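(* Let $d$ be a fixed constant, let $\delta\in(0,1)$ and $\rho>0$ be arbitrary constants, and let $c$ be a suitable constant. Let $P$ be any set of $n$ points in $\mathbb{R}^d$ and let $k$ be an integer with $k<n$ and $k=\Omega((\log n)^c)$. Let $\mathrm{OPT}$ denote the optimal cost of the $k$-center clustering problem for $P$. There exists an MPC algorithm that in $\mathcal{O}(\log\log n)$ rounds determines, with high probability, a set $T\subseteq P$ of $k+o(k)$ centers such that $\mathrm{COST}(P,T)=\mathcal{O}(\log^* n)\cdot \mathrm{OPT}$. The MPC uses local space $\mathcal{S}=\mathcal{O}(n^{\delta})$ per machine and global space $\mathcal{T}=\widetilde{\mathcal{O}}(n^{1+\rho}\cdot\log^2\Delta)$.
   Context: MPC (Massively Parallel Computation) model: there are $\mathcal{M}$ machines, each with $\mathcal{S}$ words of local memory; the global space is $\mathcal{T}=\mathcal{S}\cdot\mathcal{M}$. Computation proceeds in synchronous rounds; in each round every machine performs arbitrary local computation on its memory and then sends messages to other machines (each message addressed to one machine); each machine sends and receives at most $\mathcal{S}$ words per round. Distances are Euclidean, $d(p,q)$; for a set $S$, $d(p,S)=\min_{q\in S}d(p,q)$, and $\mathrm{COST}(P,S)=\max_{p\in P}d(p,S)$. The input is rescaled so that the minimum distance between two distinct points of $P$ is $1$, and $\Delta$ is the maximum distance between two points of $P$. The $k$-center problem for $P$ asks for $S^*=\arg\min_{S\subseteq P,|S|=k}\mathrm{COST}(P,S)$, and $\mathrm{OPT}=\mathrm{COST}(P,S^* )$. $\log^* n$ is the iterated logarithm. $\widetilde{\mathcal{O}}(f)$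 hides factors polynomial in $\log f$. "With high probability" means with probability at least $1-1/n^{\Omega(1)}$. *)

theory Defs
  imports
    "HOL-Probability.Probability"
    "HOL-Probability.Product_PMF"
    "HOL-Library.Landau_Symbols"
begin

definition log_star :: "nat \<Rightarrow> nat" where
  "log_star n = (LEAST i. (log 2 ^^ i) (real n) \<le> 1)"

subsection \<open>The k-center problem\<close>

text \<open>The minima and maxima below are over finite nonempty sets whenever \<open>P\<close> is finite
  with at least two points, \<open>C\<close> is finite and nonempty, and \<open>1 \<le> k \<le> card P\<close>;
  outside of this range the values are meaningless.\<close>

definition min_separation :: "'p::metric_space set \<Rightarrow> real" where
  "min_separation P = Min {dist p q | p q. p \<in> P \<and> q \<in> P \<and> p \<noteq> q}"

definition point_dist :: "'p::metric_space \<Rightarrow> 'p set \<Rightarrow> real" where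
  "point_dist p C = Min (dist p ` C)"

definition kcenter_cost :: "'p::metric_space set \<Rightarrow> 'p set \<Rightarrow> real" where
  "kcenter_cost P C = Max ((\<lambda>p. point_dist p C) ` P)"

definition kcenter_opt :: "'p::metric_space set \<Rightarrow> nat \<Rightarrow> real" where
  "kcenter_opt P k = Min (kcenter_cost P ` {C. C \<subseteq> P \<and> card C = k})"

subsection \<open>The MPC model\<close>

text \<open>If a word could hold an arbitrary real number, then, local computation being arbitrary,
  one word could encode the entire input and the space bounds would be void. Hence a
  word is either a number, to be bounded by a polynomial in the global space (that is,
  \<open>O(log T)\<close> bits, enough to address the global memory), or belongs to the representation of
  an input point. A point is moved as a unit and is charged \<open>s\<close> words
  (one per coordinate); its exact coordinates are available to local computation.\<close>

datatype 'p word = Num nat | Pt 'p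

fun word_size :: "nat \<Rightarrow> 'p word \<Rightarrow> nat" where
  "word_size s (Num _) = 1"
| "word_size s (Pt _) = s"

definition space :: "nat \<Rightarrow> 'p word list \<Rightarrow> nat" where
  "space s ws = sum_list (map (word_size s) ws)"

fun valid_word :: "'p set \<Rightarrow> nat \<Rightarrow> 'p word \<Rightarrow> bool" where
  "valid_word P B (Num m) \<longleftrightarrow> m \<le> B"
| "valid_word P B (Pt p) \<longleftrightarrow> p \<in> P"

text \<open>The state of one machine: its memory and a list of one-word messages. In a mailbox
  that was received, the address of a message is its sender; in one to be sent, its destination.\<close>

type_synonym 'p machine_state = "'p word list \<times> (nat \<times> 'p word) list"

type_synonym 'p config = "nat \<Rightarrow> 'p machine_state"

text \<open>A randomized program maps the round number, the identity of a machine, and its memory and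
  received messages to a distribution on its new memory and the messages to be sent.\<close>

type_synonym 'p program = "nat \<Rightarrow> nat \<Rightarrow> 'p machine_state \<Rightarrow> 'p machine_state pmf"

definition local_phase :: "'p program \<Rightarrow> nat \<Rightarrow> nat \<Rightarrow> 'p config \<Rightarrow> 'p config pmf" where
  "local_phase A M t c = Pi_pmf {..<M} ([], []) (\<lambda>i. A t i (c i))"

definition inbox :: "nat \<Rightarrow> 'p config \<Rightarrow> nat \<Rightarrow> (nat \<times> 'p word) list" where
  "inbox M r j =
     concat (map (\<lambda>i. map (\<lambda>(_, w). (i, w)) (filter (\<lambda>(dest, _). dest = j) (snd (r i)))) [0..<M])"

definition communicate :: "nat \<Rightarrow> 'p config \<Rightarrow> 'p config" where
  "communicate M r = (\<lambda>j. if j < M then (fst (r j), inbox M r j) else ([], []))"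

primrec mpc_run :: "'p program \<Rightarrow> nat \<Rightarrow> nat \<Rightarrow> 'p config \<Rightarrow> 'p config pmf" where
  "mpc_run A M 0 c = return_pmf c"
| "mpc_run A M (Suc t) c =
     bind_pmf (mpc_run A M t c) (\<lambda>c'. map_pmf (communicate M) (local_phase A M t c'))"

definition mpc_admissible :: "'p set \<Rightarrow> nat \<Rightarrow> nat \<Rightarrow> nat \<Rightarrow> nat \<Rightarrow> 'p config \<Rightarrow> bool" where
  "mpc_admissible P s B M S r \<longleftrightarrow>
     (\<forall>i<M.
        (\<forall>w \<in> set (fst (r i)). valid_word P B w) \<and>
        (\<forall>(dest, w) \<in> set (snd (r i)). dest < M \<and> valid_word P B w) \<and>
        space s (fst (r i)) \<le> S \<and>
        space s (map snd (snd (r i))) \<le> S \<and>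
        space s (map snd (inbox M r i)) \<le> S)"

text \<open>The limits of the model are hard: they hold in every possible execution, not merely
  with high probability.\<close>

definition mpc_respects :: "'p program \<Rightarrow> 'p set \<Rightarrow> nat \<Rightarrow> nat \<Rightarrow> nat \<Rightarrow> nat \<Rightarrow> nat \<Rightarrow> 'p config \<Rightarrow> bool" where
  "mpc_respects A P s B M S R c \<longleftrightarrow>
     (\<forall>t<R. \<forall>c' \<in> set_pmf (mpc_run A M t c). \<forall>r \<in> set_pmf (local_phase A M t c').
        mpc_admissible P s B M S r)"

text \<open>The input is distributed arbitrarily, each point on exactly one machine.\<close>

definition input_config :: "'p set \<Rightarrow> nat \<Rightarrow> nat \<Rightarrow> nat \<Rightarrow> 'p config \<Rightarrow> bool" where
  "input_config P s M S c \<longleftrightarrow>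
     mset (concat (map (\<lambda>i. fst (c i)) [0..<M])) = image_mset Pt (mset_set P) \<and>
     (\<forall>i<M. space s (fst (c i)) \<le> S \<and> snd (c i) = []) \<and>
     (\<forall>i\<ge>M. c i = ([], []))"

definition mpc_output :: "nat \<Rightarrow> 'p config \<Rightarrow> 'p set" where
  "mpc_output M c = {p. \<exists>i<M. Pt p \<in> set (fst (c i))}"

end

theory Submission
  imports Defs "HOL-Combinatorics.List_Permutation" "HOL-Real_Asymp.Real_Asymp"
begin

text \<open>
  Let \<open>r\<close> be a guess with \<open>OPT \<le> r \<le> 2 OPT\<close>, and partition the space by a grid of side \<open>X r\<close> with \<open>X = log\<^sup>* n + 2\<close>,
  shifted diagonally by \<open>t r\<close> for some \<open>t < X\<close>. In every coordinate at most two of the \<open>X\<close> shifts cut a given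
  optimal ball, and a ball that is cut meets at most \<open>2\<^sup>d\<close> cells. By averaging, some shift leaves at most
  \<open>k (1 + O(1 / X))\<close> nonempty cells, and one representative of each nonempty cell is a solution of cost \<open>O(X r)\<close>.
  Since \<open>k < n\<close>, the excess is \<open>o(k)\<close> as a function of \<open>k\<close> alone.

  All guesses and shifts are tried in parallel, each on its own copy of the input. Representatives are found by
  sorting the points of a copy by their cell. Columnsort with \<open>b\<close> columns, recursively, sorts \<open>b\<^sup>t\<close> items in a number of
  rounds that depends only on \<open>t\<close>, communicating along fixed permutations; counting and the choice of
  the best copy are reductions along the base-\<open>b\<close> digits of the address. The algorithm is deterministic and, with
  \<open>b = \<lceil>n powr (1 / E)\<rceil>\<close> for a constant \<open>E\<close>, takes a constant number of rounds.
\<close>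

subsection \<open>Oblivious array programs\<close>

text \<open>Two obstacles shape the proof. The limits of the model hold in every execution, so no
  routing may depend on where the points lie: an unlucky input would flood a machine. Only sorting
  moves data in a data-dependent way, and it communicates along fixed permutations. Moreover,
  neither \<open>OPT\<close> nor the good shift is known. The selection keeps, among the copies with
  at most \<open>k (1 + O(1 / X))\<close> nonempty cells, one of least radius. A guess in
  \<open>[OPT, 2 OPT]\<close> with a good shift passes this test, so the winner has radius at most
  \<open>2 OPT\<close>. It may lie below \<open>OPT\<close>: its cells are then even smaller, and
  few by the test itself.

  Space: a copy takes \<open>b ^ E\<close> cells, about \<open>n\<close>. One further digit of the
  address numbers the shift and \<open>q\<close> digits number the guess, which gives
  \<open>b ^ (E + 1 + q)\<close> cells of five words. In the dyadic case \<open>b ^ q\<close>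
  exceeds the number of guesses by at most \<open>b ^ 2\<close>, and the slack \<open>b ^ 3\<close>
  is absorbed by \<open>n powr \<rho>\<close>. A machine holds \<open>b ^ 3\<close> cells because
  Columnsort with \<open>b\<close> columns wants columns of length at least
  \<open>2 * b ^ 2\<close>.\<close>

definition bij_below :: "nat \<Rightarrow> (nat \<Rightarrow> nat) \<Rightarrow> bool" where
  "bij_below N \<sigma> \<longleftrightarrow> bij \<sigma> \<and> (\<forall>u. \<sigma> u < N \<longleftrightarrow> u < N)"

text \<open>Words are conserved up to \<open>V\<close>, so no machine can invent a point, and the
  result at \<open>w\<close> sees only the block of \<open>w\<close>. \<open>atoms\<close> gives the
  words on a wire, which lets a wire be a single word or a whole cell of five.\<close>

definition local_op ::
  "('a \<Rightarrow> 'w set) \<Rightarrow> 'w set \<Rightarrow> nat \<Rightarrow> ((nat \<Rightarrow> 'a) \<Rightarrow> nat \<Rightarrow> 'a) \<Rightarrow> bool" where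
  "local_op atoms V B F \<longleftrightarrow>
     (\<forall>x w. atoms (F x w) \<subseteq> V \<union> (\<Union>u\<in>{u. u div B = w div B}. atoms (x u))) \<and>
     (\<forall>x y w. (\<forall>u. u div B = w div B \<longrightarrow> x u = y u) \<longrightarrow> F x w = F y w)"

text \<open>One round: every machine recomputes its block of \<open>B\<close> wires, producing only words that it
  holds or numbers from \<open>V\<close>, and then the wires are permuted by a fixed \<open>\<sigma>\<close> that does not depend on the data.
  So every machine sends and receives exactly \<open>B\<close> wires, and the limits of the model hold by construction.\<close>

inductive realizable ::
  "('a \<Rightarrow> 'w set) \<Rightarrow> 'w set \<Rightarrow> nat \<Rightarrow> nat \<Rightarrow> nat \<Rightarrow> ((nat \<Rightarrow> 'a) \<Rightarrow> nat \<Rightarrow> 'a) \<Rightarrow> bool"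
  for atoms V B N where
  realizable_refl: "realizable atoms V B N 0 (\<lambda>x. x)"
| realizable_step: "realizable atoms V B N R G \<Longrightarrow> local_op atoms V B F \<Longrightarrow> bij_below N \<sigma> \<Longrightarrow>
    realizable atoms V B N (Suc R) (\<lambda>x u. F (G x) (\<sigma> u))"

lemma bij_below_id: "bij_below N (\<lambda>u. u)"
  by (simp add: bij_below_def bij_def)

lemma local_op_id: "local_op atoms V B (\<lambda>x. x)"
  by (auto simp: local_op_def)

lemma realizable_local: "local_op atoms V B F \<Longrightarrow> realizable atoms V B N 1 F"
  using realizable_step[OF realizable_refl _ bij_below_id] by simp

lemma realizable_perm: "bij_below N \<sigma> \<Longrightarrow> realizable atoms V B N 1 (\<lambda>x u. x (\<sigma> u))"
  using realizable_step[OF realizable_refl local_op_id] by simp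

lemma realizable_comp:
  assumes "realizable atoms V B N R G" "realizable atoms V B N R' G'"
  shows "realizable atoms V B N (R + R') (\<lambda>x. G' (G x))"
  using assms(2,1)
proof induction
  case realizable_refl
  then show ?case by simp
next
  case (realizable_step R' G' F \<sigma>)
  then show ?case
    using realizable.realizable_step[of atoms V B N "R + R'" "\<lambda>x. G' (G x)" F \<sigma>] by simp
qed

text \<open>The length of the pipeline varies with the diameter, while the number of rounds must be
  a function of \<open>n\<close>. Idle rounds equalize it.\<close>

lemma realizable_pad:
  assumes "realizable atoms V B N R G" "R \<le> R'"
  shows "realizable atoms V B N R' G"
  using assms(2)
proof (induction R' rule: dec_induct)
  case base
  then show ?case using assms(1) .
next
  case (step m)
  then show ?case
    using realizable_step[OF step.IH local_op_id bij_below_id] by simp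
qed

section \<open>Permutations of the wires\<close>

lemma bij_below_inv:
  assumes "bij_below N \<sigma>"
  shows "bij_below N (inv \<sigma>)" "\<sigma> (inv \<sigma> u) = u" "inv \<sigma> (\<sigma> u) = u"
proof -
  have b: "bij \<sigma>" using assms by (simp add: bij_below_def)
  show 1: "\<sigma> (inv \<sigma> u) = u" for u using b by (simp add: bij_is_surj surj_f_inv_f)
  show "inv \<sigma> (\<sigma> u) = u" using b by (simp add: bij_is_inj)
  show "bij_below N (inv \<sigma>)"
    using assms b 1 by (metis bij_below_def bij_imp_bij_inv)
qed

lemma bij_belowI:
  assumes "\<And>u. \<tau> (\<sigma> u) = u" "\<And>u. \<sigma> (\<tau> u) = u"
    and "\<And>u. u < N \<Longrightarrow> \<sigma> u < N" "\<And>u. u < N \<Longrightarrow> \<tau> u < N"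
  shows "bij_below N \<sigma>"
proof -
  have "bij \<sigma>" using o_bij[of \<tau> \<sigma>] assms(1,2) by (auto simp: comp_def fun_eq_iff id_def)
  then show ?thesis using assms by (metis bij_below_def)
qed

text \<open>A data movement is specified only on the wires that matter. As \<open>A\<close> and its
  image miss equally many wires below \<open>N\<close>, the remaining ones can be matched
  arbitrarily.\<close>

lemma bij_below_extend:
  assumes "inj_on f A" "A \<subseteq> {..<N}" "f ` A \<subseteq> {..<N}"
  shows "\<exists>\<sigma>. bij_below N \<sigma> \<and> (\<forall>u\<in>A. \<sigma> u = f u)"
proof -
  have "card ({..<N} - A) = card ({..<N} - f ` A)"
    using assms by (simp add: card_Diff_subset finite_subset card_image)
  then obtain g where g: "bij_betw g ({..<N} - A) ({..<N} - f ` A)"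
    using finite_same_card_bij[of "{..<N} - A" "{..<N} - f ` A"] by auto
  define \<sigma> where "\<sigma> u = (if u \<in> A then f u else if u < N then g u else u)" for u
  have 1: "bij_betw \<sigma> A (f ` A)"
    using assms(1) by (simp add: bij_betw_def \<sigma>_def inj_on_def)
  have 2: "bij_betw \<sigma> ({..<N} - A) ({..<N} - f ` A)"
    using g by (rule bij_betw_cong[THEN iffD1, rotated]) (auto simp: \<sigma>_def)
  have "bij_betw \<sigma> (A \<union> ({..<N} - A)) (f ` A \<union> ({..<N} - f ` A))"
    by (rule bij_betw_combine[OF 1 2]) auto
  then have 3: "bij_betw \<sigma> {..<N} {..<N}"
    using assms(2,3) by (simp add: Un_absorb1)
  have 4: "bij_betw \<sigma> (- {..<N}) (- {..<N})"
    using assms(2) by (auto simp: bij_betw_def \<sigma>_def inj_on_def image_def)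
  have "{..<N} \<union> - {..<N} = UNIV" by blast
  then have "bij \<sigma>" using bij_betw_combine[OF 3 4] by (metis Compl_disjoint)
  moreover have "\<sigma> u < N \<longleftrightarrow> u < N" for u
    using bij_betwE[OF 3] bij_betwE[OF 4] by (metis ComplI ComplD lessThan_iff)
  ultimately show ?thesis unfolding bij_below_def by (auto simp: \<sigma>_def)
qed

section \<open>Compilation of array programs into MPC programs\<close>

primrec iterate_ops ::
  "(nat \<Rightarrow> (nat \<Rightarrow> 'a) \<Rightarrow> nat \<Rightarrow> 'a) \<Rightarrow> (nat \<Rightarrow> nat \<Rightarrow> nat) \<Rightarrow> (nat \<Rightarrow> 'a) \<Rightarrow> nat \<Rightarrow> nat \<Rightarrow> 'a" where
  "iterate_ops F \<sigma> x 0 = x"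
| "iterate_ops F \<sigma> x (Suc t) = (\<lambda>u. F t (iterate_ops F \<sigma> x t) (\<sigma> t u))"

lemma iterate_ops_cong:
  "(\<And>t'. t' < t \<Longrightarrow> F t' = F' t' \<and> \<sigma> t' = \<sigma>' t') \<Longrightarrow> iterate_ops F \<sigma> x t = iterate_ops F' \<sigma>' x t"
  by (induction t) auto

lemma realizable_imp_iterate_ops:
  assumes "realizable atoms V B N R G"
  shows "\<exists>F \<sigma>. (\<forall>t. local_op atoms V B (F t)) \<and> (\<forall>t. bij_below N (\<sigma> t)) \<and>
           (\<forall>x. G x = iterate_ops F \<sigma> x R)"
  using assms
proof induction
  case realizable_refl
  then show ?case
    by (intro exI[of _ "\<lambda>_ x. x"] exI[of _ "\<lambda>_ u. u"]) (simp add: local_op_id bij_below_id)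
next
  case (realizable_step R G F' \<sigma>')
  then obtain F \<sigma> where *: "\<forall>t. local_op atoms V B (F t)" "\<forall>t. bij_below N (\<sigma> t)"
    "\<forall>x. G x = iterate_ops F \<sigma> x R" by blast
  have "iterate_ops (F(R := F')) (\<sigma>(R := \<sigma>')) x R = iterate_ops F \<sigma> x R" for x
    by (rule iterate_ops_cong) auto
  then show ?case
    using * realizable_step.hyps
    by (intro exI[of _ "F(R := F')"] exI[of _ "\<sigma>(R := \<sigma>')"]) (simp del: fun_upd_apply add: fun_upd_same, simp)
qed

text \<open>A message shows its sender but not its wire. The inbox lists the senders in increasing
  order and each sender lists its wires in increasing order, so zipping it with the increasing list
  of the wires destined for machine \<open>i\<close> recovers the labels. Wire \<open>u\<close>
  receives what was computed at wire \<open>\<sigma> (t - 1) u\<close>; therefore wire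
  \<open>w\<close> is sent to the owner of its inverse image.\<close>

definition decode_wires ::
  "nat \<Rightarrow> nat \<Rightarrow> (nat \<Rightarrow> nat \<Rightarrow> nat) \<Rightarrow> nat \<Rightarrow> nat \<Rightarrow> 'p machine_state \<Rightarrow> nat \<Rightarrow> 'p word" where
  "decode_wires N \<beta> \<sigma> t i st u =
     (if t = 0 then (if u mod \<beta> < length (fst st) then fst st ! (u mod \<beta>) else Num 0)
      else the (map_of (zip (filter (\<lambda>w. inv (\<sigma> (t - 1)) w div \<beta> = i) [0..<N]) (map snd (snd st)))
             (\<sigma> (t - 1) u)))"

text \<open>In each of the first \<open>R\<close> rounds all wires travel as messages, even those
  that stay on their machine, and the memory is left empty. Round \<open>R\<close> stores the last
  mailbox, because the output is read from the memory; hence the \<open>Suc R\<close> rounds of the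
  compiled program.\<close>

definition array_program ::
  "nat \<Rightarrow> nat \<Rightarrow> nat \<Rightarrow> (nat \<Rightarrow> (nat \<Rightarrow> 'p word) \<Rightarrow> nat \<Rightarrow> 'p word) \<Rightarrow> (nat \<Rightarrow> nat \<Rightarrow> nat) \<Rightarrow> 'p program" where
  "array_program N \<beta> R F \<sigma> t i st = return_pmf
     (if t < R then ([], map (\<lambda>w. (inv (\<sigma> t) w div \<beta>, F t (decode_wires N \<beta> \<sigma> t i st) w)) [i * \<beta>..<i * \<beta> + \<beta>])
      else (map (decode_wires N \<beta> \<sigma> t i st) [i * \<beta>..<i * \<beta> + \<beta>], []))"

definition initial_array :: "nat \<Rightarrow> 'p config \<Rightarrow> nat \<Rightarrow> 'p word" where
  "initial_array \<beta> c u = (if u mod \<beta> < length (fst (c (u div \<beta>))) then fst (c (u div \<beta>)) ! (u mod \<beta>) else Num 0)"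

lemma concat_blocks: "concat (map (\<lambda>i. [i * \<beta>..<i * \<beta> + \<beta>]) [0..<m]) = [0..<m * \<beta>]"
proof (induction m)
  case (Suc m)
  then show ?case using upt_add_eq_append[of 0 "m * \<beta>" \<beta>] by (simp add: add.commute)
qed simp

lemma map_snd_inbox:
  assumes "\<And>i. i < m \<Longrightarrow> snd (r i) = map (\<lambda>w. (dst w, y w)) [i * \<beta>..<i * \<beta> + \<beta>]"
  shows "map snd (inbox m r j) = map y (filter (\<lambda>w. dst w = j) [0..<m * \<beta>])"
proof -
  have "map snd (inbox m r j) = concat (map (\<lambda>i. map snd (filter (\<lambda>(dest, _). dest = j) (snd (r i)))) [0..<m])"
    by (simp add: inbox_def map_concat comp_def case_prod_unfold)
  also have "\<dots> = concat (map (\<lambda>i. map y (filter (\<lambda>w. dst w = j) [i * \<beta>..<i * \<beta> + \<beta>])) [0..<m])"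
    by (intro arg_cong[where f = concat] map_cong refl)
       (simp add: assms filter_map comp_def)
  also have "\<dots> = map y (filter (\<lambda>w. dst w = j) (concat (map (\<lambda>i. [i * \<beta>..<i * \<beta> + \<beta>]) [0..<m])))"
    by (simp add: map_concat filter_concat comp_def)
  finally show ?thesis by (simp only: concat_blocks)
qed

lemma space_le: "1 \<le> s \<Longrightarrow> space s ws \<le> s * length ws"
proof (induction ws)
  case (Cons w ws)
  then show ?case by (cases w) (auto simp: space_def)
qed (simp add: space_def)

lemma div_block_iff: "0 < \<beta> \<Longrightarrow> w div \<beta> = i \<longleftrightarrow> i * \<beta> \<le> w \<and> w < i * \<beta> + (\<beta>::nat)"
  by (metis add.commute div_nat_eqI dividend_less_div_times mult.commute mult_Suc div_times_less_eq_dividend)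

text \<open>This bounds the received messages: the wires destined for \<open>j\<close> are the image
  of block \<open>j\<close> under \<open>\<sigma>\<close>.\<close>

lemma length_source_wires:
  assumes "bij_below (m * \<beta>) \<sigma>" "0 < \<beta>" "j < m"
  shows "length (filter (\<lambda>w. inv \<sigma> w div \<beta> = j) [0..<m * \<beta>]) = \<beta>"
proof -
  have "length (filter (\<lambda>w. inv \<sigma> w div \<beta> = j) [0..<m * \<beta>]) = card {w. w < m * \<beta> \<and> inv \<sigma> w div \<beta> = j}"
    by (subst distinct_card[symmetric]) (auto intro!: arg_cong[where f = card])
  also have "{w. w < m * \<beta> \<and> inv \<sigma> w div \<beta> = j} = \<sigma> ` {j * \<beta>..<j * \<beta> + \<beta>}"
  proof (intro set_eqI iffI)
    fix w assume "w \<in> {w. w < m * \<beta> \<and> inv \<sigma> w div \<beta> = j}"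
    then show "w \<in> \<sigma> ` {j * \<beta>..<j * \<beta> + \<beta>}"
      using bij_below_inv(2)[OF assms(1), of w] assms(2)
      by (intro image_eqI[of _ _ "inv \<sigma> w"]) (auto simp: div_block_iff)
  next
    fix w assume "w \<in> \<sigma> ` {j * \<beta>..<j * \<beta> + \<beta>}"
    then obtain u where u: "w = \<sigma> u" "j * \<beta> \<le> u" "u < j * \<beta> + \<beta>" by auto
    have "j * \<beta> + \<beta> \<le> m * \<beta>" using assms(3) by (metis Suc_leI mult_Suc mult_le_mono1 add.commute)
    then show "w \<in> {w. w < m * \<beta> \<and> inv \<sigma> w div \<beta> = j}"
      using u assms(1,2) bij_below_inv(3)[OF assms(1), of u]
      by (auto simp: div_block_iff bij_below_def)
  qed
  also have "card \<dots> = \<beta>"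
    using assms(1) by (subst card_image) (auto simp: bij_below_def bij_def inj_on_def)
  finally show ?thesis .
qed

lemma iterate_ops_valid:
  assumes "\<forall>t. local_op (\<lambda>w. {w}) V B (F t)" "\<And>u. x u \<in> V \<union> W"
  shows "iterate_ops F \<sigma> x t u \<in> V \<union> W"
proof (induction t arbitrary: u)
  case (Suc t)
  have "{F t (iterate_ops F \<sigma> x t) (\<sigma> t u)} \<subseteq> V \<union> (\<Union>u'\<in>{u'. u' div B = \<sigma> t u div B}. {iterate_ops F \<sigma> x t u'})"
    using assms(1) unfolding local_op_def by blast
  then have "F t (iterate_ops F \<sigma> x t) (\<sigma> t u) \<in> V \<or> (\<exists>u'. F t (iterate_ops F \<sigma> x t) (\<sigma> t u) = iterate_ops F \<sigma> x t u')"
    by auto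
  then show ?case using Suc by (metis UnI1 iterate_ops.simps(2))
qed (use assms in auto)

text \<open>Invariant: after \<open>t\<close> rounds each machine decodes its own block of the array
  after \<open>t\<close> array steps. \<open>F\<close> is applied to a decoding that is right only
  on this block, which is enough by locality.\<close>

lemma array_program_run:
  assumes loc: "\<forall>t. local_op (\<lambda>w. {w}) V \<beta> (F t)" and bij: "\<forall>t. bij_below (m * \<beta>) (\<sigma> t)"
    and \<beta>: "0 < \<beta>"
  fixes R :: nat and c\<^sub>0 :: "'p config"
  defines "A \<equiv> array_program (m * \<beta>) \<beta> R F \<sigma>" and "x \<equiv> iterate_ops F \<sigma> (initial_array \<beta> c\<^sub>0)"
  shows "t \<le> R \<Longrightarrow> \<exists>c. mpc_run A m t c\<^sub>0 = return_pmf c \<and>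
     (\<forall>u. u div \<beta> < m \<longrightarrow> decode_wires (m * \<beta>) \<beta> \<sigma> t (u div \<beta>) (c (u div \<beta>)) u = x t u)"
    and "t < R \<Longrightarrow> mpc_run A m t c\<^sub>0 = return_pmf c \<Longrightarrow> local_phase A m t c = return_pmf (\<lambda>i. if i < m
       then ([], map (\<lambda>w. (inv (\<sigma> t) w div \<beta>, F t (x t) w)) [i * \<beta>..<i * \<beta> + \<beta>]) else ([], []))"
proof -
  define sent where "sent t = (\<lambda>i. if i < m
    then ([], map (\<lambda>w. (inv (\<sigma> t) w div \<beta>, F t (x t) w)) [i * \<beta>..<i * \<beta> + \<beta>]) else ([] :: 'p word list, []))"
    for t :: nat
  have phase: "local_phase A m t c = return_pmf (sent t)"
    if dec: "\<forall>u. u div \<beta> < m \<longrightarrow> decode_wires (m * \<beta>) \<beta> \<sigma> t (u div \<beta>) (c (u div \<beta>)) u = x t u"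
      and t: "t < R" for t c
  proof -
    have "F t (decode_wires (m * \<beta>) \<beta> \<sigma> t i (c i)) w = F t (x t) w"
      if "i < m" "w \<in> {i * \<beta>..<i * \<beta> + \<beta>}" for i w
    proof -
      have w: "w div \<beta> = i" using that \<beta> by (simp add: div_block_iff)
      have "\<forall>u. u div \<beta> = w div \<beta> \<longrightarrow> decode_wires (m * \<beta>) \<beta> \<sigma> t i (c i) u = x t u"
        using dec w that(1) by metis
      then show ?thesis using loc unfolding local_op_def by blast
    qed
    then show ?thesis
      using t unfolding local_phase_def A_def array_program_def sent_def
      by (auto simp: fun_eq_iff)
  qed
  have main: "t \<le> R \<Longrightarrow> \<exists>c. mpc_run A m t c\<^sub>0 = return_pmf c \<and>
     (\<forall>u. u div \<beta> < m \<longrightarrow> decode_wires (m * \<beta>) \<beta> \<sigma> t (u div \<beta>) (c (u div \<beta>)) u = x t u)" for t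
  proof (induction t)
    case 0
    then show ?case by (simp add: decode_wires_def x_def initial_array_def)
  next
    case (Suc t)
    then obtain c where c: "mpc_run A m t c\<^sub>0 = return_pmf c"
      "\<forall>u. u div \<beta> < m \<longrightarrow> decode_wires (m * \<beta>) \<beta> \<sigma> t (u div \<beta>) (c (u div \<beta>)) u = x t u" by auto
    have run: "mpc_run A m (Suc t) c\<^sub>0 = return_pmf (communicate m (sent t))"
      using c phase[OF c(2)] Suc.prems by (simp add: bind_return_pmf)
    have "decode_wires (m * \<beta>) \<beta> \<sigma> (Suc t) (u div \<beta>) (communicate m (sent t) (u div \<beta>)) u = x (Suc t) u"
      if "u div \<beta> < m" for u
    proof -
      let ?L = "filter (\<lambda>w. inv (\<sigma> t) w div \<beta> = u div \<beta>) [0..<m * \<beta>]"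
      have "map snd (inbox m (sent t) (u div \<beta>)) = map (F t (x t)) ?L"
        by (rule map_snd_inbox) (simp add: sent_def)
      moreover have "u < m * \<beta>" using that \<beta> by (simp add: div_less_iff_less_mult)
      then have "\<sigma> t u \<in> set ?L"
        using bij by (auto simp: bij_below_def bij_below_inv(3)[OF bij[rule_format]])
      ultimately show ?thesis using that
        by (simp add: decode_wires_def communicate_def map_of_zip_map x_def)
    qed
    then show ?case using run by blast
  qed
  show "t \<le> R \<Longrightarrow> \<exists>c. mpc_run A m t c\<^sub>0 = return_pmf c \<and>
     (\<forall>u. u div \<beta> < m \<longrightarrow> decode_wires (m * \<beta>) \<beta> \<sigma> t (u div \<beta>) (c (u div \<beta>)) u = x t u)"
    using main .
  show "local_phase A m t c = return_pmf (\<lambda>i. if i < m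
       then ([], map (\<lambda>w. (inv (\<sigma> t) w div \<beta>, F t (x t) w)) [i * \<beta>..<i * \<beta> + \<beta>]) else ([], []))"
    if "t < R" "mpc_run A m t c\<^sub>0 = return_pmf c"
    using main[of t] that phase[of t c] by (auto simp: sent_def)
qed

text \<open>The program is fixed before \<open>P\<close>, \<open>s\<close> and the initial
  configuration, so it cannot depend on the data. Every wire is charged \<open>s\<close> words, also
  when it carries a number, whence the local space \<open>s * \<beta>\<close>.\<close>

lemma realizable_imp_program:
  assumes real: "realizable (\<lambda>w. {w}) (Num ` {..Bd}) \<beta> (m * \<beta>) R G" and \<beta>: "0 < \<beta>"
  shows "\<exists>A :: 'p program. \<forall>P s Bd' c\<^sub>0. 1 \<le> s \<longrightarrow> Bd \<le> Bd' \<longrightarrow> finite P \<longrightarrow> input_config P s m (s * \<beta>) c\<^sub>0 \<longrightarrow>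
     mpc_respects A P s Bd' m (s * \<beta>) (Suc R) c\<^sub>0 \<and>
     (\<exists>c. mpc_run A m (Suc R) c\<^sub>0 = return_pmf c \<and>
        mpc_output m c = {p. \<exists>w<m * \<beta>. G (initial_array \<beta> c\<^sub>0) w = Pt p})"
proof -
  obtain F \<sigma> where loc: "\<forall>t. local_op (\<lambda>w. {w}) (Num ` {..Bd}) \<beta> (F t)"
    and bij: "\<forall>t. bij_below (m * \<beta>) (\<sigma> t)" and G: "\<And>x. G x = iterate_ops F \<sigma> x R"
    using realizable_imp_iterate_ops[OF real] by blast
  define A :: "'p program" where "A = array_program (m * \<beta>) \<beta> R F \<sigma>"
  show ?thesis
  proof (intro exI[of _ A] allI impI)
    fix P :: "'p set" and s Bd' :: nat and c\<^sub>0
    assume s: "1 \<le> s" and Bd: "Bd \<le> Bd'" and P: "finite P" and inp: "input_config P s m (s * \<beta>) c\<^sub>0"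
    define x where "x = iterate_ops F \<sigma> (initial_array \<beta> c\<^sub>0)"
    note run = array_program_run[OF loc bij \<beta>, where R = R and ?c\<^sub>0 = c\<^sub>0, folded A_def x_def]
    have words: "set (fst (c\<^sub>0 i)) \<subseteq> Pt ` P" for i
    proof (cases "i < m")
      case True
      have "set_mset (mset (concat (map (\<lambda>i. fst (c\<^sub>0 i)) [0..<m]))) = Pt ` P"
        using inp P by (simp add: input_config_def)
      then show ?thesis using True by auto
    next
      case False
      then show ?thesis using inp by (auto simp: input_config_def)
    qed
    have "initial_array \<beta> c\<^sub>0 u \<in> Num ` {..Bd} \<union> Pt ` P" for u
      using words[of "u div \<beta>"] by (auto simp: initial_array_def dest!: nth_mem)
    then have xv: "x t u \<in> Num ` {..Bd} \<union> Pt ` P" for t u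
      unfolding x_def by (rule iterate_ops_valid[OF loc])
    have valid: "valid_word P Bd' (x t u)" for t u
      using xv[of t u] Bd by auto
    have Fx: "valid_word P Bd' (F t (x t) u)" for t u
      using valid[of "Suc t" "inv (\<sigma> t) u"] by (simp add: x_def bij_below_inv(2)[OF bij[rule_format]])
    define fin where "fin = (\<lambda>i. if i < m then (map (x R) [i * \<beta>..<i * \<beta> + \<beta>], [] :: (nat \<times> 'p word) list) else ([], []))"
    have last: "local_phase A m R c = return_pmf fin" if "mpc_run A m R c\<^sub>0 = return_pmf c" for c
    proof -
      have "decode_wires (m * \<beta>) \<beta> \<sigma> R i (c i) w = x R w" if "i < m" "w \<in> {i * \<beta>..<i * \<beta> + \<beta>}" for i w
        using run(1)[of R] \<open>mpc_run A m R c\<^sub>0 = return_pmf c\<close> that \<beta>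
        by (metis atLeastLessThan_iff div_block_iff order_refl return_pmf_inj)
      then show ?thesis
        by (auto simp: local_phase_def A_def array_program_def fin_def fun_eq_iff)
    qed
    have adm_fin: "mpc_admissible P s Bd' m (s * \<beta>) fin"
    proof -
      have "inbox m fin i = []" for i by (simp add: inbox_def fin_def)
      then show ?thesis
        using valid space_le[OF s, of "map (x R) [i * \<beta>..<i * \<beta> + \<beta>]" for i]
        by (auto simp: mpc_admissible_def fin_def space_def)
    qed
    define sent where "sent t = (\<lambda>i. if i < m
      then ([], map (\<lambda>w. (inv (\<sigma> t) w div \<beta>, F t (x t) w)) [i * \<beta>..<i * \<beta> + \<beta>]) else ([] :: 'p word list, []))"
      for t :: nat
    have adm: "mpc_admissible P s Bd' m (s * \<beta>) (sent t)" for t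
    proof -
      have "inv (\<sigma> t) w div \<beta> < m" if "i < m" "w < i * \<beta> + \<beta>" for i w
      proof -
        have "i * \<beta> + \<beta> \<le> m * \<beta>" using that by (metis Suc_leI mult_Suc mult_le_mono1 add.commute)
        then have "w < m * \<beta>" using that by simp
        then have "inv (\<sigma> t) w < m * \<beta>"
          using bij_below_inv(1)[OF bij[rule_format, of t]] by (simp add: bij_below_def)
        then show ?thesis using \<beta> by (simp add: div_less_iff_less_mult)
      qed
      moreover have "space s (map snd (snd (sent t i))) \<le> s * \<beta>" if "i < m" for i
        using space_le[OF s, of "map snd (snd (sent t i))"] that by (simp add: sent_def)
      moreover have "space s (map snd (inbox m (sent t) i)) \<le> s * \<beta>" if "i < m" for i
      proof -
        have "map snd (inbox m (sent t) i) = map (F t (x t)) (filter (\<lambda>w. inv (\<sigma> t) w div \<beta> = i) [0..<m * \<beta>])"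
          by (rule map_snd_inbox) (simp add: sent_def)
        then show ?thesis
          using space_le[OF s, of "map snd (inbox m (sent t) i)"]
            length_source_wires[OF bij[rule_format] \<beta> that, of t] by simp
      qed
      ultimately show ?thesis
        using Fx by (auto simp: mpc_admissible_def sent_def space_def)
    qed
    have resp: "mpc_respects A P s Bd' m (s * \<beta>) (Suc R) c\<^sub>0"
      unfolding mpc_respects_def
    proof (intro allI impI ballI)
      fix t c' r
      assume t: "t < Suc R" and c': "c' \<in> set_pmf (mpc_run A m t c\<^sub>0)" and r: "r \<in> set_pmf (local_phase A m t c')"
      have "mpc_run A m t c\<^sub>0 = return_pmf c'"
        using run(1)[of t] t c' by auto
      then show "mpc_admissible P s Bd' m (s * \<beta>) r"
        using run(2)[of t c'] last[of c'] r t adm[of t] adm_fin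
        by (cases "t < R") (auto simp: sent_def less_Suc_eq)
    qed
    obtain c where c: "mpc_run A m R c\<^sub>0 = return_pmf c" using run(1)[of R] by auto
    have "mpc_run A m (Suc R) c\<^sub>0 = return_pmf (communicate m fin)"
      using c last[OF c] by (simp add: bind_return_pmf)
    moreover have "mpc_output m (communicate m fin) = {p. \<exists>w<m * \<beta>. x R w = Pt p}"
    proof (intro set_eqI iffI)
      fix p assume "p \<in> mpc_output m (communicate m fin)"
      then obtain i w where iw: "i < m" "w < i * \<beta> + \<beta>" "x R w = Pt p"
        by (auto simp: mpc_output_def communicate_def fin_def)
      have "i * \<beta> + \<beta> \<le> m * \<beta>" using iw by (metis Suc_leI mult_Suc mult_le_mono1 add.commute)
      then show "p \<in> {p. \<exists>w<m * \<beta>. x R w = Pt p}" using iw by (metis (mono_tags) less_le_trans mem_Collect_eq)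
    next
      fix p assume "p \<in> {p. \<exists>w<m * \<beta>. x R w = Pt p}"
      then obtain w where w: "w < m * \<beta>" "x R w = Pt p" by auto
      then have "w div \<beta> < m" using \<beta> by (simp add: div_less_iff_less_mult)
      moreover have "w \<in> {w div \<beta> * \<beta>..<w div \<beta> * \<beta> + \<beta>}" using \<beta> div_block_iff[of \<beta> w "w div \<beta>"] by simp
      ultimately show "p \<in> mpc_output m (communicate m fin)"
        using w(2) by (auto simp: mpc_output_def communicate_def fin_def intro!: exI[of _ "w div \<beta>"] image_eqI[of _ _ w])
    qed
    ultimately show "mpc_respects A P s Bd' m (s * \<beta>) (Suc R) c\<^sub>0 \<and>
     (\<exists>c. mpc_run A m (Suc R) c\<^sub>0 = return_pmf c \<and>
        mpc_output m c = {p. \<exists>w<m * \<beta>. G (initial_array \<beta> c\<^sub>0) w = Pt p})"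
      using resp by (simp add: G x_def)
  qed
qed

subsection \<open>Columnsort\<close>

lemma down_closed_eq_lessThan_card:
  fixes D :: "nat set"
  assumes "D \<subseteq> {..<r}" "\<And>i j. i \<le> j \<Longrightarrow> j \<in> D \<Longrightarrow> i \<in> D"
  shows "i \<in> D \<longleftrightarrow> i < card D"
proof -
  have fin: "finite D" using assms(1) finite_subset by blast
  show ?thesis
  proof
    assume "i \<in> D"
    then have "{..i} \<subseteq> D" using assms(2) by auto
    then show "i < card D" using card_mono[OF fin, of "{..i}"] by simp
  next
    assume "i < card D"
    show "i \<in> D"
    proof (rule ccontr)
      assume "i \<notin> D"
      then have "D \<subseteq> {..<i}" using assms(2) by (metis lessThan_iff not_le subsetI)
      then show False using card_mono[of "{..<i}" D] \<open>i < card D\<close> by simp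
    qed
  qed
qed

lemma card_blocks:
  "card {i. i < c * r \<and> g i} = (\<Sum>k<c. card {j. j < r \<and> g (k * r + j)})" for c r :: nat
proof (induction c)
  case (Suc c)
  have "{i. i < Suc c * r \<and> g i} = {i. i < c * r \<and> g i} \<union> (\<lambda>j. c * r + j) ` {j. j < r \<and> g (c * r + j)}"
  proof (intro set_eqI iffI)
    fix i assume i: "i \<in> {i. i < Suc c * r \<and> g i}"
    show "i \<in> {i. i < c * r \<and> g i} \<union> (\<lambda>j. c * r + j) ` {j. j < r \<and> g (c * r + j)}"
    proof (cases "i < c * r")
      case False
      then have "i = c * r + (i - c * r)" "i - c * r < r" using i by auto
      then show ?thesis using i by (intro UnI2 image_eqI[of _ _ "i - c * r"]) auto
    qed (use i in auto)
  qed (auto simp: add.commute)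
  moreover have "{i. i < c * r \<and> g i} \<inter> (\<lambda>j. c * r + j) ` {j. j < r \<and> g (c * r + j)} = {}" by auto
  ultimately have "card {i. i < Suc c * r \<and> g i} = card {i. i < c * r \<and> g i} + card ((\<lambda>j. c * r + j) ` {j. j < r \<and> g (c * r + j)})"
    by (simp add: card_Un_disjoint)
  also have "card ((\<lambda>j. c * r + j) ` {j. j < r \<and> g (c * r + j)}) = card {j. j < r \<and> g (c * r + j)}"
    by (intro card_image) (simp add: inj_on_def)
  finally show ?case using Suc by simp
qed simp

text \<open>True stands for a small key. Sorting a block cannot enlarge the window from
  \<open>lo\<close> to \<open>hi\<close> that contains all disorder: up to a position before
  \<open>lo\<close> all entries are true, so their number exceeds its index; for a position from
  \<open>hi\<close> on, all true entries of the block precede it.\<close>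

lemma block_sort_window:
  assumes g: "i < r" "g (s + i) \<longleftrightarrow> i < card {i. i < r \<and> f (s + i)}"
  shows "(\<And>q. q < s + r \<Longrightarrow> q < lo \<Longrightarrow> f q) \<Longrightarrow> s + i < lo \<Longrightarrow> g (s + i)"
    and "(\<And>q. q < s + r \<Longrightarrow> hi \<le> q \<Longrightarrow> \<not> f q) \<Longrightarrow> hi \<le> s + i \<Longrightarrow> \<not> g (s + i)"
proof -
  assume "\<And>q. q < s + r \<Longrightarrow> q < lo \<Longrightarrow> f q" "s + i < lo"
  then have "{..i} \<subseteq> {i. i < r \<and> f (s + i)}" using g(1) by auto
  then have "card {..i} \<le> card {i. i < r \<and> f (s + i)}" by (intro card_mono) auto
  then show "g (s + i)" using g(2) by simp
next
  assume *: "\<And>q. q < s + r \<Longrightarrow> hi \<le> q \<Longrightarrow> \<not> f q" "hi \<le> s + i"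
  have "{i. i < r \<and> f (s + i)} \<subseteq> {..<i}"
  proof
    fix j assume "j \<in> {i. i < r \<and> f (s + i)}"
    then have "\<not> hi \<le> s + j" using *(1) by auto
    then show "j \<in> {..<i}" using *(2) by simp
  qed
  then have "card {i. i < r \<and> f (s + i)} \<le> card {..<i}" by (intro card_mono) auto
  then show "\<not> g (s + i)" using g(2) by simp
qed

text \<open>Sorted column \<open>l\<close> is a run of \<open>Z l\<close> true entries. The
  transposition deals its entries in turn to the \<open>c\<close> new columns, each of which thus
  gets \<open>Z l div c\<close> true ones or one more. Summing over the \<open>c\<close> old
  columns, the counts differ by at most \<open>c\<close>. By \<open>c dvd r\<close> the dealing
  starts afresh at new column 0 in every old column.\<close>

lemma columnsort_counts:
  fixes c r :: nat and f1 :: "nat \<Rightarrow> bool" and Z :: "nat \<Rightarrow> nat"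
  assumes "0 < c" "c dvd r"
    and f1: "\<And>k i. k < c \<Longrightarrow> i < r \<Longrightarrow> f1 (k * r + i) \<longleftrightarrow> i < Z k"
    and Z: "\<And>k. k < c \<Longrightarrow> Z k \<le> r"
  shows "\<exists>Q. \<forall>k<c. Q \<le> card {i. i < r \<and> f1 (i * c + k)} \<and> card {i. i < r \<and> f1 (i * c + k)} \<le> Q + c"
proof -
  obtain r' where r': "r = c * r'" using assms(2) by blast
  define Q where "Q = (\<Sum>l<c. Z l div c)"
  have "Q \<le> card {i. i < r \<and> f1 (i * c + k)} \<and> card {i. i < r \<and> f1 (i * c + k)} \<le> Q + c" if k: "k < c" for k
  proof -
    have eq: "card {i. i < r \<and> f1 (i * c + k)} = (\<Sum>l<c. card {j. j < r' \<and> f1 ((l * r' + j) * c + k)})"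
      unfolding r' by (rule card_blocks)
    have b: "Z l div c \<le> card {j. j < r' \<and> f1 ((l * r' + j) * c + k)} \<and>
             card {j. j < r' \<and> f1 ((l * r' + j) * c + k)} \<le> Z l div c + 1" if l: "l < c" for l
    proof -
      have pos: "(l * r' + j) * c + k = l * r + (j * c + k)" for j by (simp add: r' algebra_simps)
      have lt: "j * c + k < r" if "j < r'" for j
      proof -
        have "j * c + k < Suc j * c" using k by simp
        also have "\<dots> \<le> r" using that unfolding r' by (metis Suc_leI mult.commute mult_le_mono2)
        finally show ?thesis .
      qed
      have S: "{j. j < r' \<and> f1 ((l * r' + j) * c + k)} = {j. j < r' \<and> j * c + k < Z l}"
        using f1[OF l] lt by (auto simp: pos)
      have "{..<Z l div c} \<subseteq> {j. j < r' \<and> j * c + k < Z l}"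
      proof
        fix j assume "j \<in> {..<Z l div c}"
        then have "Suc j * c \<le> Z l" by (metis Suc_leI lessThan_iff div_times_less_eq_dividend le_trans mult_le_mono1)
        moreover then have "Suc j * c \<le> r' * c" using Z[OF l] r' by (simp add: mult.commute)
        then have "j < r'" using \<open>0 < c\<close> by (metis Suc_le_eq mult_le_cancel2)
        ultimately show "j \<in> {j. j < r' \<and> j * c + k < Z l}" using k by simp
      qed
      then have "card {..<Z l div c} \<le> card {j. j < r' \<and> j * c + k < Z l}" by (intro card_mono) auto
      moreover have "{j. j < r' \<and> j * c + k < Z l} \<subseteq> {..Z l div c}"
        by (auto simp: less_eq_div_iff_mult_less_eq \<open>0 < c\<close>)
      then have "card {j. j < r' \<and> j * c + k < Z l} \<le> card {..Z l div c}" by (intro card_mono) auto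
      ultimately show ?thesis by (simp add: S)
    qed
    have "Q \<le> (\<Sum>l<c. card {j. j < r' \<and> f1 ((l * r' + j) * c + k)})"
      unfolding Q_def using b by (intro sum_mono) auto
    moreover have "(\<Sum>l<c. card {j. j < r' \<and> f1 ((l * r' + j) * c + k)}) \<le> (\<Sum>l<c. Z l div c + 1)"
      using b by (intro sum_mono) auto
    moreover have "(\<Sum>l<c. Z l div c + 1) = Q + c" by (simp only: sum.distrib Q_def) simp
    ultimately show ?thesis unfolding eq by simp
  qed
  then show ?thesis by blast
qed

text \<open>Leighton's Columnsort on \<open>c\<close> columns of length \<open>r\<close>, observed through one threshold: \<open>f1\<close> and \<open>f3\<close> are
  the states after sorting the columns, before and after the transposition. After the transposition the counts
  of the columns differ by at most \<open>c\<close>, so after undoing it (\<open>f4\<close>) only a window of length \<open>c\<^sup>2\<close> is unsorted. The window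
  lies inside a column or inside a column shifted by \<open>c\<^sup>2\<close>.\<close>

lemma columnsort_threshold:
  fixes c r :: nat and f1 f3 f4 f5 f8 :: "nat \<Rightarrow> bool"
  assumes c: "0 < c" "c dvd r" "2 * (c * c) \<le> r"
    and f1: "\<And>k i. k < c \<Longrightarrow> i < r \<Longrightarrow> f1 (k * r + i) \<longleftrightarrow> i < Z k" "\<And>k. k < c \<Longrightarrow> Z k \<le> r"
    and f3: "\<And>k i. k < c \<Longrightarrow> i < r \<Longrightarrow> f3 (k * r + i) \<longleftrightarrow> i < card {i. i < r \<and> f1 (i * c + k)}"
    and f4: "\<And>k i. k < c \<Longrightarrow> i < r \<Longrightarrow> f4 (i * c + k) \<longleftrightarrow> f3 (k * r + i)"
    and f5: "\<And>k i. k < c \<Longrightarrow> i < r \<Longrightarrow> f5 (k * r + i) \<longleftrightarrow> i < card {i. i < r \<and> f4 (k * r + i)}"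
    and f8: "\<And>k i. 0 < k \<Longrightarrow> k < c \<Longrightarrow> i < r \<Longrightarrow>
               f8 (k * r - c * c + i) \<longleftrightarrow> i < card {i. i < r \<and> f5 (k * r - c * c + i)}"
            "\<And>p. p < c * r \<Longrightarrow> p < r - c * c \<or> c * r - c * c \<le> p \<Longrightarrow> f8 p \<longleftrightarrow> f5 p"
    and pq: "p \<le> q" "q < c * r" "f8 q"
  shows "f8 p"
proof -
  define h where "h = c * c"
  have h: "0 < h" "2 * h \<le> r" "h \<le> r" using c by (auto simp: h_def)
  obtain Q where Q: "\<And>k. k < c \<Longrightarrow> Q \<le> card {i. i < r \<and> f1 (i * c + k)}"
    "\<And>k. k < c \<Longrightarrow> card {i. i < r \<and> f1 (i * c + k)} \<le> Q + c"
    using columnsort_counts[OF c(1,2) f1] by blast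
  \<comment> \<open>Once the transposition is undone, a position is row times \<open>c\<close> plus
    column. All rows before \<open>Q\<close> are true and all rows from \<open>Q + c\<close> on are
    false, so the disorder lies in the \<open>c * c\<close> positions from \<open>c * Q\<close>
    on.\<close>
  define lo where "lo = c * Q"
  have col: "u div r < c" "u mod r < r" "u = u div r * r + u mod r" if "u < c * r" for u
    using that h by (auto simp: div_less_iff_less_mult)
  have blk: "k * r + r \<le> c * r" if "k < c" for k
    using that by (metis Suc_leI mult_Suc mult_le_mono1 add.commute)
  have f4w: "f4 u" if "u < c * r" "u < lo" for u
  proof -
    have r: "u div c < r" "u mod c < c" using that c by (auto simp: div_less_iff_less_mult mult.commute)
    have "u div c < Q" using that c by (simp add: lo_def div_less_iff_less_mult mult.commute)
    then have "u div c < card {i. i < r \<and> f1 (i * c + u mod c)}" using Q(1)[OF r(2)] by simp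
    then show ?thesis using f3[OF r(2,1)] f4[OF r(2,1)] by simp
  qed
  have f4w': "\<not> f4 u" if "u < c * r" "lo + h \<le> u" for u
  proof -
    have r: "u div c < r" "u mod c < c" using that c by (auto simp: div_less_iff_less_mult mult.commute)
    have "(Q + c) * c \<le> u" using that by (simp add: lo_def h_def algebra_simps)
    then have "Q + c \<le> u div c" using c by (simp add: less_eq_div_iff_mult_less_eq)
    then have "card {i. i < r \<and> f1 (i * c + u mod c)} \<le> u div c" using Q(2)[OF r(2)] by simp
    then show ?thesis using f3[OF r(2,1)] f4[OF r(2,1)] by simp
  qed
  have f5w: "f5 u" if "u < c * r" "u < lo" for u
  proof -
    note cu = col(1,2)[OF that(1)]
    have "f5 (u div r * r + u mod r)"
      by (rule block_sort_window(1)[where f = f4 and lo = lo and g = f5 and s = "u div r * r", OF cu(2) f5[OF cu]])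
         (use that(2) f4w less_le_trans[OF _ blk[OF cu(1)]] in auto)
    then show ?thesis by simp
  qed
  have f5w': "\<not> f5 u" if "u < c * r" "lo + h \<le> u" for u
  proof -
    note cu = col(1,2)[OF that(1)]
    have "\<not> f5 (u div r * r + u mod r)"
      by (rule block_sort_window(2)[where f = f4 and hi = "lo + h" and g = f5 and s = "u div r * r", OF cu(2) f5[OF cu]])
         (use that(2) f4w' less_le_trans[OF _ blk[OF cu(1)]] in auto)
    then show ?thesis by simp
  qed
  have shifted: "\<exists>k i. 0 < k \<and> k < c \<and> i < r \<and> u = k * r - h + i"
    if u: "u < c * r" "\<not> (u < r - h \<or> c * r - h \<le> u)" for u
  proof -
    define k i where "k = (u + h) div r" and "i = (u + h) mod r"
    have "0 < r" using h by simp
    have "u + h < c * r" "r \<le> u + h" using u h by auto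
    then have "0 < k" "k < c" "i < r"
      using \<open>0 < r\<close> by (auto simp: k_def i_def div_less_iff_less_mult div_greater_zero_iff)
    moreover have "u + h = k * r + i" by (simp add: k_def i_def)
    moreover have "1 * r \<le> k * r" using \<open>0 < k\<close> by (intro mult_le_mono1) simp
    ultimately have "u = k * r - h + i" using h by linarith
    then show ?thesis using \<open>0 < k\<close> \<open>k < c\<close> \<open>i < r\<close> by blast
  qed
  have shblk: "k * r - h + r \<le> c * r" if "k < c" for k using blk[OF that] h by linarith
  have f8w: "f8 u" if u: "u < c * r" "u < lo" for u
  proof (cases "u < r - h \<or> c * r - h \<le> u")
    case True
    then show ?thesis using f8(2)[OF u(1)] f5w[OF u] by (simp add: h_def)
  next
    case False
    then obtain k i where ki: "0 < k" "k < c" "i < r" "u = k * r - h + i" using shifted[OF u(1)] by blast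
    show ?thesis unfolding ki(4)
      by (rule block_sort_window(1)[where f = f5 and lo = lo and g = f8 and s = "k * r - h", OF ki(3) f8(1)[OF ki(1-3), folded h_def]])
         (use f5w less_le_trans[OF _ shblk[OF ki(2)]] u(2) ki(4) in auto)
  qed
  have f8w': "\<not> f8 u" if u: "u < c * r" "lo + h \<le> u" for u
  proof (cases "u < r - h \<or> c * r - h \<le> u")
    case True
    then show ?thesis using f8(2)[OF u(1)] f5w'[OF u] by (simp add: h_def)
  next
    case False
    then obtain k i where ki: "0 < k" "k < c" "i < r" "u = k * r - h + i" using shifted[OF u(1)] by blast
    show ?thesis unfolding ki(4)
      by (rule block_sort_window(2)[where f = f5 and hi = "lo + h" and g = f8 and s = "k * r - h", OF ki(3) f8(1)[OF ki(1-3), folded h_def]])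
         (use f5w' less_le_trans[OF _ shblk[OF ki(2)]] u(2) ki(4) in auto)
  qed
  show ?thesis
  proof (rule ccontr)
    assume np: "\<not> f8 p"
    have p: "p < c * r" using pq by simp
    have dirty: "lo \<le> p" "q < lo + h" using np f8w[OF p] f8w'[OF pq(2)] pq(3) by (meson not_le)+
    define i where "i = lo div r"
    have i: "i * r \<le> lo" "lo < i * r + r"
      using h div_block_iff[of r lo i] by (auto simp: i_def)
    show False
    proof (cases "lo + h \<le> i * r + r \<or> c \<le> Suc i")
      case True
      \<comment> \<open>Here the window does not leave column \<open>i\<close>, so sorting the
        columns has already made \<open>f5\<close> monotone. It then remains to see that sorting the
        shifted columns changes nothing.\<close>
      have f5s: "f5 u" if uv: "u \<le> v" "v < c * r" "f5 v" for u v
      proof (rule ccontr)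
        assume nu: "\<not> f5 u"
        have "lo \<le> u" "v < lo + h" using nu f5w[of u] f5w'[of v] uv by (meson not_le le_less_trans)+
        moreover have "c * r \<le> i * r + r" if "c \<le> Suc i" using that mult_le_mono1[OF that, of r] by simp
        ultimately have "i * r \<le> u" "v < i * r + r" using True i uv by auto
        then have "u div r = i" "v div r = i" using uv h by (auto simp: div_block_iff)
        then have a: "u = i * r + (u - i * r)" "v = i * r + (v - i * r)" "u - i * r \<le> v - i * r" "v - i * r < r" "i < c"
          using uv col(1)[of v] \<open>i * r \<le> u\<close> \<open>v < i * r + r\<close> by auto
        then show False using f5[of i "u - i * r"] f5[of i "v - i * r"] nu uv(3)
          by (metis le_less_trans)
      qed
      have "f8 u = f5 u" if u: "u < c * r" for u
      proof (cases "u < r - h \<or> c * r - h \<le> u")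
        case True
        then show ?thesis using f8(2)[OF u(1)] by (simp add: h_def)
      next
        case False
        then obtain k i where ki: "0 < k" "k < c" "i < r" "u = k * r - h + i" using shifted[OF u(1)] by blast
        define D where "D = {i. i < r \<and> f5 (k * r - h + i)}"
        have "i \<in> D \<longleftrightarrow> i < card D"
        proof (rule down_closed_eq_lessThan_card)
          show "D \<subseteq> {..<r}" by (auto simp: D_def)
          show "a \<in> D" if "a \<le> b" "b \<in> D" for a b
            using that f5s[of "k * r - h + a" "k * r - h + b"] shblk[OF ki(2)] by (auto simp: D_def)
        qed
        then show ?thesis using f8(1)[OF ki(1-3)] ki by (simp add: D_def h_def)
      qed
      then show False using f5s[OF pq(1,2)] np pq p by auto
    next
      case False
      then have "Suc i < c" by simp
      \<comment> \<open>The window straddles the column boundary \<open>Suc i * r\<close>. By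
        \<open>2 * h \<le> r\<close> it fits into the shifted column that starts \<open>h\<close>
        before this boundary.\<close>
      moreover have "Suc i * r - h \<le> p" "q < Suc i * r - h + r" using False dirty h i by auto
      then obtain a a' where a: "p = Suc i * r - h + a" "q = Suc i * r - h + a'" "a \<le> a'" "a' < r"
        using pq(1) that[of "p - (Suc i * r - h)" "q - (Suc i * r - h)"] by simp
      ultimately show False using f8(1)[of "Suc i" a] f8(1)[of "Suc i" a'] np pq(3) by (auto simp: h_def)
    qed
  qed
qed

section \<open>Sorting the segments of an array\<close>

definition segment_perm :: "nat \<Rightarrow> nat set \<Rightarrow> (nat \<Rightarrow> nat) \<Rightarrow> bool" where
  "segment_perm r A \<sigma> \<longleftrightarrow> bij \<sigma> \<and> (\<forall>u. \<sigma> u div r = u div r) \<and> (\<forall>u. u div r \<notin> A \<longrightarrow> \<sigma> u = u)"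

text \<open>The permutation may depend on the data, but it fixes every segment outside
  \<open>A\<close> pointwise. Columnsort relies on this for the shifted column that joins the two
  ends.\<close>

definition sorts_segments :: "('a \<Rightarrow> nat) \<Rightarrow> nat \<Rightarrow> nat set \<Rightarrow> ((nat \<Rightarrow> 'a) \<Rightarrow> nat \<Rightarrow> 'a) \<Rightarrow> bool" where
  "sorts_segments key r A G \<longleftrightarrow>
     (\<forall>x. (\<exists>\<sigma>. segment_perm r A \<sigma> \<and> (\<forall>u. G x u = x (\<sigma> u))) \<and>
          (\<forall>u v. u \<le> v \<longrightarrow> u div r = v div r \<longrightarrow> u div r \<in> A \<longrightarrow> key (G x u) \<le> key (G x v)))"

definition on_segments :: "nat \<Rightarrow> nat set \<Rightarrow> (nat \<Rightarrow> nat) \<Rightarrow> nat \<Rightarrow> nat" where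
  "on_segments n A \<pi> u = (if u div n \<in> A then u div n * n + \<pi> (u mod n) else u)"

lemma segment_perm_comp: "segment_perm r A \<sigma> \<Longrightarrow> segment_perm r A \<tau> \<Longrightarrow> segment_perm r A (\<lambda>u. \<sigma> (\<tau> u))"
  using bij_comp[of \<tau> \<sigma>] by (auto simp: segment_perm_def comp_def)

lemma segment_perm_coarsen:
  assumes "segment_perm r A' \<sigma>" "\<And>K. K \<in> A' \<Longrightarrow> K div c \<in> A"
  shows "segment_perm (r * c) A \<sigma>"
  using assms unfolding segment_perm_def by (metis div_mult2_eq)

lemma segment_perm_on_segments:
  assumes "\<And>p. p < n \<Longrightarrow> \<pi> p < n" "\<And>p. p < n \<Longrightarrow> \<pi>' p < n"
    and "\<And>p. p < n \<Longrightarrow> \<pi> (\<pi>' p) = p" "\<And>p. p < n \<Longrightarrow> \<pi>' (\<pi> p) = p" and n: "0 < n"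
  shows "segment_perm n A (on_segments n A \<pi>)"
proof -
  have d: "on_segments n A \<pi>1 u div n = u div n" "u div n \<in> A \<Longrightarrow> on_segments n A \<pi>1 u mod n = \<pi>1 (u mod n)"
    if "\<And>p. p < n \<Longrightarrow> \<pi>1 p < n" for \<pi>1 u
    using that[of "u mod n"] n by (auto simp: on_segments_def)
  have 1: "on_segments n A \<pi> (on_segments n A \<pi>' u) = u" for u
    using d[of \<pi>' u, OF assms(2)] assms(3)[of "u mod n"] n
    by (auto simp: on_segments_def[of n A \<pi>] simp: on_segments_def[of n A \<pi>' u])
  have 2: "on_segments n A \<pi>' (on_segments n A \<pi> u) = u" for u
    using d[of \<pi> u, OF assms(1)] assms(4)[of "u mod n"] n
    by (auto simp: on_segments_def[of n A \<pi>'] simp: on_segments_def[of n A \<pi> u])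
  have "bij (on_segments n A \<pi>)"
    by (rule o_bij[of "on_segments n A \<pi>'"]) (auto simp: fun_eq_iff 1 2)
  moreover have "on_segments n A \<pi> u div n = u div n" for u using d(1)[of \<pi> u] assms(1) by blast
  ultimately show ?thesis by (simp add: segment_perm_def) (simp add: on_segments_def)
qed

lemma segment_perm_bij_below:
  assumes "segment_perm n A \<sigma>" "n dvd N" "0 < n"
  shows "bij_below N \<sigma>"
proof -
  obtain m where m: "N = n * m" using assms(2) by blast
  have "u < N \<longleftrightarrow> u div n < m" for u
    unfolding m using assms(3) by (simp add: div_less_iff_less_mult mult.commute)
  then show ?thesis using assms(1) by (simp add: segment_perm_def bij_below_def)
qed

text \<open>The bridge to the Boolean lemmas, in the spirit of the 0-1 principle: the permutation
  preserves the number of keys up to \<open>\<tau>\<close>, and sortedness makes them an initial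
  piece of the segment.\<close>

lemma sorts_segments_threshold:
  assumes S: "sorts_segments key r A S" and K: "K \<in> A" and i: "i < r"
  shows "key (S x (K * r + i)) \<le> \<tau> \<longleftrightarrow> i < card {i. i < r \<and> key (x (K * r + i)) \<le> \<tau>}"
proof -
  obtain \<sigma> where \<sigma>: "segment_perm r A \<sigma>" "\<And>u. S x u = x (\<sigma> u)"
    using S unfolding sorts_segments_def by metis
  define D where "D = {i. i < r \<and> key (S x (K * r + i)) \<le> \<tau>}"
  have K': "(K * r + i) div r = K" if "i < r" for i using that by simp
  have "i \<in> D \<longleftrightarrow> i < card D"
  proof (rule down_closed_eq_lessThan_card)
    show "D \<subseteq> {..<r}" by (auto simp: D_def)
    fix a b assume ab: "a \<le> b" "b \<in> D"
    then have "a < r" "b < r" by (auto simp: D_def)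
    then have "key (S x (K * r + a)) \<le> key (S x (K * r + b))"
      using S ab K K' unfolding sorts_segments_def by (metis add_le_cancel_left)
    then show "a \<in> D" using ab by (auto simp: D_def)
  qed
  moreover have "bij_betw (\<lambda>i. \<sigma> (K * r + i) mod r) D {i. i < r \<and> key (x (K * r + i)) \<le> \<tau>}"
  proof -
    have e: "K * r + \<sigma> (K * r + i) mod r = \<sigma> (K * r + i)" if "i < r" for i
      using \<sigma>(1) K'[OF that] unfolding segment_perm_def by (metis div_mult_mod_eq)
    have inj: "inj \<sigma>" using \<sigma>(1) by (simp add: segment_perm_def bij_is_inj)
    show ?thesis unfolding bij_betw_def
    proof
      show "inj_on (\<lambda>i. \<sigma> (K * r + i) mod r) D"
        by (rule inj_onI) (use e inj in \<open>metis (mono_tags, lifting) D_def add_left_cancel injD mem_Collect_eq\<close>)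
      show "(\<lambda>i. \<sigma> (K * r + i) mod r) ` D = {i. i < r \<and> key (x (K * r + i)) \<le> \<tau>}"
      proof (intro set_eqI iffI)
        fix j assume "j \<in> (\<lambda>i. \<sigma> (K * r + i) mod r) ` D"
        then show "j \<in> {i. i < r \<and> key (x (K * r + i)) \<le> \<tau>}"
          using e i \<sigma>(2) by (auto simp: D_def)
      next
        fix j assume j: "j \<in> {i. i < r \<and> key (x (K * r + i)) \<le> \<tau>}"
        obtain u where u: "\<sigma> u = K * r + j" using \<sigma>(1) by (metis segment_perm_def bij_pointE)
        then have "u div r = K" using \<sigma>(1) j by (metis (mono_tags, lifting) K' mem_Collect_eq segment_perm_def)
        then have "u = K * r + u mod r" "u mod r < r" using i by (auto simp: mult.commute)
        then show "j \<in> (\<lambda>i. \<sigma> (K * r + i) mod r) ` D"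
          using u j \<sigma>(2)[of u] by (intro image_eqI[of _ _ "u mod r"]) (auto simp: D_def)
      qed
    qed
  qed
  then have "card D = card {i. i < r \<and> key (x (K * r + i)) \<le> \<tau>}" by (rule bij_betw_same_card)
  ultimately show ?thesis using i by (simp add: D_def)
qed

text \<open>Transposition of an \<open>r\<close> by \<open>c\<close> matrix; exchanging
  \<open>r\<close> and \<open>c\<close> inverts it. With powers of \<open>b\<close> in place of
  \<open>r\<close> and \<open>c\<close> it also describes the rotation of digits.\<close>

lemma transpose_index:
  fixes r c p :: nat
  assumes "p < r * c"
  shows "p mod r * c + p div r < r * c"
    and "(p mod r * c + p div r) mod c * r + (p mod r * c + p div r) div c = p"
proof -
  have rc: "0 < r" "0 < c" using assms by (auto intro: Nat.gr0I)
  have 1: "p div r < c" using assms rc by (simp add: div_less_iff_less_mult mult.commute)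
  have "p mod r * c + p div r < Suc (p mod r) * c" using 1 by simp
  also have "\<dots> \<le> r * c" using rc by (intro mult_le_mono1) (simp add: Suc_leI)
  finally show "p mod r * c + p div r < r * c" .
  show "(p mod r * c + p div r) mod c * r + (p mod r * c + p div r) div c = p"
    using 1 rc by simp
qed

text \<open>The shift is cyclic, so the first shifted column joins the two ends of the segment; \<open>S'\<close> must leave it alone.\<close>

lemma columnsort_step:
  fixes r c :: nat
  assumes c: "0 < c" "c dvd r" "2 * (c * c) \<le> r" and r: "0 < r"
    and S: "sorts_segments key r {K. K div c \<in> A} S"
    and S': "sorts_segments key r {K. K div c \<in> A \<and> K mod c \<noteq> 0} S'"
  defines "n \<equiv> r * c"
  defines "tr \<equiv> on_segments n A (\<lambda>p. p mod r * c + p div r)"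
    and "tr' \<equiv> on_segments n A (\<lambda>p. p mod c * r + p div c)"
    and "sh \<equiv> on_segments n A (\<lambda>p. (p + (n - c * c)) mod n)"
    and "sh' \<equiv> on_segments n A (\<lambda>p. (p + c * c) mod n)"
  shows "segment_perm n A tr" "segment_perm n A tr'" "segment_perm n A sh" "segment_perm n A sh'"
    "sorts_segments key n A (\<lambda>x u. S' (\<lambda>u. S (\<lambda>u. S (\<lambda>u. S x (tr u)) (tr' u)) (sh u)) (sh' u))"
proof -
  define h where "h = c * c"
  have h: "0 < h" "h \<le> r" "2 * h \<le> r" using c by (auto simp: h_def)
  have n: "0 < n" "r \<le> n" using c r by (auto simp: n_def)
  have hn: "h \<le> n" using h n by simp
  have [simp]: "n - c * c = n - h" by (simp add: h_def)
  show tr: "segment_perm n A tr" unfolding tr_def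
    by (rule segment_perm_on_segments[where \<pi>' = "\<lambda>p. p mod c * r + p div c"])
       (use transpose_index[of _ r c] transpose_index[of _ c r] n in \<open>auto simp: n_def mult.commute\<close>)
  show tr': "segment_perm n A tr'" unfolding tr'_def
    by (rule segment_perm_on_segments[where \<pi>' = "\<lambda>p. p mod r * c + p div r"])
       (use transpose_index[of _ r c] transpose_index[of _ c r] n in \<open>auto simp: n_def mult.commute\<close>)
  have cyc: "((p + (n - h)) mod n + h) mod n = p" "((p + h) mod n + (n - h)) mod n = p" if "p < n" for p
  proof -
    have "((p + (n - h)) mod n + h) mod n = (p + n) mod n" using hn by (simp add: mod_add_left_eq)
    then show "((p + (n - h)) mod n + h) mod n = p" using that by simp
    have "((p + h) mod n + (n - h)) mod n = (p + h + (n - h)) mod n" by (rule mod_add_left_eq)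
    then show "((p + h) mod n + (n - h)) mod n = p" using that hn by simp
  qed
  show sh: "segment_perm n A sh" unfolding sh_def
    by (rule segment_perm_on_segments[where \<pi>' = "\<lambda>p. (p + h) mod n"]) (use cyc n in auto)
  show sh': "segment_perm n A sh'" unfolding sh'_def h_def[symmetric]
    by (rule segment_perm_on_segments[where \<pi>' = "\<lambda>p. (p + (n - h)) mod n"]) (use cyc n in auto)
  show "sorts_segments key n A (\<lambda>x u. S' (\<lambda>u. S (\<lambda>u. S (\<lambda>u. S x (tr u)) (tr' u)) (sh u)) (sh' u))"
    unfolding sorts_segments_def
  proof (intro allI conjI impI)
    fix x :: "nat \<Rightarrow> 'a"
    define x1 where "x1 = S x"
    define x3 where "x3 = S (\<lambda>u. x1 (tr u))"
    define x4 where "x4 = (\<lambda>u. x3 (tr' u))"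
    define x5 where "x5 = S x4"
    define x7 where "x7 = S' (\<lambda>u. x5 (sh u))"
    have eq: "S' (\<lambda>u. S (\<lambda>u. S (\<lambda>u. S x (tr u)) (tr' u)) (sh u)) (sh' u) = x7 (sh' u)" for u
      by (simp add: x1_def x3_def x4_def x5_def x7_def)
    have pS: "\<exists>\<sigma>. segment_perm n A \<sigma> \<and> (\<forall>u. S y u = y (\<sigma> u))" for y
      using S unfolding sorts_segments_def n_def by (metis (mono_tags, lifting) mem_Collect_eq segment_perm_coarsen)
    have pS': "\<exists>\<sigma>. segment_perm n A \<sigma> \<and> (\<forall>u. S' y u = y (\<sigma> u))" for y
      using S' unfolding sorts_segments_def n_def by (metis (mono_tags, lifting) mem_Collect_eq segment_perm_coarsen)
    obtain \<sigma>1 where \<sigma>1: "segment_perm n A \<sigma>1" "\<And>u. x1 u = x (\<sigma>1 u)" using pS[of x] by (auto simp: x1_def)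
    obtain \<sigma>3 where \<sigma>3: "segment_perm n A \<sigma>3" "\<And>u. x3 u = x1 (tr (\<sigma>3 u))"
      using pS[of "\<lambda>u. x1 (tr u)"] by (auto simp: x3_def)
    obtain \<sigma>5 where \<sigma>5: "segment_perm n A \<sigma>5" "\<And>u. x5 u = x4 (\<sigma>5 u)" using pS[of x4] by (auto simp: x5_def)
    obtain \<sigma>7 where \<sigma>7: "segment_perm n A \<sigma>7" "\<And>u. x7 u = x5 (sh (\<sigma>7 u))"
      using pS'[of "\<lambda>u. x5 (sh u)"] by (auto simp: x7_def)
    have "segment_perm n A (\<lambda>u. \<sigma>1 (tr (\<sigma>3 (tr' (\<sigma>5 (sh (\<sigma>7 (sh' u))))))))"
      using segment_perm_comp[OF \<sigma>1(1) segment_perm_comp[OF tr segment_perm_comp[OF \<sigma>3(1) segment_perm_comp[OF tr'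
        segment_perm_comp[OF \<sigma>5(1) segment_perm_comp[OF sh segment_perm_comp[OF \<sigma>7(1) sh']]]]]]] .
    then show "\<exists>\<sigma>. segment_perm n A \<sigma> \<and>
        (\<forall>u. S' (\<lambda>u. S (\<lambda>u. S (\<lambda>u. S x (tr u)) (tr' u)) (sh u)) (sh' u) = x (\<sigma> u))"
      unfolding eq by (intro exI[of _ "\<lambda>u. \<sigma>1 (tr (\<sigma>3 (tr' (\<sigma>5 (sh (\<sigma>7 (sh' u)))))))"])
        (simp add: \<sigma>1(2) \<sigma>3(2) \<sigma>5(2) \<sigma>7(2) x4_def)
    fix u v assume uv: "u \<le> v" "u div n = v div n" "u div n \<in> A"
    define J where "J = u div n"
    \<comment> \<open>Monotonicity between \<open>u\<close> and \<open>v\<close> is tested at the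
      one threshold given by the key at \<open>v\<close>.\<close>
    define \<tau> where "\<tau> = key (x7 (sh' v))"
    have J: "J \<in> A" "u = J * n + u mod n" "v = J * n + v mod n"
      using uv(3) by (simp_all add: J_def) (simp add: uv(2))
    have pos: "J * n + (k * r + i) = (J * c + k) * r + i" for k i by (simp add: n_def algebra_simps)
    have colA: "(J * c + k) div c = J" if "k < c" for k using that c by simp
    have lt: "k * r + i < n" if "k < c" "i < r" for k i
    proof -
      have "k * r + i < Suc k * r" using that by simp
      also have "\<dots> \<le> c * r" using that by (intro mult_le_mono1) simp
      finally show ?thesis by (simp add: n_def mult.commute)
    qed
    have lt': "i * c + k < n" if "k < c" "i < r" for k i
    proof -
      have "i * c + k < Suc i * c" using that by simp
      also have "\<dots> \<le> r * c" using that by (intro mult_le_mono1) simp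
      finally show ?thesis by (simp add: n_def)
    qed
    have on: "on_segments n A \<pi> (J * n + p) = J * n + \<pi> p" if "p < n" for \<pi> p
      using that J(1) by (simp add: on_segments_def)
    have tS: "key (S y (J * n + (k * r + i))) \<le> \<tau> \<longleftrightarrow> i < card {i. i < r \<and> key (y (J * n + (k * r + i))) \<le> \<tau>}"
      if "k < c" "i < r" for y k i
      unfolding pos by (rule sorts_segments_threshold[OF S _ that(2)]) (use that(1) colA J(1) in simp)
    have tS': "key (S' y (J * n + (k * r + i))) \<le> \<tau> \<longleftrightarrow> i < card {i. i < r \<and> key (y (J * n + (k * r + i))) \<le> \<tau>}"
      if "0 < k" "k < c" "i < r" for y k i
      unfolding pos by (rule sorts_segments_threshold[OF S' _ that(3)]) (use that(1,2) colA J(1) in simp)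
    have idS': "S' y (J * n + i) = y (J * n + i)" if "i < r" for y i
    proof -
      have "J * n + i = i + J * c * r" by (simp add: n_def)
      then have "(J * n + i) div r = J * c" using that by (simp only: div_mult_self1[OF r[THEN gr_implies_not0]]) simp
      then show ?thesis using S' unfolding sorts_segments_def segment_perm_def
        by (metis (mono_tags, lifting) mem_Collect_eq mod_mult_self2_is_0)
    qed
    have "(\<lambda>p. key (x7 (sh' (J * n + p))) \<le> \<tau>) (u mod n)"
    proof (rule columnsort_threshold[OF c,
          where ?f1.0 = "\<lambda>p. key (x1 (J * n + p)) \<le> \<tau>" and ?f3.0 = "\<lambda>p. key (x3 (J * n + p)) \<le> \<tau>"
            and ?f4.0 = "\<lambda>p. key (x4 (J * n + p)) \<le> \<tau>" and ?f5.0 = "\<lambda>p. key (x5 (J * n + p)) \<le> \<tau>"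
            and Z = "\<lambda>k. card {i. i < r \<and> key (x (J * n + (k * r + i))) \<le> \<tau>}" and ?f8.0 = "\<lambda>p. key (x7 (sh' (J * n + p))) \<le> \<tau>" and p = "u mod n" and q = "v mod n"])
      fix k i assume k: "k < c"
      have "card {i. i < r \<and> key (x (J * n + (k * r + i))) \<le> \<tau>} \<le> card {..<r}"
        by (intro card_mono) auto
      then show "card {i. i < r \<and> key (x (J * n + (k * r + i))) \<le> \<tau>} \<le> r" by simp
      assume i: "i < r"
      show "key (x1 (J * n + (k * r + i))) \<le> \<tau> \<longleftrightarrow> i < card {i. i < r \<and> key (x (J * n + (k * r + i))) \<le> \<tau>}"
        unfolding x1_def by (rule tS[OF k i])
      show "key (x5 (J * n + (k * r + i))) \<le> \<tau> \<longleftrightarrow> i < card {i. i < r \<and> key (x4 (J * n + (k * r + i))) \<le> \<tau>}"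
        unfolding x5_def by (rule tS[OF k i])
      have "x1 (tr (J * n + (k * r + i))) = x1 (J * n + (i * c + k))" if "i < r" for i
        using on[OF lt[OF k that]] that by (simp add: tr_def)
      then have "{i. i < r \<and> key (x1 (tr (J * n + (k * r + i)))) \<le> \<tau>} = {i. i < r \<and> key (x1 (J * n + (i * c + k))) \<le> \<tau>}"
        by auto
      then show "key (x3 (J * n + (k * r + i))) \<le> \<tau> \<longleftrightarrow> i < card {i. i < r \<and> key (x1 (J * n + (i * c + k))) \<le> \<tau>}"
        unfolding x3_def tS[OF k i] by simp
      show "key (x4 (J * n + (i * c + k))) \<le> \<tau> \<longleftrightarrow> key (x3 (J * n + (k * r + i))) \<le> \<tau>"
        using on[OF lt'[OF k i]] k by (simp add: x4_def tr'_def)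
    next
      fix k i assume k: "0 < k" "k < c" and i: "i < r"
      have kr: "r \<le> k * r" using k by (cases k) auto
      have 1: "sh' (J * n + (k * r - h + i)) = J * n + (k * r + i)" if "i < r" for i
      proof -
        have "k * r - h + i < n" "k * r - h + i + h = k * r + i" using lt[OF k(2) that] kr h by linarith+
        then show ?thesis using on[of "k * r - h + i"] lt[OF k(2) that] by (simp add: sh'_def h_def[symmetric])
      qed
      have 2: "sh (J * n + (k * r + i)) = J * n + (k * r - h + i)" if "i < r" for i
      proof -
        have "(k * r + i + (n - h)) mod n = (k * r - h + i + n) mod n"
          by (intro arg_cong2[where f = "(mod)"] refl) (use kr h hn in linarith)
        also have "\<dots> = k * r - h + i" using lt[OF k(2) that] by simp
        finally show ?thesis using on[OF lt[OF k(2) that]] by (simp add: sh_def)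
      qed
      have "{i. i < r \<and> key (x5 (sh (J * n + (k * r + i)))) \<le> \<tau>} = {i. i < r \<and> key (x5 (J * n + (k * r - h + i))) \<le> \<tau>}"
        using 2 by auto
      then show "key (x7 (sh' (J * n + (k * r - c * c + i)))) \<le> \<tau> \<longleftrightarrow>
          i < card {i. i < r \<and> key (x5 (J * n + (k * r - c * c + i))) \<le> \<tau>}"
        unfolding h_def[symmetric] 1[OF i] x7_def tS'[OF k i] by simp
    next
      fix p assume p: "p < c * r" "p < r - c * c \<or> c * r - c * c \<le> p"
      have pn: "p < n" using p by (simp add: n_def mult.commute)
      have small: "(p + h) mod n < r"
      proof (cases "p < r - h")
        case True
        then have "p + h < r" "p + h < n" using n by auto
        then show ?thesis by simp
      next
        case False
        then have "n - h \<le> p" using p by (simp add: h_def n_def mult.commute)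
        then have "(p + h) mod n = p + h - n" using pn hn h n by (simp add: mod_if)
        then show ?thesis using pn h by simp
      qed
      have "x7 (sh' (J * n + p)) = x5 (sh (J * n + (p + h) mod n))"
        using on[OF pn] idS'[OF small] by (simp add: x7_def sh'_def h_def)
      also have "sh (J * n + (p + h) mod n) = J * n + p"
        using on[of "(p + h) mod n"] n cyc(2)[OF pn] by (simp add: sh_def)
      finally show "key (x7 (sh' (J * n + p))) \<le> \<tau> \<longleftrightarrow> key (x5 (J * n + p)) \<le> \<tau>" by simp
    next
      show "u mod n \<le> v mod n" using uv(1) J by (metis add_le_cancel_left)
      show "v mod n < c * r" using n by (simp add: n_def mult.commute)
      show "key (x7 (sh' (J * n + v mod n))) \<le> \<tau>" using J(3) by (simp add: \<tau>_def)
    qed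
    then show "key (S' (\<lambda>u. S (\<lambda>u. S (\<lambda>u. S x (tr u)) (tr' u)) (sh u)) (sh' u))
        \<le> key (S' (\<lambda>u. S (\<lambda>u. S (\<lambda>u. S x (tr u)) (tr' u)) (sh u)) (sh' v))"
      unfolding eq \<tau>_def using J(2) by simp
  qed
qed

section \<open>The recursive sorting network\<close>

definition block_sort :: "('a \<Rightarrow> nat) \<Rightarrow> nat \<Rightarrow> nat set \<Rightarrow> (nat \<Rightarrow> 'a) \<Rightarrow> nat \<Rightarrow> 'a" where
  "block_sort key B A x u =
     (if u div B \<in> A then sort_key key (map x [u div B * B..<u div B * B + B]) ! (u mod B) else x u)"

lemma local_op_block_sort:
  assumes "0 < B"
  shows "local_op atoms V B (block_sort key B A)"
  unfolding local_op_def
proof (intro conjI allI impI)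
  fix x :: "nat \<Rightarrow> 'a" and w
  have "block_sort key B A x w \<in> x ` {u. u div B = w div B}"
  proof (cases "w div B \<in> A")
    case True
    have "sort_key key (map x [w div B * B..<w div B * B + B]) ! (w mod B)
        \<in> set (sort_key key (map x [w div B * B..<w div B * B + B]))"
      using assms by (intro nth_mem) simp
    then show ?thesis using True assms by (auto simp: block_sort_def div_block_iff)
  qed (auto simp: block_sort_def)
  then show "atoms (block_sort key B A x w) \<subseteq> V \<union> (\<Union>u\<in>{u. u div B = w div B}. atoms (x u))" by auto
next
  fix x y :: "nat \<Rightarrow> 'a" and w
  assume *: "\<forall>u. u div B = w div B \<longrightarrow> x u = y u"
  then have e: "x w = y w" by blast
  have L: "map x [w div B * B..<w div B * B + B] = map y [w div B * B..<w div B * B + B]"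
    using * assms by (auto simp: div_block_iff)
  show "block_sort key B A x w = block_sort key B A y w" by (simp only: block_sort_def L e)
qed

lemma sorts_segments_block_sort:
  assumes B: "0 < B"
  shows "sorts_segments key B A (block_sort key B A)"
  unfolding sorts_segments_def
proof (intro allI conjI impI)
  fix x :: "nat \<Rightarrow> 'a"
  have "\<exists>p. p permutes {..<B} \<and> permute_list p (map x [K * B..<K * B + B]) = sort_key key (map x [K * B..<K * B + B])" for K
  proof -
    have "mset (sort_key key (map x [K * B..<K * B + B])) = mset (map x [K * B..<K * B + B])" by (simp only: mset_sort)
    then obtain p where "p permutes {..<length (map x [K * B..<K * B + B])}"
      "permute_list p (map x [K * B..<K * B + B]) = sort_key key (map x [K * B..<K * B + B])"
      by (rule mset_eq_permutation)
    then show ?thesis by (intro exI[of _ p]) simp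
  qed
  then obtain p where p: "\<And>K. p K permutes {..<B}"
    "\<And>K. permute_list (p K) (map x [K * B..<K * B + B]) = sort_key key (map x [K * B..<K * B + B])" by metis
  define \<sigma> where "\<sigma> u = (if u div B \<in> A then u div B * B + p (u div B) (u mod B) else u)" for u
  define \<sigma>' where "\<sigma>' u = (if u div B \<in> A then u div B * B + inv (p (u div B)) (u mod B) else u)" for u
  have lt: "p K i < B" "inv (p K) i < B" if "i < B" for K i
    using that permutes_in_image[OF p(1)[of K]] permutes_in_image[OF permutes_inv[OF p(1)[of K]]] by auto
  have d: "\<sigma> u div B = u div B" "\<sigma>' u div B = u div B"
    "u div B \<in> A \<Longrightarrow> \<sigma> u mod B = p (u div B) (u mod B)" "u div B \<in> A \<Longrightarrow> \<sigma>' u mod B = inv (p (u div B)) (u mod B)" for u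
    using lt[of "u mod B" "u div B"] B by (auto simp: \<sigma>_def \<sigma>'_def)
  have "\<sigma>' (\<sigma> u) = u" for u
    unfolding \<sigma>'_def[of "\<sigma> u"] using d[of u] permutes_inverses[OF p(1)[of "u div B"]]
    by (cases "u div B \<in> A") (simp_all, simp add: \<sigma>_def)
  moreover have "\<sigma> (\<sigma>' u) = u" for u
    unfolding \<sigma>_def[of "\<sigma>' u"] using d[of u] permutes_inverses[OF p(1)[of "u div B"]]
    by (cases "u div B \<in> A") (simp_all, simp add: \<sigma>'_def)
  ultimately have "bij \<sigma>" by (intro o_bij[of \<sigma>']) (auto simp: fun_eq_iff)
  then have "segment_perm B A \<sigma>" using d by (auto simp: segment_perm_def \<sigma>_def)
  moreover have "block_sort key B A x u = x (\<sigma> u)" for u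
  proof (cases "u div B \<in> A")
    case True
    have "sort_key key (map x [u div B * B..<u div B * B + B]) ! (u mod B)
        = map x [u div B * B..<u div B * B + B] ! p (u div B) (u mod B)"
      unfolding p(2)[symmetric] using B p(1) by (intro permute_list_nth) auto
    also have "\<dots> = x (\<sigma> u)" using True lt[of "u mod B" "u div B"] B by (simp add: \<sigma>_def)
    finally show ?thesis using True by (simp add: block_sort_def)
  qed (simp add: block_sort_def \<sigma>_def)
  ultimately show "\<exists>\<sigma>. segment_perm B A \<sigma> \<and> (\<forall>u. block_sort key B A x u = x (\<sigma> u))" by blast
next
  fix x :: "nat \<Rightarrow> 'a" and u v assume uv: "u \<le> v" "u div B = v div B" "u div B \<in> A"
  define xs where "xs = sort_key key (map x [u div B * B..<u div B * B + B])"
  have "u mod B \<le> v mod B" using uv by (metis div_mult_mod_eq nat_add_left_cancel_le)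
  moreover have "v mod B < length (map key xs)" using B by (simp add: xs_def)
  moreover have "sorted (map key xs)" by (simp add: xs_def)
  ultimately have "map key xs ! (u mod B) \<le> map key xs ! (v mod B)" by (intro sorted_nth_mono) auto
  then have "key (xs ! (u mod B)) \<le> key (xs ! (v mod B))" using B by (simp add: xs_def)
  then show "key (block_sort key B A x u) \<le> key (block_sort key B A x v)"
    using uv by (simp add: block_sort_def xs_def)
qed

text \<open>Four column sorts alternate with four permutations of one round each; the base case
  sorts inside the machines.\<close>

fun sort_rounds :: "nat \<Rightarrow> nat" where
  "sort_rounds 0 = 1"
| "sort_rounds (Suc D) = 4 * sort_rounds D + 4"

text \<open>Each level is a Columnsort with \<open>b\<close> columns, sorted by the level below.
  \<open>A\<close> is generalized because the fourth column sort skips the columns whose number is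
  divisible by \<open>b\<close>.\<close>

lemma realizable_sort:
  assumes B: "0 < b" "b dvd B" "2 * (b * b) \<le> B" "0 < B" and N: "B * b ^ D dvd N"
  shows "\<exists>G. realizable atoms V B N (sort_rounds D) G \<and> sorts_segments key (B * b ^ D) A G"
  using N
proof (induction D arbitrary: A)
  case 0
  then show ?case
    using realizable_local[OF local_op_block_sort[OF B(4)]] sorts_segments_block_sort[OF B(4)] by fastforce
next
  case (Suc D)
  define r where "r = B * b ^ D"
  have rb: "B * b ^ Suc D = r * b" by (simp add: r_def)
  have r: "0 < r" "b dvd r" "2 * (b * b) \<le> r" using B by (auto simp: r_def intro: le_trans)
  have "r dvd N" using Suc.prems unfolding rb by (metis dvd_mult_left)
  obtain S where S: "realizable atoms V B N (sort_rounds D) S" "sorts_segments key r {K. K div b \<in> A} S"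
    using Suc.IH \<open>r dvd N\<close> unfolding r_def by blast
  obtain S' where S': "realizable atoms V B N (sort_rounds D) S'" "sorts_segments key r {K. K div b \<in> A \<and> K mod b \<noteq> 0} S'"
    using Suc.IH \<open>r dvd N\<close> unfolding r_def by blast
  note step = columnsort_step[OF B(1) r(2,3,1) S(2) S'(2)]
  have bb: "bij_below N \<sigma>" if "segment_perm (r * b) A \<sigma>" for \<sigma>
    by (rule segment_perm_bij_below[OF that]) (use Suc.prems[unfolded rb] r B(1) in simp_all)
  note pr = realizable_perm[OF bb[OF step(1)]] realizable_perm[OF bb[OF step(2)]]
    realizable_perm[OF bb[OF step(3)]] realizable_perm[OF bb[OF step(4)]]
  note R = realizable_comp[OF realizable_comp[OF realizable_comp[OF realizable_comp[OF realizable_comp[OF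
    realizable_comp[OF realizable_comp[OF S(1) pr(1)] S(1)] pr(2)] S(1)] pr(3)] S'(1)] pr(4)]
  have e: "sort_rounds D + 1 + sort_rounds D + 1 + sort_rounds D + 1 + sort_rounds D + 1 = sort_rounds (Suc D)" by simp
  show ?case unfolding rb using step(5) R[unfolded e] by blast
qed

subsection \<open>Digit operations on arrays of cells\<close>

text \<open>In copy \<open>g\<close> of the input, \<open>c_pt\<close> holds a point, \<open>c_a\<close> and \<open>c_b\<close> the two points that define the guessed radius,
  \<open>c_idx\<close> the number \<open>g\<close>, and \<open>c_aux\<close> in turn the previous point, a leader flag, the count, and
  \<open>2 g\<close> plus a failure bit.\<close>

datatype 'p cell = Cell (c_pt: "'p word") (c_a: "'p word") (c_b: "'p word") (c_idx: "'p word") (c_aux: "'p word")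

definition cell_atoms :: "'p cell \<Rightarrow> 'p word set" where
  "cell_atoms z = {c_pt z, c_a z, c_b z, c_idx z, c_aux z}"

definition slot :: "'p cell \<Rightarrow> nat \<Rightarrow> 'p word" where
  "slot z i = (if i = 0 then c_pt z else if i = 1 then c_a z else if i = 2 then c_b z else if i = 3 then c_idx z else c_aux z)"

definition cells_of :: "(nat \<Rightarrow> 'p word) \<Rightarrow> nat \<Rightarrow> 'p cell" where
  "cells_of x c = Cell (x (5 * c)) (x (5 * c + 1)) (x (5 * c + 2)) (x (5 * c + 3)) (x (5 * c + 4))"

definition words_of :: "(nat \<Rightarrow> 'p cell) \<Rightarrow> nat \<Rightarrow> 'p word" where
  "words_of X w = slot (X (w div 5)) (w mod 5)"

lemma cells_of_words_of [simp]: "cells_of (words_of X) = X"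
proof
  fix c
  have "(5 * c + i) div 5 = c" "(5 * c + i) mod 5 = i" if "i < 5" for i :: nat using that by auto
  from this[of 0] this[of 1] this[of 2] this[of 3] this[of 4]
  show "cells_of (words_of X) c = X c"
    by (cases "X c") (simp add: cells_of_def words_of_def slot_def)
qed

lemma slot_cells_of: "i < 5 \<Longrightarrow> slot (cells_of x c) i = x (5 * c + i)"
  by (auto simp: slot_def cells_of_def numeral_eq_Suc less_Suc_eq)

lemma words_of_cells_of [simp]: "words_of (cells_of x) = x"
  by (rule ext) (simp add: words_of_def slot_cells_of)

lemma slot_in_cell_atoms: "slot z i \<in> cell_atoms z"
  by (simp add: slot_def cell_atoms_def)

lemma cell_atoms_cells_of:
  assumes "c div B = w div (5 * B)"
  shows "cell_atoms (cells_of x c) \<subseteq> x ` {u. u div (5 * B) = w div (5 * B)}"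
proof -
  have "(5 * c + i) div (5 * B) = w div (5 * B)" if "i < 5" for i
    using that assms by (simp add: div_mult2_eq)
  from this[of 0] this[of 1] this[of 2] this[of 3] this[of 4] show ?thesis
    by (auto simp: cell_atoms_def cells_of_def)
qed

text \<open>A permutation of cells moves the five words of a cell together. Most stages are written
  for cells; gathering and shifting move single slots and need the level of words, so both levels
  must compose.\<close>

lemma realizable_words_of_cells:
  fixes G :: "(nat \<Rightarrow> 'p cell) \<Rightarrow> nat \<Rightarrow> 'p cell"
  assumes "realizable cell_atoms V B N R G"
  shows "realizable (\<lambda>w. {w}) V (5 * B) (5 * N) R (\<lambda>x. words_of (G (cells_of x)))"
  using assms
proof induction
  case realizable_refl
  then show ?case using realizable.realizable_refl by simp
next
  case (realizable_step R G F \<sigma>)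
  define \<sigma>' where "\<sigma>' w = 5 * \<sigma> (w div 5) + w mod 5" for w
  define F' :: "(nat \<Rightarrow> 'p word) \<Rightarrow> nat \<Rightarrow> 'p word" where "F' x = words_of (F (cells_of x))" for x
  have "local_op (\<lambda>w. {w}) V (5 * B) F'"
    unfolding local_op_def
  proof (intro conjI allI impI)
    fix x :: "nat \<Rightarrow> 'p word" and w
    have "F' x w \<in> cell_atoms (F (cells_of x) (w div 5))"
      by (simp add: F'_def words_of_def slot_in_cell_atoms)
    also have "\<dots> \<subseteq> V \<union> (\<Union>c\<in>{c. c div B = w div 5 div B}. cell_atoms (cells_of x c))"
      using realizable_step.hyps(2) unfolding local_op_def by blast
    also have "\<dots> \<subseteq> V \<union> x ` {u. u div (5 * B) = w div (5 * B)}"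
      using cell_atoms_cells_of[of _ B w x] by (auto simp: div_mult2_eq)
    finally show "{F' x w} \<subseteq> V \<union> (\<Union>u\<in>{u. u div (5 * B) = w div (5 * B)}. {x u})" by auto
  next
    fix x y :: "nat \<Rightarrow> 'p word" and w assume *: "\<forall>u. u div (5 * B) = w div (5 * B) \<longrightarrow> x u = y u"
    have "cells_of x c = cells_of y c" if c: "c div B = w div 5 div B" for c
    proof -
      have "x (5 * c + i) = y (5 * c + i)" if "i < 5" for i
        using that c by (intro *[rule_format]) (simp add: div_mult2_eq)
      from this[of 0] this[of 1] this[of 2] this[of 3] this[of 4] show ?thesis by (simp add: cells_of_def)
    qed
    then have "F (cells_of x) (w div 5) = F (cells_of y) (w div 5)"
      using realizable_step.hyps(2) unfolding local_op_def by blast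
    then show "F' x w = F' y w" by (simp add: F'_def words_of_def)
  qed
  moreover have "bij_below (5 * N) \<sigma>'"
  proof (rule bij_belowI[where \<tau> = "\<lambda>w. 5 * inv \<sigma> (w div 5) + w mod 5"])
    note i = bij_below_inv[OF realizable_step.hyps(3)]
    have lt: "w div 5 < N \<longleftrightarrow> w < 5 * N" for w :: nat by (simp add: div_less_iff_less_mult mult.commute)
    show "5 * inv \<sigma> (\<sigma>' u div 5) + \<sigma>' u mod 5 = u" for u by (simp add: \<sigma>'_def i)
    show "\<sigma>' (5 * inv \<sigma> (u div 5) + u mod 5) = u" for u by (simp add: \<sigma>'_def i)
    show "\<sigma>' u < 5 * N" if "u < 5 * N" for u
      using that realizable_step.hyps(3) by (simp add: lt[symmetric] \<sigma>'_def bij_below_def)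
    show "5 * inv \<sigma> (u div 5) + u mod 5 < 5 * N" if "u < 5 * N" for u
      using that i(1) by (simp add: lt[symmetric] bij_below_def)
  qed
  ultimately have "realizable (\<lambda>w. {w}) V (5 * B) (5 * N) (Suc R) (\<lambda>x w. F' (words_of (G (cells_of x))) (\<sigma>' w))"
    by (intro realizable.realizable_step realizable_step.IH)
  moreover have "(\<lambda>x w. F' (words_of (G (cells_of x))) (\<sigma>' w)) = (\<lambda>x. words_of (\<lambda>u. F (G (cells_of x)) (\<sigma> u)))"
    by (simp add: fun_eq_iff F'_def words_of_def \<sigma>'_def)
  ultimately show ?case by simp
qed

section \<open>Base-\<open>b\<close> digits of addresses, and reductions along them\<close>

definition upd_digit :: "nat \<Rightarrow> nat \<Rightarrow> nat \<Rightarrow> nat \<Rightarrow> nat" where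
  "upd_digit b j i c = (c div b ^ Suc j * b + i) * b ^ j + c mod b ^ j"

definition digit :: "nat \<Rightarrow> nat \<Rightarrow> nat \<Rightarrow> nat" where
  "digit b j c = c div b ^ j mod b"

lemma digit_less: "0 < b \<Longrightarrow> digit b j c < b"
  by (simp add: digit_def)

lemma upd_digit_same: "upd_digit b j (digit b j c) c = c"
proof -
  have "c div b ^ Suc j * b + c div b ^ j mod b = c div b ^ j"
    by (metis div_mod_decomp div_mult2_eq power_Suc2)
  then show ?thesis unfolding upd_digit_def digit_def by (simp only: div_mult_mod_eq)
qed

lemma upd_digit_div:
  assumes "0 < b" "i < b"
  shows "upd_digit b j i c div b ^ j = c div b ^ Suc j * b + i"
    and "upd_digit b j i c div b ^ Suc j = c div b ^ Suc j"
    and "upd_digit b j i c mod b ^ j = c mod b ^ j"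
proof -
  have "0 < b ^ j" using assms by simp
  then show 1: "upd_digit b j i c div b ^ j = c div b ^ Suc j * b + i" by (simp add: upd_digit_def)
  have "upd_digit b j i c div b ^ Suc j = upd_digit b j i c div b ^ j div b" by (metis div_mult2_eq power_Suc2)
  also have "\<dots> = c div b ^ Suc j" unfolding 1 using assms by simp
  finally show "upd_digit b j i c div b ^ Suc j = c div b ^ Suc j" .
  show "upd_digit b j i c mod b ^ j = c mod b ^ j" using \<open>0 < b ^ j\<close> by (simp add: upd_digit_def)
qed

lemma upd_digit_less:
  assumes "0 < b" "i < b" "j < t" "c < b ^ t"
  shows "upd_digit b j i c < b ^ t"
proof -
  have t: "b ^ t = b ^ Suc j * b ^ (t - Suc j)" using assms(3) by (metis Suc_leI le_add_diff_inverse power_add)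
  have "c div b ^ Suc j < b ^ (t - Suc j)"
    using assms(1,4) unfolding t by (simp add: div_less_iff_less_mult mult.commute)
  then have "upd_digit b j i c div b ^ Suc j < b ^ (t - Suc j)" using upd_digit_div[OF assms(1,2)] by simp
  then show ?thesis
    using assms(1) unfolding t by (simp add: div_less_iff_less_mult mult.commute)
qed

text \<open>The \<open>j\<close> low digits move to the top, so that digit \<open>j\<close> becomes
  the lowest. Cells that differ only in digit \<open>j\<close> become neighbours.\<close>

definition rotate_digits :: "nat \<Rightarrow> nat \<Rightarrow> nat \<Rightarrow> nat \<Rightarrow> nat" where
  "rotate_digits b t j c = (if c < b ^ t then c mod b ^ j * b ^ (t - j) + c div b ^ j else c)"

lemma rotate_digits_inverse:
  assumes "0 < b" "j \<le> t"
  shows "rotate_digits b t (t - j) (rotate_digits b t j c) = c"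
    and "c < b ^ t \<Longrightarrow> rotate_digits b t j c < b ^ t"
proof -
  have t: "b ^ t = b ^ j * b ^ (t - j)" using assms(2) by (metis le_add_diff_inverse power_add)
  show lt: "rotate_digits b t j c < b ^ t" if "c < b ^ t" for c
    using transpose_index(1)[of c "b ^ j" "b ^ (t - j)"] that by (simp add: rotate_digits_def t[symmetric])
  show "rotate_digits b t (t - j) (rotate_digits b t j c) = c"
  proof (cases "c < b ^ t")
    case True
    then show ?thesis
      using transpose_index(2)[of c "b ^ j" "b ^ (t - j)"] lt[OF True] assms(2)
      by (simp add: rotate_digits_def t[symmetric] split: if_splits)
  qed (simp add: rotate_digits_def)
qed

lemma bij_below_rotate_digits:
  assumes "0 < b" "j \<le> t"
  shows "bij_below (b ^ t) (rotate_digits b t j)"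
  using rotate_digits_inverse[of b j t] rotate_digits_inverse[of b "t - j" t] assms
  by (intro bij_belowI[where \<tau> = "rotate_digits b t (t - j)"]) auto

lemma rotate_digits_upd_digit:
  assumes "0 < b" "i < b" "j < t" "c < b ^ t"
  shows "rotate_digits b t j (upd_digit b j i c) div b = rotate_digits b t j c div b"
proof -
  have tj: "b ^ (t - j) = b ^ (t - Suc j) * b" using assms(3) by (metis Suc_diff_Suc power_Suc2)
  have s: "c div b ^ j div b = c div b ^ Suc j" for c by (metis div_mult2_eq power_Suc2)
  have "rotate_digits b t j c div b = c mod b ^ j * b ^ (t - Suc j) + c div b ^ Suc j" if "c < b ^ t" for c
  proof -
    have "rotate_digits b t j c = c div b ^ j + (c mod b ^ j * b ^ (t - Suc j)) * b"
      using that by (simp add: rotate_digits_def tj)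
    then show ?thesis using assms(1) by (simp add: s)
  qed
  then show ?thesis using upd_digit_less[OF assms] upd_digit_div[OF assms(1,2)] assms(4) by simp
qed

text \<open>The first round rotates digit \<open>j\<close> to the lowest place. The \<open>b\<close>
  cells that differ only there are then consecutive and, as \<open>b dvd B\<close>, on one machine.
  The second round computes and rotates back.\<close>

lemma realizable_digit_op:
  fixes \<Phi> :: "nat \<Rightarrow> (nat \<Rightarrow> 'a) \<Rightarrow> 'a"
  assumes b: "0 < b" "b dvd B" and j: "j < t"
    and atoms: "\<And>c f. atoms (\<Phi> c f) \<subseteq> V \<union> (\<Union>i<b. atoms (f i))"
    and cong: "\<And>c f f'. (\<And>i. i < b \<Longrightarrow> f i = f' i) \<Longrightarrow> \<Phi> c f = \<Phi> c f'"
  shows "\<exists>G. realizable atoms V B (b ^ t) 2 G \<and>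
           (\<forall>X. \<forall>c < b ^ t. G X c = \<Phi> c (\<lambda>i. X (upd_digit b j i c)))"
proof -
  define \<sigma> where "\<sigma> = rotate_digits b t j"
  have \<sigma>: "bij_below (b ^ t) \<sigma>" using bij_below_rotate_digits b j by (simp add: \<sigma>_def)
  note i = bij_below_inv[OF \<sigma>]
  define F where "F X w = (if w < b ^ t then \<Phi> (inv \<sigma> w) (\<lambda>i. X (\<sigma> (upd_digit b j i (inv \<sigma> w)))) else X w)" for X w
  have blk: "\<sigma> (upd_digit b j k (inv \<sigma> w)) div B = w div B" if "w < b ^ t" "k < b" for w k
  proof -
    have "inv \<sigma> w < b ^ t" using i(1) that by (simp add: bij_below_def)
    then have "\<sigma> (upd_digit b j k (inv \<sigma> w)) div b = w div b"
      using rotate_digits_upd_digit[OF b(1) that(2) j, of "inv \<sigma> w"] by (simp add: \<sigma>_def[symmetric] i)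
    moreover obtain B' where "B = b * B'" using b(2) by blast
    ultimately show ?thesis by (simp add: div_mult2_eq)
  qed
  have "local_op atoms V B F"
    unfolding local_op_def
  proof (intro conjI allI impI)
    fix X :: "nat \<Rightarrow> 'a" and w
    show "atoms (F X w) \<subseteq> V \<union> (\<Union>u\<in>{u. u div B = w div B}. atoms (X u))"
    proof (cases "w < b ^ t")
      case True
      have "atoms (F X w) \<subseteq> V \<union> (\<Union>k<b. atoms (X (\<sigma> (upd_digit b j k (inv \<sigma> w)))))"
        using True atoms[of "inv \<sigma> w"] by (simp add: F_def)
      also have "\<dots> \<subseteq> V \<union> (\<Union>u\<in>{u. u div B = w div B}. atoms (X u))" using blk[OF True] by fastforce
      finally show ?thesis .
    qed (auto simp: F_def)
  next
    fix X Y :: "nat \<Rightarrow> 'a" and w assume "\<forall>u. u div B = w div B \<longrightarrow> X u = Y u"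
    then show "F X w = F Y w" unfolding F_def using blk by (auto intro!: cong)
  qed
  have "realizable atoms V B (b ^ t) (Suc 1) (\<lambda>X c. F (\<lambda>u. X (inv \<sigma> u)) (\<sigma> c))"
    by (rule realizable_step[OF realizable_perm[OF i(1)] \<open>local_op atoms V B F\<close> \<sigma>])
  moreover have "F (\<lambda>u. X (inv \<sigma> u)) (\<sigma> c) = \<Phi> c (\<lambda>i. X (upd_digit b j i c))" if "c < b ^ t" for X c
    using that \<sigma> by (simp add: F_def i bij_below_def)
  ultimately show ?thesis by (intro exI[of _ "\<lambda>X c. F (\<lambda>u. X (inv \<sigma> u)) (\<sigma> c)"]) (simp add: numeral_2_eq_2)
qed

text \<open>\<open>H\<close> prescribes the arrays between the rounds. \<open>G\<close> is fixed
  before \<open>H\<close>, so one program serves all inputs, and an application only has to exhibit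
  a closed form for \<open>H\<close>.\<close>

lemma realizable_digit_ops:
  fixes \<Phi> :: "nat \<Rightarrow> nat \<Rightarrow> (nat \<Rightarrow> 'a) \<Rightarrow> 'a"
  assumes b: "0 < b" "b dvd B"
    and atoms: "\<And>j c f. atoms (\<Phi> j c f) \<subseteq> V \<union> (\<Union>i<b. atoms (f i))"
    and cong: "\<And>j c f f'. (\<And>i. i < b \<Longrightarrow> f i = f' i) \<Longrightarrow> \<Phi> j c f = \<Phi> j c f'"
    and j: "j\<^sub>0 \<le> j\<^sub>1" "j\<^sub>1 \<le> t"
  shows "\<exists>G. realizable atoms V B (b ^ t) (2 * (j\<^sub>1 - j\<^sub>0)) G \<and>
     (\<forall>H X. (\<forall>j c. j\<^sub>0 \<le> j \<longrightarrow> j < j\<^sub>1 \<longrightarrow> c < b ^ t \<longrightarrow> H (Suc j) c = \<Phi> j c (\<lambda>i. H j (upd_digit b j i c))) \<longrightarrow>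
        (\<forall>c < b ^ t. X c = H j\<^sub>0 c) \<longrightarrow> (\<forall>c < b ^ t. G X c = H j\<^sub>1 c))"
  using j
proof (induction j\<^sub>1 rule: dec_induct)
  case base
  then show ?case using realizable_refl by (intro exI[of _ "\<lambda>X. X"]) auto
next
  case (step j)
  then obtain G where G: "realizable atoms V B (b ^ t) (2 * (j - j\<^sub>0)) G"
    "\<And>H X. (\<forall>j' c. j\<^sub>0 \<le> j' \<longrightarrow> j' < j \<longrightarrow> c < b ^ t \<longrightarrow> H (Suc j') c = \<Phi> j' c (\<lambda>i. H j' (upd_digit b j' i c))) \<Longrightarrow>
        (\<forall>c < b ^ t. X c = H j\<^sub>0 c) \<Longrightarrow> (\<forall>c < b ^ t. G X c = H j c)"
    by auto
  obtain G' where G': "realizable atoms V B (b ^ t) 2 G'"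
    "\<And>X c. c < b ^ t \<Longrightarrow> G' X c = \<Phi> j c (\<lambda>i. X (upd_digit b j i c))"
    using realizable_digit_op[where \<Phi> = "\<Phi> j" and t = t and j = j, OF b Suc_le_lessD[OF step.prems(1)] atoms cong]
    by blast
  show ?case
  proof (intro exI[of _ "\<lambda>X. G' (G X)"] conjI allI impI)
    have "2 * (Suc j - j\<^sub>0) = 2 * (j - j\<^sub>0) + 2" using step.hyps by simp
    then show "realizable atoms V B (b ^ t) (2 * (Suc j - j\<^sub>0)) (\<lambda>X. G' (G X))"
      using realizable_comp[OF G(1) G'(1)] by (simp only:)
    fix H X c
    assume H: "\<forall>j' c. j\<^sub>0 \<le> j' \<longrightarrow> j' < Suc j \<longrightarrow> c < b ^ t \<longrightarrow> H (Suc j') c = \<Phi> j' c (\<lambda>i. H j' (upd_digit b j' i c))"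
      and X: "\<forall>c < b ^ t. X c = H j\<^sub>0 c" and c: "c < b ^ t"
    have *: "\<forall>c < b ^ t. G X c = H j c" by (rule G(2)) (use H X in auto)
    have "G' (G X) c = \<Phi> j c (\<lambda>i. H j (upd_digit b j i c))"
      unfolding G'(2)[OF c] by (rule cong) (use * upd_digit_less[OF b(1) _ _ c] step.prems in auto)
    then show "G' (G X) c = H (Suc j) c" using H c step.hyps by simp
  qed
qed

subsection \<open>Shifted grids and k-center\<close>

definition grid_cell :: "real \<Rightarrow> nat \<Rightarrow> nat \<Rightarrow> real ^ 'd \<Rightarrow> 'd \<Rightarrow> int" where
  "grid_cell r X t p = (\<lambda>i. \<lfloor>(p $ i / r + real t) / real X\<rfloor>)"

lemma dist_le_card_mult:
  fixes p q :: "real ^ 'd"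
  assumes "\<And>i. \<bar>p $ i - q $ i\<bar> \<le> D"
  shows "dist p q \<le> real CARD('d) * D"
proof -
  have "dist p q \<le> (\<Sum>i\<in>UNIV. \<bar>(p - q) $ i\<bar>)" unfolding dist_norm by (rule norm_le_l1_cart)
  also have "\<dots> \<le> (\<Sum>i\<in>(UNIV :: 'd set). D)" using assms by (intro sum_mono) simp
  finally show ?thesis by simp
qed

lemma grid_cell_eq_imp_dist_le:
  fixes p q :: "real ^ 'd"
  assumes "0 < r" "0 < X" "grid_cell r X t p = grid_cell r X t q"
  shows "dist p q \<le> real CARD('d) * (real X * r)"
proof (rule dist_le_card_mult)
  fix i
  have "\<lfloor>(p $ i / r + real t) / real X\<rfloor> = \<lfloor>(q $ i / r + real t) / real X\<rfloor>"
    using fun_cong[OF assms(3), of i] by (simp add: grid_cell_def)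
  then have "\<bar>(p $ i / r + real t) / real X - (q $ i / r + real t) / real X\<bar> \<le> 1" by linarith
  also have "(p $ i / r + real t) / real X - (q $ i / r + real t) / real X = (p $ i - q $ i) / (real X * r)"
    using assms by (simp add: field_simps)
  finally show "\<bar>p $ i - q $ i\<bar> \<le> real X * r"
    using assms by (simp add: abs_divide field_simps)
qed

text \<open>In units of the radius, a ball of center coordinate \<open>y\<close> is cut when a
  multiple of \<open>X\<close>, lowered by \<open>t\<close>, lies in the half-open interval from
  \<open>y - 1\<close> to \<open>y + 1\<close>. This interval contains exactly two integers, and
  each of them determines \<open>t\<close> modulo \<open>X\<close>.\<close>

lemma card_cut_shifts:
  fixes y :: real
  assumes "0 < X"
  shows "card {t. t < X \<and> \<lfloor>(y - 1 + real t) / real X\<rfloor> \<noteq> \<lfloor>(y + 1 + real t) / real X\<rfloor>} \<le> 2"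
proof -
  have "{t. t < X \<and> \<lfloor>(y - 1 + real t) / real X\<rfloor> \<noteq> \<lfloor>(y + 1 + real t) / real X\<rfloor>}
      \<subseteq> {nat ((- \<lfloor>y\<rfloor>) mod int X), nat ((- \<lfloor>y\<rfloor> - 1) mod int X)}"
  proof
    fix t assume "t \<in> {t. t < X \<and> \<lfloor>(y - 1 + real t) / real X\<rfloor> \<noteq> \<lfloor>(y + 1 + real t) / real X\<rfloor>}"
    then have t: "t < X" "\<lfloor>(y - 1 + real t) / real X\<rfloor> \<noteq> \<lfloor>(y + 1 + real t) / real X\<rfloor>" by auto
    define m where "m = \<lfloor>(y + 1 + real t) / real X\<rfloor>"
    have "(y - 1 + real t) / real X \<le> (y + 1 + real t) / real X" using assms by (simp add: divide_right_mono)
    then have "\<lfloor>(y - 1 + real t) / real X\<rfloor> < m" using t(2) floor_mono unfolding m_def by (metis order_less_le)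
    then have "(y - 1 + real t) / real X < of_int m" by (simp add: floor_less_iff)
    then have 1: "y - 1 + real t < of_int (m * int X)" using assms by (simp add: divide_less_eq)
    have "of_int m \<le> (y + 1 + real t) / real X" by (simp add: m_def)
    then have 2: "of_int (m * int X) \<le> y + 1 + real t" using assms by (simp add: le_divide_eq)
    have "m * int X - int t = \<lfloor>y\<rfloor> \<or> m * int X - int t = \<lfloor>y\<rfloor> + 1"
      using 1 2 by linarith
    then have "int t = (- \<lfloor>y\<rfloor>) + int X * m \<or> int t = (- \<lfloor>y\<rfloor> - 1) + int X * m" by (auto simp: algebra_simps)
    then have "int t mod int X = (- \<lfloor>y\<rfloor>) mod int X \<or> int t mod int X = (- \<lfloor>y\<rfloor> - 1) mod int X"
      by (metis mod_mult_self2)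
    moreover have "int t mod int X = int t" using t(1) by simp
    ultimately show "t \<in> {nat ((- \<lfloor>y\<rfloor>) mod int X), nat ((- \<lfloor>y\<rfloor> - 1) mod int X)}" by (metis insertCI nat_int)
  qed
  then have "card {t. t < X \<and> \<lfloor>(y - 1 + real t) / real X\<rfloor> \<noteq> \<lfloor>(y + 1 + real t) / real X\<rfloor>}
      \<le> card {nat ((- \<lfloor>y\<rfloor>) mod int X), nat ((- \<lfloor>y\<rfloor> - 1) mod int X)}"
    by (intro card_mono) auto
  also have "\<dots> \<le> 2" by (simp add: card_insert_if)
  finally show ?thesis .
qed

text \<open>As \<open>X \<ge> 2\<close>, a ball meets at most two layers of cells in each
  coordinate, and one cell if no coordinate is cut. The full \<open>2 ^ d\<close> is charged to
  every cut coordinate because such a sum can be averaged over the shifts coordinate by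
  coordinate.\<close>

lemma card_grid_cells_ball:
  fixes z :: "real ^ 'd"
  assumes "0 < r" "2 \<le> X" "B \<subseteq> cball z r"
  fixes t :: nat
  defines "is_cut \<equiv> (\<lambda>i. \<lfloor>(z $ i / r - 1 + real t) / real X\<rfloor> \<noteq> \<lfloor>(z $ i / r + 1 + real t) / real X\<rfloor>)"
  shows "finite (grid_cell r X t ` B)"
    and "card (grid_cell r X t ` B) \<le> 1 + (\<Sum>i\<in>UNIV. if is_cut i then 2 ^ CARD('d) else 0)"
proof -
  define lo where "lo = (\<lambda>i. \<lfloor>(z $ i / r - 1 + real t) / real X\<rfloor>)"
  have bnd: "lo i \<le> grid_cell r X t p i" "grid_cell r X t p i \<le> \<lfloor>(z $ i / r + 1 + real t) / real X\<rfloor>" if "p \<in> B" for p i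
  proof -
    have "dist z p \<le> r" using that assms(3) by auto
    moreover have "\<bar>(z - p) $ i\<bar> \<le> norm (z - p)" by (rule component_le_norm_cart)
    ultimately have "\<bar>z $ i - p $ i\<bar> \<le> r" by (simp add: dist_norm)
    then have "(z $ i - p $ i) / r \<le> 1" "(p $ i - z $ i) / r \<le> 1"
      using assms(1) by (auto simp: divide_le_eq abs_le_iff)
    then have "z $ i / r - 1 \<le> p $ i / r" "p $ i / r \<le> z $ i / r + 1"
      unfolding diff_divide_distrib by linarith+
    then show "lo i \<le> grid_cell r X t p i" "grid_cell r X t p i \<le> \<lfloor>(z $ i / r + 1 + real t) / real X\<rfloor>"
      unfolding lo_def grid_cell_def by (auto intro!: floor_mono divide_right_mono)
  qed
  have hi: "\<lfloor>(z $ i / r + 1 + real t) / real X\<rfloor> \<le> lo i + 1" for i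
  proof -
    have "(z $ i / r + 1 + real t) / real X \<le> (z $ i / r - 1 + real t) / real X + 1"
      using assms(2) by (simp add: field_simps)
    then show ?thesis unfolding lo_def by linarith
  qed
  have sub: "grid_cell r X t ` B \<subseteq> Pi\<^sub>E UNIV (\<lambda>i. {lo i, lo i + 1})"
  proof
    fix g assume "g \<in> grid_cell r X t ` B"
    then obtain p where p: "p \<in> B" "g = grid_cell r X t p" by blast
    have "g i = lo i \<or> g i = lo i + 1" for i
      using bnd[OF p(1), of i] hi[of i] unfolding p(2) by linarith
    then show "g \<in> Pi\<^sub>E UNIV (\<lambda>i. {lo i, lo i + 1})" by (simp add: PiE_UNIV_domain)
  qed
  have fin: "finite (Pi\<^sub>E (UNIV :: 'd set) (\<lambda>i. {lo i, lo i + 1}))" by (intro finite_PiE) auto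
  show "finite (grid_cell r X t ` B)" using finite_subset[OF sub fin] .
  show "card (grid_cell r X t ` B) \<le> 1 + (\<Sum>i\<in>UNIV. if is_cut i then 2 ^ CARD('d) else 0)"
  proof (cases "\<exists>i. is_cut i")
    case True
    then obtain i where i: "is_cut i" by blast
    have "card (grid_cell r X t ` B) \<le> card (Pi\<^sub>E (UNIV :: 'd set) (\<lambda>i. {lo i, lo i + 1}))"
      by (rule card_mono[OF fin sub])
    also have "\<dots> = 2 ^ CARD('d)" by (simp add: card_PiE numeral_2_eq_2)
    also have "\<dots> = (if is_cut i then 2 ^ CARD('d) else 0)" using i by simp
    also have "\<dots> \<le> (\<Sum>i\<in>UNIV. if is_cut i then 2 ^ CARD('d) else 0)"
      by (rule member_le_sum) auto
    finally show ?thesis by simp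
  next
    case False
    then have "grid_cell r X t p = lo" if "p \<in> B" for p
      using bnd[OF that] by (auto simp: is_cut_def lo_def fun_eq_iff intro!: antisym)
    then have "grid_cell r X t ` B \<subseteq> {lo}" by auto
    then have "card (grid_cell r X t ` B) \<le> card {lo}" by (intro card_mono) auto
    then show ?thesis by simp
  qed
qed

text \<open>A coordinate is cut by at most two shifts and is charged \<open>2 ^ d\<close> cells each
  time, so the \<open>X\<close> shifts together cost one ball at most
  \<open>X + d * 2 ^ (d + 1)\<close> cells. Some shift is no worse than the average.\<close>

lemma exists_good_shift:
  fixes P Z :: "(real ^ 'd) set"
  assumes r: "0 < r" and X: "2 \<le> X" and Z: "finite Z" and cover: "\<And>p. p \<in> P \<Longrightarrow> \<exists>z\<in>Z. dist z p \<le> r"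
  shows "\<exists>t<X. real (card (grid_cell r X t ` P))
           \<le> real (card Z) + real (card Z) * (real CARD('d) * 2 ^ Suc CARD('d)) / real X"
proof (rule ccontr)
  assume "\<not> ?thesis"
  then have neg: "real (card Z) + real (card Z) * (real CARD('d) * 2 ^ Suc CARD('d)) / real X
      < real (card (grid_cell r X t ` P))" if "t < X" for t
    using that by (auto simp: not_le)
  define N where "N t z = 1 + (\<Sum>i\<in>(UNIV :: 'd set). if \<lfloor>(z $ i / r - 1 + real t) / real X\<rfloor> \<noteq> \<lfloor>(z $ i / r + 1 + real t) / real X\<rfloor>
      then 2 ^ CARD('d) else 0 :: nat)" for t and z :: "real ^ 'd"
  have le: "card (grid_cell r X t ` P) \<le> (\<Sum>z\<in>Z. N t z)" for t
  proof -
    have "grid_cell r X t ` P \<subseteq> (\<Union>z\<in>Z. grid_cell r X t ` cball z r)" using cover by fastforce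
    then have "card (grid_cell r X t ` P) \<le> card (\<Union>z\<in>Z. grid_cell r X t ` cball z r)"
      using Z card_grid_cells_ball(1)[OF r X order_refl] by (intro card_mono) auto
    also have "\<dots> \<le> (\<Sum>z\<in>Z. card (grid_cell r X t ` cball z r))" by (rule card_UN_le[OF Z])
    also have "\<dots> \<le> (\<Sum>z\<in>Z. N t z)"
      unfolding N_def by (intro sum_mono card_grid_cells_ball(2)[OF r X order_refl])
    finally show ?thesis .
  qed
  have Nz: "(\<Sum>t<X. N t z) \<le> X + CARD('d) * 2 ^ Suc CARD('d)" for z
  proof -
    have "(\<Sum>t<X. N t z) = X + (\<Sum>i\<in>(UNIV :: 'd set). \<Sum>t<X. if \<lfloor>(z $ i / r - 1 + real t) / real X\<rfloor> \<noteq> \<lfloor>(z $ i / r + 1 + real t) / real X\<rfloor>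
      then 2 ^ CARD('d) else 0 :: nat)"
      unfolding N_def sum.distrib by (subst sum.swap) simp
    also have "\<dots> \<le> X + (\<Sum>i\<in>(UNIV :: 'd set). 2 * 2 ^ CARD('d))"
    proof (intro add_left_mono sum_mono)
      fix i :: 'd
      have "(\<Sum>t<X. if \<lfloor>(z $ i / r - 1 + real t) / real X\<rfloor> \<noteq> \<lfloor>(z $ i / r + 1 + real t) / real X\<rfloor>
          then 2 ^ CARD('d) else 0 :: nat)
        = card {t. t < X \<and> \<lfloor>(z $ i / r - 1 + real t) / real X\<rfloor> \<noteq> \<lfloor>(z $ i / r + 1 + real t) / real X\<rfloor>} * 2 ^ CARD('d)"
        by (subst sum.If_cases) (auto intro!: arg_cong[where f = card])
      also have "\<dots> \<le> 2 * 2 ^ CARD('d)" using card_cut_shifts[of X "z $ i / r"] X by (intro mult_le_mono1) simp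
      finally show "(\<Sum>t<X. if \<lfloor>(z $ i / r - 1 + real t) / real X\<rfloor> \<noteq> \<lfloor>(z $ i / r + 1 + real t) / real X\<rfloor>
          then 2 ^ CARD('d) else 0 :: nat) \<le> 2 * 2 ^ CARD('d)" .
    qed
    finally show ?thesis by simp
  qed
  have "real X * (real (card Z) + real (card Z) * (real CARD('d) * 2 ^ Suc CARD('d)) / real X)
      = (\<Sum>t<X. real (card Z) + real (card Z) * (real CARD('d) * 2 ^ Suc CARD('d)) / real X)" by simp
  also have "\<dots> < (\<Sum>t<X. real (card (grid_cell r X t ` P)))"
  proof (rule sum_strict_mono)
    show "{..<X} \<noteq> {}" using X by (simp add: lessThan_empty_iff)
  qed (use neg in auto)
  also have "\<dots> \<le> real (\<Sum>t<X. \<Sum>z\<in>Z. N t z)" unfolding of_nat_sum[symmetric] of_nat_le_iff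
    by (intro sum_mono le)
  also have "(\<Sum>t<X. \<Sum>z\<in>Z. N t z) = (\<Sum>z\<in>Z. \<Sum>t<X. N t z)" by (rule sum.swap)
  also have "real \<dots> \<le> real (\<Sum>z\<in>Z. X + CARD('d) * 2 ^ Suc CARD('d))"
    unfolding of_nat_le_iff by (intro sum_mono Nz)
  also have "\<dots> = real X * (real (card Z) + real (card Z) * (real CARD('d) * 2 ^ Suc CARD('d)) / real X)"
    using X by (simp add: field_simps)
  finally show False by simp
qed

section \<open>Bounds on the k-center cost and on the diameter\<close>

lemma min_separation_le:
  assumes "finite P" "p \<in> P" "q \<in> P" "p \<noteq> q"
  shows "min_separation P \<le> dist p q"
  unfolding min_separation_def
proof (rule Min_le)
  have "{dist p q |p q. p \<in> P \<and> q \<in> P \<and> p \<noteq> q} \<subseteq> (\<lambda>(p, q). dist p q) ` (P \<times> P)" by auto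
  then show "finite {dist p q |p q. p \<in> P \<and> q \<in> P \<and> p \<noteq> q}"
    by (rule finite_subset) (use assms(1) in auto)
qed (use assms in auto)

lemma point_dist_attained:
  assumes "finite C" "C \<noteq> {}"
  shows "\<exists>q\<in>C. point_dist p C = dist p q"
proof -
  have "Min (dist p ` C) \<in> dist p ` C" using assms by (intro Min_in) auto
  then show ?thesis by (auto simp: point_dist_def)
qed

lemma kcenter_cost_le:
  assumes "finite P" "P \<noteq> {}" "finite C" "\<And>p. p \<in> P \<Longrightarrow> \<exists>q\<in>C. dist p q \<le> D"
  shows "kcenter_cost P C \<le> D"
  unfolding kcenter_cost_def
proof (subst Max_le_iff)
  show "\<forall>a\<in>(\<lambda>p. point_dist p C) ` P. a \<le> D"
  proof
    fix a assume "a \<in> (\<lambda>p. point_dist p C) ` P"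
    then obtain p where p: "p \<in> P" "a = Min (dist p ` C)" by (auto simp: point_dist_def)
    then obtain q where q: "q \<in> C" "dist p q \<le> D" using assms(4) by blast
    then have "Min (dist p ` C) \<le> dist p q" using assms(3) by (intro Min_le) auto
    then show "a \<le> D" using p q by simp
  qed
qed (use assms in auto)

text \<open>The optimum is the distance of two input points, which makes one of the pair guesses
  exact. Since \<open>k < card P\<close>, some point is not a center, so the optimum is at least the
  separation and the dyadic guesses may start at 1.\<close>

lemma kcenter_opt_witness:
  fixes P :: "'p::metric_space set"
  assumes P: "finite P" and k: "0 < k" "k < card P"
  obtains Z p q where "Z \<subseteq> P" "card Z = k" "p \<in> P" "q \<in> P" "kcenter_opt P k = dist p q"
    and "\<And>p. p \<in> P \<Longrightarrow> \<exists>z\<in>Z. dist z p \<le> kcenter_opt P k" and "min_separation P \<le> kcenter_opt P k"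
proof -
  have "finite {C. C \<subseteq> P \<and> card C = k}" by (rule finite_subset[of _ "Pow P"]) (use P in auto)
  moreover obtain Z0 where "Z0 \<subseteq> P" "card Z0 = k" using obtain_subset_with_card_n k by (metis less_imp_le_nat)
  then have "{C. C \<subseteq> P \<and> card C = k} \<noteq> {}" by auto
  ultimately have "kcenter_opt P k \<in> kcenter_cost P ` {C. C \<subseteq> P \<and> card C = k}"
    unfolding kcenter_opt_def by (intro Min_in) auto
  then obtain Z where Z: "Z \<subseteq> P" "card Z = k" "kcenter_opt P k = kcenter_cost P Z" by auto
  have fZ: "finite Z" "Z \<noteq> {}" using Z P k finite_subset by auto
  have le: "point_dist p Z \<le> kcenter_opt P k" if "p \<in> P" for p
    unfolding Z(3) kcenter_cost_def using that P by (intro Max_ge) auto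
  have "kcenter_cost P Z \<in> (\<lambda>p. point_dist p Z) ` P"
    unfolding kcenter_cost_def using P k by (intro Max_in) auto
  then obtain p where p: "p \<in> P" "kcenter_opt P k = point_dist p Z" using Z(3) by auto
  then obtain q where q: "q \<in> Z" "kcenter_opt P k = dist p q" using point_dist_attained[OF fZ] by metis
  have "\<exists>z\<in>Z. dist z p \<le> kcenter_opt P k" if "p \<in> P" for p
    using le[OF that] point_dist_attained[OF fZ, of p] by (auto simp: dist_commute)
  moreover have "min_separation P \<le> kcenter_opt P k"
  proof -
    have "\<not> P \<subseteq> Z" using Z k fZ(1) by (metis card_mono not_le)
    then obtain p' where p': "p' \<in> P" "p' \<notin> Z" by blast
    obtain q' where q': "q' \<in> Z" "point_dist p' Z = dist p' q'" using point_dist_attained[OF fZ] by metis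
    have "min_separation P \<le> dist p' q'" using p' q' Z(1) P by (intro min_separation_le) auto
    also have "\<dots> \<le> kcenter_opt P k" using le[OF p'(1)] q' by simp
    finally show ?thesis .
  qed
  ultimately show thesis using that Z p q by blast
qed

text \<open>For large \<open>n\<close> this forces \<open>log 2 \<Delta> \<ge> 1\<close>, which
  keeps the allowed global space from degenerating. In a grid of side \<open>1 / d\<close> distinct
  points have distinct cells, since within a cell the coordinate differences sum to less than 1;
  each coordinate spans \<open>[-2, 2]\<close> around \<open>p0\<close>, that is
  \<open>4 * d + 1\<close> cells.\<close>

lemma card_le_of_diameter_less_two:
  fixes P :: "(real ^ 'd) set"
  assumes P: "finite P" "1 \<le> min_separation P" "diameter P < 2"
  shows "card P \<le> (4 * CARD('d) + 1) ^ CARD('d)"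
proof (cases "P = {}")
  case False
  then obtain p0 where p0: "p0 \<in> P" by blast
  define d where "d = real CARD('d)"
  have d: "0 < d" by (simp add: d_def)
  define f where "f p = (\<lambda>i. \<lfloor>d * (p $ i - p0 $ i)\<rfloor>)" for p :: "real ^ 'd"
  have "inj_on f P"
  proof (rule inj_onI, rule ccontr)
    fix p q assume pq: "p \<in> P" "q \<in> P" "f p = f q" "p \<noteq> q"
    have lt: "\<bar>p $ i - q $ i\<bar> < 1 / d" for i
    proof -
      have "\<lfloor>d * (p $ i - p0 $ i)\<rfloor> = \<lfloor>d * (q $ i - p0 $ i)\<rfloor>" using fun_cong[OF pq(3), of i] by (simp add: f_def)
      then have "\<bar>d * (p $ i - p0 $ i) - d * (q $ i - p0 $ i)\<bar> < 1" by linarith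
      also have "d * (p $ i - p0 $ i) - d * (q $ i - p0 $ i) = d * (p $ i - q $ i)" by (simp add: algebra_simps)
      finally have "d * \<bar>p $ i - q $ i\<bar> < 1" using d by (simp only: abs_mult abs_of_pos)
      then show ?thesis using d by (simp add: less_divide_eq mult.commute)
    qed
    have "dist p q \<le> (\<Sum>i\<in>UNIV. \<bar>(p - q) $ i\<bar>)" unfolding dist_norm by (rule norm_le_l1_cart)
    also have "\<dots> < (\<Sum>i\<in>(UNIV :: 'd set). 1 / d)" using lt by (intro sum_strict_mono) auto
    also have "\<dots> = 1" by (simp add: d_def)
    finally show False using min_separation_le[OF P(1) pq(1,2,4)] P(2) by simp
  qed
  moreover have sub: "f ` P \<subseteq> Pi\<^sub>E UNIV (\<lambda>i. {- 2 * int CARD('d)..2 * int CARD('d)})"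
  proof
    fix g assume "g \<in> f ` P"
    then obtain p where p: "p \<in> P" "g = f p" by blast
    have "- 2 * int CARD('d) \<le> f p i \<and> f p i \<le> 2 * int CARD('d)" for i
    proof -
      have "\<bar>(p - p0) $ i\<bar> \<le> norm (p - p0)" by (rule component_le_norm_cart)
      also have "\<dots> \<le> 2" using diameter_bounded_bound[OF finite_imp_bounded[OF P(1)] p(1) p0] P(3)
        by (simp add: dist_norm)
      finally have "\<bar>d * (p $ i - p0 $ i)\<bar> \<le> d * 2" using d by (simp add: abs_mult)
      then have "- (d * 2) \<le> d * (p $ i - p0 $ i)" "d * (p $ i - p0 $ i) \<le> d * 2" by linarith+
      moreover define y where "y = d * (p $ i - p0 $ i)"
      ultimately have "- (real CARD('d) * 2) \<le> y" "y \<le> real CARD('d) * 2" by (auto simp: d_def)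
      then have "- 2 * int CARD('d) \<le> \<lfloor>y\<rfloor> \<and> \<lfloor>y\<rfloor> \<le> 2 * int CARD('d)"
        unfolding le_floor_iff floor_le_iff by simp
      then show ?thesis by (simp add: f_def y_def)
    qed
    then show "g \<in> Pi\<^sub>E UNIV (\<lambda>i. {- 2 * int CARD('d)..2 * int CARD('d)})" by (simp add: p(2) PiE_UNIV_domain)
  qed
  ultimately have "card P \<le> card (Pi\<^sub>E (UNIV :: 'd set) (\<lambda>i. {- 2 * int CARD('d)..2 * int CARD('d)}))"
    by (metis card_image card_mono finite_PiE finite finite_atLeastAtMost_int)
  also have "\<dots> = (4 * CARD('d) + 1) ^ CARD('d)" by (simp add: card_PiE nat_add_distrib nat_mult_distrib)
  finally show ?thesis .
qed simp

subsection \<open>The stages of the algorithm\<close>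

definition set_aux :: "'p cell \<Rightarrow> 'p word \<Rightarrow> 'p cell" where
  "set_aux z w = Cell (c_pt z) (c_a z) (c_b z) (c_idx z) w"

text \<open>What a copy contributes to the selection: the two points defining its radius, and its
  number with the failure bit. The point of a cell stays in place.\<close>

definition triple :: "'p cell \<Rightarrow> 'p word \<times> 'p word \<times> 'p word" where
  "triple z = (c_a z, c_b z, c_aux z)"

definition with_triple :: "'p cell \<Rightarrow> 'p word \<times> 'p word \<times> 'p word \<Rightarrow> 'p cell" where
  "with_triple z T = Cell (c_pt z) (fst T) (fst (snd T)) (c_idx z) (snd (snd T))"

definition num :: "'p word \<Rightarrow> nat" where
  "num w = (case w of Num m \<Rightarrow> m | Pt _ \<Rightarrow> 0)"

definition is_pt :: "'p word \<Rightarrow> bool" where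
  "is_pt w = (case w of Num _ \<Rightarrow> False | Pt _ \<Rightarrow> True)"

lemma num_Num [simp]: "num (Num m) = m" by (simp add: num_def)

lemma is_pt_simps [simp]: "is_pt (Pt p)" "\<not> is_pt (Num m)" by (simp_all add: is_pt_def)

lemma is_ptE: "is_pt w \<Longrightarrow> (\<And>p. w = Pt p \<Longrightarrow> thesis) \<Longrightarrow> thesis"
  by (cases w) auto

lemma local_op_pointwise:
  assumes "\<And>c z. atoms (\<phi> c z) \<subseteq> V \<union> atoms z"
  shows "local_op atoms V B (\<lambda>X c. \<phi> c (X c))"
  using assms unfolding local_op_def by fastforce

section \<open>Broadcast and gathering\<close>

primrec clear_digits :: "nat \<Rightarrow> nat \<Rightarrow> nat \<Rightarrow> nat \<Rightarrow> nat \<Rightarrow> nat" where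
  "clear_digits b E h 0 c = c"
| "clear_digits b E h (Suc j) c = clear_digits b E h j (if h \<le> j \<and> j < h + E then c else upd_digit b j 0 c)"

text \<open>\<open>clear_digits\<close> follows a broadcast backwards, from the last round to the
  source cell. Digits below the window, inside it and above it are treated separately; only the
  window survives.\<close>

lemma clear_digits_eq:
  assumes b: "0 < b" and "h + E \<le> t" "c < b ^ t"
  shows "clear_digits b E h t c = (c div b ^ h mod b ^ E) * b ^ h"
proof -
  have low: "clear_digits b E h j c = c div b ^ j * b ^ j" if "j \<le> h" for j c
    using that
  proof (induction j arbitrary: c)
    case (Suc j)
    have "clear_digits b E h (Suc j) c = upd_digit b j 0 c div b ^ j * b ^ j" using Suc by simp
    also have "\<dots> = c div b ^ Suc j * b ^ Suc j" unfolding upd_digit_div(1)[OF b b] by simp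
    finally show ?case .
  qed simp
  have mid: "clear_digits b E h (h + j) c = c div b ^ h * b ^ h" if "j \<le> E" for j c
    using that by (induction j arbitrary: c) (simp_all add: low)
  have "clear_digits b E h j c = c mod b ^ (h + E) div b ^ h * b ^ h" if "h + E \<le> j" "c < b ^ j" for j c
    using that
  proof (induction j arbitrary: c rule: dec_induct)
    case base
    then show ?case by (simp add: mid)
  next
    case (step j)
    have "c div b ^ Suc j = 0" using step.prems by simp
    then have u: "upd_digit b j 0 c = c mod b ^ j" by (simp only: upd_digit_def) simp
    have "clear_digits b E h (Suc j) c = clear_digits b E h j (c mod b ^ j)" using step.hyps u by simp
    also have "\<dots> = c mod b ^ j mod b ^ (h + E) div b ^ h * b ^ h" using b by (intro step.IH) simp
    also have "c mod b ^ j mod b ^ (h + E) = c mod b ^ (h + E)"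
      using step.hyps by (intro mod_mod_cancel le_imp_power_dvd)
    finally show ?case .
  qed
  from this[of t c] have "clear_digits b E h t c = c mod b ^ (h + E) div b ^ h * b ^ h" using assms by simp
  also have "c mod b ^ (h + E) div b ^ h = c div b ^ h mod b ^ E"
    using b by (simp add: power_add mod_mult2_eq)
  finally show ?thesis .
qed

text \<open>Every slot has its own window of \<open>E\<close> digits and is filled from the cell
  whose digits outside the window vanish. The window at 0 will spread the input over all copies;
  windows from digit \<open>E\<close> on make the content a function of the copy number.\<close>

lemma realizable_broadcast:
  fixes h :: "nat \<Rightarrow> nat"
  assumes b: "0 < b" "b dvd B" and h: "\<And>i. i < 3 \<Longrightarrow> h i + E \<le> t"
  shows "\<exists>G. realizable cell_atoms V B (b ^ t) (2 * t) G \<and>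
    (\<forall>X. \<forall>c < b ^ t. \<forall>i < 3. slot (G X c) i = slot (X ((c div b ^ h i mod b ^ E) * b ^ h i)) i)"
proof -
  define src where "src i j c = (if h i \<le> j \<and> j < h i + E then digit b j c else 0)" for i j c
  define \<Phi> :: "nat \<Rightarrow> nat \<Rightarrow> (nat \<Rightarrow> 'a cell) \<Rightarrow> 'a cell" where
    "\<Phi> j c f = Cell (slot (f (src 0 j c)) 0) (slot (f (src 1 j c)) 1) (slot (f (src 2 j c)) 2)
                  (slot (f (digit b j c)) 3) (slot (f (digit b j c)) 4)" for j c f
  have src: "src i j c < b" for i j c using b digit_less[of b j c] by (simp add: src_def)
  have \<Phi>1: "cell_atoms (\<Phi> j c f) \<subseteq> V \<union> (\<Union>i<b. cell_atoms (f i))" for j c f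
    using src[of 0 j c] src[of 1 j c] src[of 2 j c] digit_less[OF b(1), of j c] slot_in_cell_atoms[of "f _"]
    unfolding \<Phi>_def cell_atoms_def[of "Cell _ _ _ _ _"] cell.sel by blast
  have \<Phi>2: "\<Phi> j c f = \<Phi> j c f'" if "\<And>i. i < b \<Longrightarrow> f i = f' i" for j c f f'
    using that src digit_less[OF b(1)] by (simp add: \<Phi>_def)
  obtain G where G: "realizable cell_atoms V B (b ^ t) (2 * (t - 0)) G"
    "\<And>H X c. (\<forall>j c. 0 \<le> j \<longrightarrow> j < t \<longrightarrow> c < b ^ t \<longrightarrow> H (Suc j) c = \<Phi> j c (\<lambda>i. H j (upd_digit b j i c))) \<Longrightarrow>
        (\<forall>c < b ^ t. X c = H 0 c) \<Longrightarrow> c < b ^ t \<Longrightarrow> G X c = H t c"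
    using realizable_digit_ops[where \<Phi> = \<Phi> and atoms = cell_atoms and j\<^sub>0 = 0 and j\<^sub>1 = t and t = t and V = V, OF b \<Phi>1 \<Phi>2]
    by fastforce
  show ?thesis
  proof (intro exI[of _ G] conjI allI impI)
    show "realizable cell_atoms V B (b ^ t) (2 * t) G" using G(1) by simp
    fix X :: "nat \<Rightarrow> 'a cell" and c i :: nat assume c: "c < b ^ t" and i: "i < 3"
    define H where "H j c = Cell (slot (X (clear_digits b E (h 0) j c)) 0) (slot (X (clear_digits b E (h 1) j c)) 1)
      (slot (X (clear_digits b E (h 2) j c)) 2) (slot (X c) 3) (slot (X c) 4)" for j c
    have "H (Suc j) c = \<Phi> j c (\<lambda>i. H j (upd_digit b j i c))" for j c
      by (simp add: H_def \<Phi>_def slot_def src_def upd_digit_same)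
    moreover have "X c = H 0 c" for c by (cases "X c") (simp add: H_def slot_def)
    ultimately have "G X c = H t c" using G(2) c by blast
    then have "slot (G X c) i = slot (X (clear_digits b E (h i) t c)) i"
      using i by (auto simp: H_def slot_def numeral_3_eq_3 numeral_2_eq_2 less_Suc_eq)
    then show "slot (G X c) i = slot (X ((c div b ^ h i mod b ^ E) * b ^ h i)) i"
      using clear_digits_eq[OF b(1) h[OF i] c] by simp
  qed
qed

text \<open>Three rounds prepare the broadcast: word \<open>v\<close> moves to the first slot of
  cell \<open>v\<close>, is duplicated into three slots, and slot \<open>i\<close> moves to cell
  \<open>v * b ^ h i\<close>, from which its broadcast reads.\<close>

lemma realizable_gather:
  fixes h :: "nat \<Rightarrow> nat"
  assumes b: "0 < b" "b dvd B" and h: "\<And>i. i < 3 \<Longrightarrow> h i + E \<le> t" and V: "Num 0 \<in> V"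
  shows "\<exists>G. realizable (\<lambda>w. {w}) V (5 * B) (5 * b ^ t) (2 * t + 3) G \<and>
    (\<forall>x :: nat \<Rightarrow> 'p word. \<forall>c < b ^ t. \<forall>i < 3. slot (cells_of (G x) c) i = x (c div b ^ h i mod b ^ E))"
proof -
  have Et: "b ^ E \<le> b ^ t" using h[of 0] b(1) by (intro power_increasing) auto
  have vt: "v * b ^ h i < b ^ t" if "v < b ^ E" "i < 3" for v i
  proof -
    have "v * b ^ h i < b ^ E * b ^ h i" using that b by simp
    also have "\<dots> \<le> b ^ t" unfolding power_add[symmetric] using h[OF that(2)] b(1) by (intro power_increasing) auto
    finally show ?thesis .
  qed
  obtain \<sigma>1 where \<sigma>1: "bij_below (5 * b ^ t) \<sigma>1" "\<And>v. v < b ^ E \<Longrightarrow> \<sigma>1 (5 * v) = v"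
  proof -
    have "\<exists>\<sigma>. bij_below (5 * b ^ t) \<sigma> \<and> (\<forall>u\<in>(\<lambda>v. 5 * v) ` {..<b ^ E}. \<sigma> u = u div 5)"
      by (rule bij_below_extend) (use Et in \<open>auto simp: inj_on_def\<close>)
    then show thesis using that by auto
  qed
  define A where "A = (\<lambda>(v, i). 5 * (v * b ^ h i) + i) ` ({..<b ^ E} \<times> {..<3})"
  obtain \<sigma>2 where \<sigma>2: "bij_below (5 * b ^ t) \<sigma>2"
    "\<And>v i. v < b ^ E \<Longrightarrow> i < 3 \<Longrightarrow> \<sigma>2 (5 * (v * b ^ h i) + i) = 5 * v + i"
  proof -
    define f where "f u = 5 * (u div 5 div b ^ h (u mod 5)) + u mod 5" for u
    have f: "f (5 * (v * b ^ h i) + i) = 5 * v + i" if "i < 3" for v i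
      using that b(1) by (simp add: f_def)
    have "\<exists>\<sigma>. bij_below (5 * b ^ t) \<sigma> \<and> (\<forall>u\<in>A. \<sigma> u = f u)"
    proof (rule bij_below_extend)
      show "inj_on f A"
      proof (rule inj_onI)
        fix x y assume "x \<in> A" "y \<in> A" and e: "f x = f y"
        then obtain v i v' i' where x: "x = 5 * (v * b ^ h i) + i" "i < 3" and y: "y = 5 * (v' * b ^ h i') + i'" "i' < 3"
          unfolding A_def by auto
        have "5 * v + i = 5 * v' + i'" using e f x y by simp
        then have "(5 * v + i) div 5 = (5 * v' + i') div 5" "(5 * v + i) mod 5 = (5 * v' + i') mod 5" by simp_all
        then have "v = v'" "i = i'" using x(2) y(2) by simp_all
        then show "x = y" using x y by simp
      qed
      have lt: "5 * v + i < 5 * b ^ t" if "v < b ^ t" "i < 3" for v i using that by linarith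
      show "A \<subseteq> {..<5 * b ^ t}" unfolding A_def using lt[OF vt] by auto
      show "f ` A \<subseteq> {..<5 * b ^ t}" unfolding A_def using lt[OF less_le_trans[OF _ Et]] f by auto
    qed
    then show thesis using that f unfolding A_def by fastforce
  qed
  define cp :: "nat \<Rightarrow> 'p cell \<Rightarrow> 'p cell" where "cp c z = Cell (c_pt z) (c_pt z) (c_pt z) (Num 0) (Num 0)" for c z
  have "local_op cell_atoms V B (\<lambda>X c. cp c (X c))"
    by (rule local_op_pointwise) (use V in \<open>auto simp: cp_def cell_atoms_def\<close>)
  note r2 = realizable_words_of_cells[OF realizable_local[OF this, of "b ^ t"]]
  obtain G where G: "realizable cell_atoms V B (b ^ t) (2 * t) G"
    "\<And>(X :: nat \<Rightarrow> 'p cell) c i. c < b ^ t \<Longrightarrow> i < 3 \<Longrightarrow> slot (G X c) i = slot (X ((c div b ^ h i mod b ^ E) * b ^ h i)) i"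
    using realizable_broadcast[where h = h and V = V and E = E, OF b h] by blast
  note r = realizable_comp[OF realizable_comp[OF realizable_comp[OF realizable_perm[OF \<sigma>1(1)] r2]
      realizable_perm[OF \<sigma>2(1)]] realizable_words_of_cells[OF G(1)]]
  have e: "1 + 1 + 1 + 2 * t = 2 * t + 3" by simp
  show ?thesis
  proof (intro exI conjI allI impI)
    show "realizable (\<lambda>w. {w}) V (5 * B) (5 * b ^ t) (2 * t + 3)
      (\<lambda>x. words_of (G (cells_of (\<lambda>u. words_of (\<lambda>c. cp c (cells_of (\<lambda>u. x (\<sigma>1 u)) c)) (\<sigma>2 u)))))"
      using r unfolding e .
    fix x :: "nat \<Rightarrow> 'p word" and c i :: nat assume c: "c < b ^ t" and i: "i < 3"
    define v where "v = c div b ^ h i mod b ^ E"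
    have v: "v < b ^ E" using b by (simp add: v_def)
    have "slot (cells_of (words_of (G (cells_of (\<lambda>u. words_of (\<lambda>c. cp c (cells_of (\<lambda>u. x (\<sigma>1 u)) c)) (\<sigma>2 u))))) c) i
      = words_of (\<lambda>c. cp c (cells_of (\<lambda>u. x (\<sigma>1 u)) c)) (\<sigma>2 (5 * (v * b ^ h i) + i))"
      using G(2)[OF c i] i by (simp add: slot_cells_of v_def)
    also have "\<dots> = slot (cp v (cells_of (\<lambda>u. x (\<sigma>1 u)) v)) i"
      using i by (simp add: \<sigma>2(2)[OF v i] words_of_def)
    also have "\<dots> = x (\<sigma>1 (5 * v))" using i by (auto simp: slot_def cp_def cells_of_def)
    finally show "slot (cells_of (words_of (G (cells_of (\<lambda>u. words_of (\<lambda>c. cp c (cells_of (\<lambda>u. x (\<sigma>1 u)) c)) (\<sigma>2 u))))) c) i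
      = x (c div b ^ h i mod b ^ E)"
      by (simp add: \<sigma>1(2)[OF v]) (simp add: v_def)
  qed
qed

section \<open>Counting inside a copy and selection among the copies\<close>

lemma realizable_sum:
  assumes b: "0 < b" "b dvd B" and E: "E \<le> t" and Bd: "b ^ t \<le> Bd"
  shows "\<exists>G. realizable cell_atoms (Num ` {..Bd}) B (b ^ t) (2 * E) G \<and>
    (\<forall>(X :: nat \<Rightarrow> 'p cell) val. (\<forall>c < b ^ t. c_aux (X c) = Num (val c)) \<longrightarrow> (\<forall>c. val c \<le> 1) \<longrightarrow>
       (\<forall>c < b ^ t. G X c = set_aux (X c) (Num (\<Sum>l<b ^ E. val (c div b ^ E * b ^ E + l)))))"
proof -
  define \<Phi> :: "nat \<Rightarrow> nat \<Rightarrow> (nat \<Rightarrow> 'p cell) \<Rightarrow> 'p cell" where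
    \<comment> \<open>The cap \<open>Bd\<close> makes this a legal operation on every array. On 0-1
      values it never acts, as partial sums stay below \<open>b ^ t \<le> Bd\<close>.\<close>
    "\<Phi> j c f = set_aux (f (digit b j c)) (Num (min Bd (\<Sum>i<b. num (c_aux (f i)))))" for j c f
  have \<Phi>1: "cell_atoms (\<Phi> j c f) \<subseteq> Num ` {..Bd} \<union> (\<Union>i<b. cell_atoms (f i))" for j c f
    using digit_less[OF b(1), of j c] by (auto simp: \<Phi>_def set_aux_def cell_atoms_def)
  have \<Phi>2: "\<Phi> j c f = \<Phi> j c f'" if "\<And>i. i < b \<Longrightarrow> f i = f' i" for j c f f'
    using that digit_less[OF b(1)] by (simp add: \<Phi>_def)
  obtain G where G: "realizable cell_atoms (Num ` {..Bd}) B (b ^ t) (2 * (E - 0)) G"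
    "\<And>H X c. (\<forall>j c. 0 \<le> j \<longrightarrow> j < E \<longrightarrow> c < b ^ t \<longrightarrow> H (Suc j) c = \<Phi> j c (\<lambda>i. H j (upd_digit b j i c))) \<Longrightarrow>
        (\<forall>c < b ^ t. X c = H 0 c) \<Longrightarrow> c < b ^ t \<Longrightarrow> G X c = H E c"
    using realizable_digit_ops[where \<Phi> = \<Phi> and atoms = cell_atoms and j\<^sub>0 = 0 and j\<^sub>1 = E and t = t and V = "Num ` {..Bd}", OF b \<Phi>1 \<Phi>2] E
    by fastforce
  show ?thesis
  proof (intro exI[of _ G] conjI allI impI)
    show "realizable cell_atoms (Num ` {..Bd}) B (b ^ t) (2 * E) G" using G(1) by simp
    fix X :: "nat \<Rightarrow> 'p cell" and val :: "nat \<Rightarrow> nat" and c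
    assume X: "\<forall>c < b ^ t. c_aux (X c) = Num (val c)" and val: "\<forall>c. val c \<le> 1" and c: "c < b ^ t"
    define S where "S j c = (\<Sum>l<b ^ j. val (c div b ^ j * b ^ j + l))" for j c
    define H where "H j c = set_aux (X c) (Num (S j c))" for j c
    have S: "(\<Sum>i<b. S j (upd_digit b j i c)) = S (Suc j) c" for j c
    proof -
      have "(\<Sum>i<b. S j (upd_digit b j i c)) = (\<Sum>i<b. \<Sum>l<b ^ j. val (c div b ^ Suc j * b ^ Suc j + (i * b ^ j + l)))"
        unfolding S_def by (intro sum.cong refl) (simp add: upd_digit_div(1)[OF b(1)] algebra_simps del: power_Suc, simp add: algebra_simps)
      also have "\<dots> = (\<Sum>i<b. sum (\<lambda>l. val (c div b ^ Suc j * b ^ Suc j + l)) {i * b ^ j..<i * b ^ j + b ^ j})"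
      proof (rule sum.cong[OF refl])
        fix i
        show "(\<Sum>l<b ^ j. val (c div b ^ Suc j * b ^ Suc j + (i * b ^ j + l)))
          = sum (\<lambda>l. val (c div b ^ Suc j * b ^ Suc j + l)) {i * b ^ j..<i * b ^ j + b ^ j}"
          using sum.shift_bounds_nat_ivl[of "\<lambda>l. val (c div b ^ Suc j * b ^ Suc j + l)" 0 "i * b ^ j" "b ^ j"]
          by (simp add: lessThan_atLeast0 add.commute)
      qed
      also have "\<dots> = S (Suc j) c" unfolding S_def by (subst sum.nat_group) simp
      finally show ?thesis .
    qed
    have "S j c \<le> b ^ j" for j c
      using sum_mono[of "{..<b ^ j}" "\<lambda>l. val (c div b ^ j * b ^ j + l)" "\<lambda>_. 1"] val by (simp add: S_def)
    then have SBd: "S j c \<le> Bd" if "j \<le> t" for j c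
      using Bd power_increasing[OF that, of b] b(1) by (metis One_nat_def Suc_leI le_trans)
    have "H (Suc j) c = \<Phi> j c (\<lambda>i. H j (upd_digit b j i c))" if "j < E" for j c
      using S[of j c] SBd[of "Suc j" c] that E by (simp add: H_def \<Phi>_def set_aux_def upd_digit_same)
    moreover have "X c = H 0 c" if "c < b ^ t" for c using X that by (cases "X c") (auto simp: H_def S_def set_aux_def)
    ultimately have "G X c = H E c" using G(2) c by blast
    then show "G X c = set_aux (X c) (Num (\<Sum>l<b ^ E. val (c div b ^ E * b ^ E + l)))" by (simp add: H_def S_def)
  qed
qed

definition pick :: "nat \<Rightarrow> (nat \<Rightarrow> ereal) \<Rightarrow> nat" where
  "pick b g = (SOME i. i < b \<and> (\<forall>i'<b. g i \<le> g i'))"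

lemma pick_cong: "(\<And>i. i < b \<Longrightarrow> g i = g' i) \<Longrightarrow> pick b g = pick b g'"
  unfolding pick_def by (rule arg_cong[where f = Eps]) auto

lemma pick_min:
  assumes "0 < b"
  shows "pick b g < b" "i < b \<Longrightarrow> g (pick b g) \<le> g i"
proof -
  have "\<exists>i. i < b \<and> (\<forall>i'<b. g i \<le> g i')"
    using ex_min_if_finite[of "g ` {..<b}"] assms
    by (metis (no_types, lifting) finite_imageI finite_lessThan image_is_empty imageE imageI lessThan_empty_iff lessThan_iff not_gr_zero not_le)
  from someI_ex[OF this] show "pick b g < b" "i < b \<Longrightarrow> g (pick b g) \<le> g i" by (auto simp: pick_def)
qed

text \<open>The winner of a tournament along the \<open>j\<close> low digits, held among the
  addresses that agree with \<open>g\<close> from digit \<open>j\<close> on.\<close>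

primrec select_min :: "nat \<Rightarrow> ('a \<Rightarrow> ereal) \<Rightarrow> (nat \<Rightarrow> 'a) \<Rightarrow> nat \<Rightarrow> nat \<Rightarrow> 'a" where
  "select_min b rk T 0 g = T g"
| "select_min b rk T (Suc j) g =
     select_min b rk T j (upd_digit b j (pick b (\<lambda>i. rk (select_min b rk T j (upd_digit b j i g)))) g)"

text \<open>All addresses of a group obtain the same winner, even when entries tie, because
  \<open>pick\<close> sees the same candidates.\<close>

lemma select_min_cong:
  assumes b: "0 < b" and "g div b ^ j = g' div b ^ j"
  shows "select_min b rk T j g = select_min b rk T j g'"
  using assms(2)
proof (induction j arbitrary: g g')
  case (Suc j)
  have *: "select_min b rk T j (upd_digit b j i g) = select_min b rk T j (upd_digit b j i g')" if "i < b" for i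
    using upd_digit_div(1)[OF b that] Suc by metis
  have "pick b (\<lambda>i. rk (select_min b rk T j (upd_digit b j i g))) = pick b (\<lambda>i. rk (select_min b rk T j (upd_digit b j i g')))"
    by (rule pick_cong) (simp add: *)
  then show ?case using * pick_min(1)[OF b] by simp
qed simp

lemma select_min_spec:
  assumes b: "0 < b"
  shows "(\<exists>g'. g' div b ^ j = g div b ^ j \<and> select_min b rk T j g = T g') \<and>
    (\<forall>g'. g' div b ^ j = g div b ^ j \<longrightarrow> rk (select_min b rk T j g) \<le> rk (T g'))"
proof (induction j arbitrary: g)
  case (Suc j)
  define i where "i = pick b (\<lambda>i. rk (select_min b rk T j (upd_digit b j i g)))"
  have i: "i < b" "\<And>k. k < b \<Longrightarrow> rk (select_min b rk T j (upd_digit b j i g)) \<le> rk (select_min b rk T j (upd_digit b j k g))"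
    using pick_min[OF b, where g = "\<lambda>i. rk (select_min b rk T j (upd_digit b j i g))"] by (auto simp: i_def)
  have eq: "select_min b rk T (Suc j) g = select_min b rk T j (upd_digit b j i g)" by (simp add: i_def)
  have s: "c div b ^ Suc j = c div b ^ j div b" for c by (metis div_mult2_eq power_Suc2)
  have "\<exists>g'. g' div b ^ Suc j = g div b ^ Suc j \<and> select_min b rk T j (upd_digit b j i g) = T g'"
    using Suc[of "upd_digit b j i g"] upd_digit_div(2)[OF b i(1), of j g] by (metis s)
  moreover have "rk (select_min b rk T j (upd_digit b j i g)) \<le> rk (T g')" if "g' div b ^ Suc j = g div b ^ Suc j" for g'
  proof -
    have k: "digit b j g' < b" by (rule digit_less[OF b])
    have "upd_digit b j (digit b j g') g div b ^ j = upd_digit b j (digit b j g') g' div b ^ j"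
      using upd_digit_div(1)[OF b k] that by simp
    then have "g' div b ^ j = upd_digit b j (digit b j g') g div b ^ j" by (simp add: upd_digit_same)
    then have "rk (select_min b rk T j (upd_digit b j (digit b j g') g)) \<le> rk (T g')" using Suc by blast
    then show ?thesis using i(2)[OF k] by (rule order_trans[rotated])
  qed
  ultimately show ?case unfolding eq by blast
qed auto

lemma upd_digit_div_power:
  assumes "0 < b"
  shows "upd_digit b (E + j) i c div b ^ E = upd_digit b j i (c div b ^ E)"
proof -
  have "upd_digit b (E + j) i c = c mod b ^ (E + j) + ((c div b ^ (E + Suc j) * b + i) * b ^ j) * b ^ E"
    by (simp add: upd_digit_def power_add algebra_simps)
  then have "upd_digit b (E + j) i c div b ^ E = (c div b ^ (E + Suc j) * b + i) * b ^ j + c mod b ^ (E + j) div b ^ E"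
    using assms by simp
  also have "c div b ^ (E + Suc j) = c div b ^ E div b ^ Suc j" by (simp only: power_add div_mult2_eq)
  also have "c mod b ^ (E + j) div b ^ E = c div b ^ E mod b ^ j" using assms by (simp add: power_add mod_mult2_eq)
  finally show ?thesis by (simp add: upd_digit_def)
qed

text \<open>The digits from \<open>E\<close> on are those of the copy number. Each position inside a
  copy runs its own tournament; since \<open>T\<close> depends only on the copy, all of them agree
  on \<open>g\<close>.\<close>

lemma realizable_select:
  fixes rk :: "'p word \<times> 'p word \<times> 'p word \<Rightarrow> ereal"
  assumes b: "0 < b" "b dvd B" and E: "E \<le> t"
  shows "\<exists>G. realizable cell_atoms V B (b ^ t) (2 * (t - E)) G \<and>
    (\<forall>(X :: nat \<Rightarrow> 'p cell) T. (\<forall>c < b ^ t. triple (X c) = T (c div b ^ E)) \<longrightarrow>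
       (\<exists>g < b ^ (t - E). (\<forall>g' < b ^ (t - E). rk (T g) \<le> rk (T g')) \<and>
          (\<forall>c < b ^ t. G X c = with_triple (X c) (T g))))"
proof -
  define \<Phi> :: "nat \<Rightarrow> nat \<Rightarrow> (nat \<Rightarrow> 'p cell) \<Rightarrow> 'p cell" where
    "\<Phi> j c f = with_triple (f (digit b j c)) (triple (f (pick b (\<lambda>i. rk (triple (f i))))))" for j c f
  have \<Phi>1: "cell_atoms (\<Phi> j c f) \<subseteq> V \<union> (\<Union>i<b. cell_atoms (f i))" for j c f
    using digit_less[OF b(1), of j c] pick_min(1)[OF b(1), of "\<lambda>i. rk (triple (f i))"]
    by (auto simp: \<Phi>_def with_triple_def triple_def cell_atoms_def)
  have \<Phi>2: "\<Phi> j c f = \<Phi> j c f'" if "\<And>i. i < b \<Longrightarrow> f i = f' i" for j c f f'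
  proof -
    have "pick b (\<lambda>i. rk (triple (f i))) = pick b (\<lambda>i. rk (triple (f' i)))" by (rule pick_cong) (simp add: that)
    then show ?thesis using that digit_less[OF b(1)] pick_min(1)[OF b(1)] by (simp add: \<Phi>_def)
  qed
  obtain G where G: "realizable cell_atoms V B (b ^ t) (2 * (t - E)) G"
    "\<And>H X c. (\<forall>j c. E \<le> j \<longrightarrow> j < t \<longrightarrow> c < b ^ t \<longrightarrow> H (Suc j) c = \<Phi> j c (\<lambda>i. H j (upd_digit b j i c))) \<Longrightarrow>
        (\<forall>c < b ^ t. X c = H E c) \<Longrightarrow> c < b ^ t \<Longrightarrow> G X c = H t c"
    using realizable_digit_ops[where \<Phi> = \<Phi> and atoms = cell_atoms and j\<^sub>0 = E and j\<^sub>1 = t and t = t and V = V, OF b \<Phi>1 \<Phi>2] E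
    by fastforce
  show ?thesis
  proof (intro exI[of _ G] conjI allI impI)
    show "realizable cell_atoms V B (b ^ t) (2 * (t - E)) G" by fact
    fix X :: "nat \<Rightarrow> 'p cell" and T assume X: "\<forall>c < b ^ t. triple (X c) = T (c div b ^ E)"
    define H where "H j c = with_triple (X c) (select_min b rk T (j - E) (c div b ^ E))" for j c
    have "H (Suc j) c = \<Phi> j c (\<lambda>i. H j (upd_digit b j i c))" if "E \<le> j" for j c
    proof -
      obtain j' where j: "j = E + j'" using \<open>E \<le> j\<close> le_Suc_ex by blast
      show ?thesis
        by (simp add: H_def \<Phi>_def j upd_digit_div_power[OF b(1)] upd_digit_same Suc_diff_le)
           (simp add: with_triple_def triple_def upd_digit_div_power[OF b(1)])
    qed
    moreover have "X c = H E c" if "c < b ^ t" for c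
    proof -
      have "with_triple (X c) (triple (X c)) = X c" by (cases "X c") (simp add: with_triple_def triple_def)
      then show ?thesis using X that by (simp add: H_def)
    qed
    ultimately have GX: "G X c = H t c" if "c < b ^ t" for c using G(2) that by blast
    define j where "j = t - E"
    obtain g where g: "g div b ^ j = 0 div b ^ j" "select_min b rk T j 0 = T g"
      "\<And>g'. g' div b ^ j = 0 div b ^ j \<Longrightarrow> rk (T g) \<le> rk (T g')"
      using select_min_spec[OF b(1), of j 0 rk T] by auto
    have lt: "g' div b ^ j = 0 \<longleftrightarrow> g' < b ^ j" for g' using b(1) by (simp add: div_eq_0_iff)
    have "G X c = with_triple (X c) (T g)" if c: "c < b ^ t" for c
    proof -
      have "b ^ t = b ^ j * b ^ E" using E by (simp add: j_def power_add[symmetric])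
      then have "c div b ^ E < b ^ j" using c b(1) by (simp add: div_less_iff_less_mult)
      then have "c div b ^ E div b ^ j = 0 div b ^ j" by simp
      from select_min_cong[OF b(1) this, of rk T] show ?thesis using GX[OF c] g(2) by (simp add: H_def j_def)
    qed
    then show "\<exists>g < b ^ (t - E). (\<forall>g' < b ^ (t - E). rk (T g) \<le> rk (T g')) \<and>
          (\<forall>c < b ^ t. G X c = with_triple (X c) (T g))"
      using g(1,3) lt by (intro exI[of _ g]) (auto simp: j_def)
  qed
qed

section \<open>Compaction of the input, and leaders of sorted runs\<close>

text \<open>The points lie anywhere in the initial memories. One sort of all words, with key 0 for
  points and 1 for fillers, gives them the addresses below \<open>card P\<close>; each occurs once
  by the injectivity assumption.\<close>

lemma realizable_compaction:
  assumes b: "2 \<le> b" and t: "3 \<le> t"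
  shows "\<exists>G. realizable (\<lambda>w. {w}) V (5 * b ^ 3) (5 * b ^ t) (sort_rounds (t - 3)) G \<and>
    (\<forall>(x :: nat \<Rightarrow> 'p word) P. x ` {..<5 * b ^ t} \<inter> range Pt = Pt ` P \<longrightarrow>
       inj_on x {w. w < 5 * b ^ t \<and> is_pt (x w)} \<longrightarrow>
       (\<exists>pts. pts ` {..<card P} = P \<and> (\<forall>v<card P. G x v = Pt (pts v)) \<and>
          (\<forall>v. card P \<le> v \<longrightarrow> v < 5 * b ^ t \<longrightarrow> \<not> is_pt (G x v))))"
proof -
  define N where "N = 5 * b ^ t"
  define key :: "'p word \<Rightarrow> nat" where "key w = (if is_pt w then 0 else 1)" for w
  have N: "5 * b ^ 3 * b ^ (t - 3) = N" using t by (simp add: N_def power_add[symmetric])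
  have N0: "0 < N" using b by (simp add: N_def)
  have "b dvd 5 * b ^ 3" by (simp add: dvd_mult power3_eq_cube)
  moreover have "2 * (b * b) \<le> 5 * b ^ 3"
  proof -
    have "2 * (b * b) \<le> b * (b * b)" using b by (intro mult_le_mono1)
    also have "\<dots> \<le> 5 * b ^ 3" by (simp add: power3_eq_cube mult.assoc)
    finally show ?thesis .
  qed
  ultimately obtain G where G: "realizable (\<lambda>w. {w}) V (5 * b ^ 3) N (sort_rounds (t - 3)) G"
    "sorts_segments key N {0} G"
    using realizable_sort[of b "5 * b ^ 3" "t - 3" N "\<lambda>w. {w}" V key "{0}"] b unfolding N by auto
  show ?thesis
  proof (intro exI[of _ G] conjI allI impI)
    show "realizable (\<lambda>w. {w}) V (5 * b ^ 3) (5 * b ^ t) (sort_rounds (t - 3)) G"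
      using G(1) by (simp add: N_def)
    fix x :: "nat \<Rightarrow> 'p word" and P
    assume P: "x ` {..<5 * b ^ t} \<inter> range Pt = Pt ` P" and inj: "inj_on x {w. w < 5 * b ^ t \<and> is_pt (x w)}"
    obtain \<sigma> where \<sigma>: "segment_perm N {0} \<sigma>" "\<And>u. G x u = x (\<sigma> u)"
      using G(2) unfolding sorts_segments_def by metis
    have lt: "\<sigma> u < N \<longleftrightarrow> u < N" for u
      using \<sigma>(1) N0 unfolding segment_perm_def by (metis div_less div_eq_0_iff less_not_refl2)
    define D where "D = {v. v < N \<and> is_pt (G x v)}"
    have D: "v \<in> D \<longleftrightarrow> v < card D" for v
    proof (rule down_closed_eq_lessThan_card)
      show "D \<subseteq> {..<N}" by (auto simp: D_def)
      fix i j assume ij: "i \<le> j" "j \<in> D"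
      then have "j < N" by (simp add: D_def)
      then have "i div N = j div N" "i div N \<in> {0}" using ij by auto
      then have "key (G x i) \<le> key (G x j)" using G(2) ij(1) unfolding sorts_segments_def by blast
      then show "i \<in> D" using ij by (auto simp: D_def key_def split: if_splits)
    qed
    have img: "G x ` D = Pt ` P"
    proof (intro set_eqI iffI)
      fix w assume "w \<in> G x ` D"
      then obtain v where v: "v < N" "is_pt (x (\<sigma> v))" "w = x (\<sigma> v)" by (auto simp: D_def \<sigma>(2))
      then have "w \<in> x ` {..<5 * b ^ t} \<inter> range Pt" using lt by (auto simp: N_def elim: is_ptE)
      then show "w \<in> Pt ` P" using P by simp
    next
      fix w assume "w \<in> Pt ` P"
      then have "w \<in> x ` {..<5 * b ^ t} \<inter> range Pt" using P by simp
      then obtain u p where u: "u < N" "w = x u" "w = Pt p" unfolding N_def by blast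
      obtain v where v: "\<sigma> v = u" using \<sigma>(1) by (metis segment_perm_def bij_pointE)
      then have "v < N" using u lt by blast
      then show "w \<in> G x ` D" using u v by (intro image_eqI[of _ _ v]) (simp_all add: D_def \<sigma>(2), metis is_pt_simps(1))
    qed
    have "inj \<sigma>" using \<sigma>(1) by (simp add: segment_perm_def bij_is_inj)
    have "inj_on (G x) D"
    proof (rule inj_onI)
      fix u v assume uv: "u \<in> D" "v \<in> D" "G x u = G x v"
      have "\<sigma> w \<in> {w. w < 5 * b ^ t \<and> is_pt (x w)}" if "w \<in> D" for w
        using that lt[of w] by (simp add: D_def \<sigma>(2)) (simp add: N_def)
      then have "\<sigma> u = \<sigma> v" using inj_onD[OF inj, of "\<sigma> u" "\<sigma> v"] uv by (simp add: \<sigma>(2))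
      then show "u = v" using \<open>inj \<sigma>\<close> by (simp add: inj_eq)
    qed
    then have "card D = card (Pt ` P)" using card_image img by metis
    also have "\<dots> = card P" by (intro card_image) (simp add: inj_on_def)
    finally have cD: "card D = card P" .
    define pts where "pts v = (SOME p. G x v = Pt p)" for v
    have pts: "G x v = Pt (pts v)" if "v < card P" for v
    proof -
      have "is_pt (G x v)" using D[of v] that cD by (simp add: D_def)
      then obtain p where "G x v = Pt p" by (rule is_ptE)
      then show ?thesis unfolding pts_def by (rule someI)
    qed
    show "\<exists>pts. pts ` {..<card P} = P \<and> (\<forall>v<card P. G x v = Pt (pts v)) \<and>
          (\<forall>v. card P \<le> v \<longrightarrow> v < 5 * b ^ t \<longrightarrow> \<not> is_pt (G x v))"
    proof (intro exI[of _ pts] conjI allI impI)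
      have "D = {..<card P}" using D cD by auto
      then have "Pt ` pts ` {..<card P} = Pt ` P" using img pts by (force simp: image_image)
      then show "pts ` {..<card P} = P" by (simp add: inj_image_eq_iff inj_def)
      show "\<not> is_pt (G x v)" if "card P \<le> v" "v < 5 * b ^ t" for v
        using D[of v] that cD by (auto simp: D_def N_def)
    qed (rule pts)
  qed
qed

text \<open>It lets a cell compare itself with its predecessor, which may be on another machine:
  every cell copies its point into its last slot, and the last slots move on by one cell.\<close>

lemma realizable_shift:
  shows "\<exists>G. realizable (\<lambda>w. {w}) V (5 * B) (5 * N) 2 G \<and>
    (\<forall>x :: nat \<Rightarrow> 'p word. \<forall>c<N. \<exists>w. cells_of (G x) c = set_aux (cells_of x c) w \<and>
       (0 < c \<longrightarrow> w = c_pt (cells_of x (c - 1))))"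
proof -
  \<comment> \<open>Word 4 is the last slot of cell 0, which has no predecessor; what it receives is
    left to the extension of \<open>f\<close>.\<close>
  define A where "A = {w. w < 5 * N \<and> w \<noteq> 4}"
  define f where "f w = (if w mod 5 = 4 then w - 5 else w)" for w :: nat
  have "\<exists>\<sigma>. bij_below (5 * N) \<sigma> \<and> (\<forall>u\<in>A. \<sigma> u = f u)"
  proof (rule bij_below_extend)
    have ge: "5 \<le> w" if "w mod 5 = 4" "w \<noteq> 4" for w :: nat using that by presburger
    show "inj_on f A"
    proof (rule inj_onI)
      fix u v assume uv: "u \<in> A" "v \<in> A" "f u = f v"
      have m: "f w mod 5 = w mod 5" if "w \<in> A" for w
      proof (cases "w mod 5 = 4")
        case True
        then have "5 \<le> w" using that ge by (simp add: A_def)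
        then obtain d where "w = 5 + d" using le_Suc_ex by blast
        then show ?thesis by (simp add: f_def)
      qed (simp add: f_def)
      have "u mod 5 = v mod 5" using m uv by metis
      moreover have "5 \<le> w" if "w \<in> A" "w mod 5 = 4" for w using that ge by (simp add: A_def)
      ultimately show "u = v" using uv unfolding f_def by (metis eq_diff_iff)
    qed
    show "A \<subseteq> {..<5 * N}" by (auto simp: A_def)
    show "f ` A \<subseteq> {..<5 * N}" by (auto simp: A_def f_def)
  qed
  then obtain \<sigma> where \<sigma>: "bij_below (5 * N) \<sigma>" "\<And>u. u \<in> A \<Longrightarrow> \<sigma> u = f u" by blast
  have "local_op cell_atoms V B (\<lambda>X c. set_aux (X c) (c_pt (X c)))"
    by (rule local_op_pointwise) (auto simp: set_aux_def cell_atoms_def)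
  note r = realizable_comp[OF realizable_words_of_cells[OF realizable_local[OF this, of N]] realizable_perm[OF \<sigma>(1)]]
  show ?thesis
  proof (rule exI, intro conjI allI impI)
    show "realizable (\<lambda>w. {w}) V (5 * B) (5 * N) 2
      (\<lambda>x u. words_of (\<lambda>c. set_aux (cells_of x c) (c_pt (cells_of x c))) (\<sigma> u))"
      using r by (simp add: numeral_2_eq_2)
    fix x :: "nat \<Rightarrow> 'p word" and c assume c: "c < N"
    define y where "y = words_of (\<lambda>c. set_aux (cells_of x c) (c_pt (cells_of x c)))"
    have y: "y (5 * c + i) = slot (set_aux (cells_of x c) (c_pt (cells_of x c))) i" if "i < 5" for c i
      using that by (simp add: y_def words_of_def)
    have s: "\<sigma> (5 * c + i) = 5 * c + i" if "i < 4" for i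
    proof -
      have "5 * c + i \<noteq> 4" using that by presburger
      then have "5 * c + i \<in> A" using that c by (simp add: A_def)
      then show ?thesis using that \<sigma>(2) by (simp add: f_def)
    qed
    have "cells_of (\<lambda>u. y (\<sigma> u)) c = Cell (y (5 * c)) (y (5 * c + 1)) (y (5 * c + 2)) (y (5 * c + 3)) (y (\<sigma> (5 * c + 4)))"
      using s[of 0] s[of 1] s[of 2] s[of 3] by (simp add: cells_of_def)
    also have "\<dots> = set_aux (cells_of x c) (y (\<sigma> (5 * c + 4)))"
      using y[of 0 c] y[of 1 c] y[of 2 c] y[of 3 c] by (simp add: set_aux_def slot_def)
    finally have 1: "cells_of (\<lambda>u. y (\<sigma> u)) c = set_aux (cells_of x c) (y (\<sigma> (5 * c + 4)))" .
    have 2: "y (\<sigma> (5 * c + 4)) = c_pt (cells_of x (c - 1))" if "0 < c"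
    proof -
      obtain c' where c': "c = Suc c'" using \<open>0 < c\<close> gr0_implies_Suc by blast
      have "\<sigma> (5 * c + 4) = f (5 * c + 4)" using c that by (intro \<sigma>(2)) (simp add: A_def)
      also have "\<dots> = 5 * c' + 4" by (simp add: f_def c')
      finally show ?thesis using y[of 4 c'] by (simp add: c' set_aux_def slot_def)
    qed
    show "\<exists>w. cells_of (\<lambda>u. words_of (\<lambda>c. set_aux (cells_of x c) (c_pt (cells_of x c))) (\<sigma> u)) c
        = set_aux (cells_of x c) w \<and> (0 < c \<longrightarrow> w = c_pt (cells_of x (c - 1)))"
      using 1 2 unfolding y_def by blast
  qed
qed

text \<open>Leaders are the first entries of the runs of equal keys; the least index with a given
  key is one. \<open>pt\<close> is constant on a run because points and fillers will never share a
  key.\<close>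

lemma sorted_leaders:
  fixes kk :: "nat \<Rightarrow> nat"
  assumes mono: "\<And>u v. u \<le> v \<Longrightarrow> v < L \<Longrightarrow> kk u \<le> kk v"
    and pt: "\<And>u v. u < L \<Longrightarrow> v < L \<Longrightarrow> kk u = kk v \<Longrightarrow> pt u \<longleftrightarrow> pt v"
  defines "Ld \<equiv> {v. v < L \<and> pt v \<and> (v = 0 \<or> kk (v - 1) \<noteq> kk v)}"
  shows "inj_on kk Ld" "kk ` Ld = kk ` {v. v < L \<and> pt v}"
proof -
  have "kk u \<noteq> kk v" if "u \<in> Ld" "v \<in> Ld" "u < v" for u v
  proof
    assume e: "kk u = kk v"
    have "kk u \<le> kk (v - 1)" "kk (v - 1) \<le> kk v" using that by (auto simp: Ld_def intro!: mono)
    then show False using e that by (auto simp: Ld_def)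
  qed
  then show "inj_on kk Ld" by (metis inj_onI linorder_neqE_nat)
  show "kk ` Ld = kk ` {v. v < L \<and> pt v}"
  proof
    show "kk ` {v. v < L \<and> pt v} \<subseteq> kk ` Ld"
    proof
      fix k assume "k \<in> kk ` {v. v < L \<and> pt v}"
      then obtain v where v: "v < L" "pt v" "k = kk v" by auto
      define u where "u = (LEAST u. kk u = k)"
      have u: "kk u = k" unfolding u_def by (rule LeastI[of _ v]) (simp add: v)
      have "u \<le> v" unfolding u_def by (rule Least_le) (simp add: v)
      moreover have "kk (u - 1) \<noteq> k" if "0 < u" using not_less_Least[of "u - 1" "\<lambda>u. kk u = k"] that by (simp add: u_def)
      ultimately have "u \<in> Ld" using v u pt[of u v] by (auto simp: Ld_def)
      then show "k \<in> kk ` Ld" using u by blast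
    qed
  qed (auto simp: Ld_def)
qed

section \<open>The composed clustering stage\<close>

text \<open>\<open>y\<close> will be the compacted input. The copy number is the address without its
  \<open>E\<close> low digits, so the window at \<open>h\<close> of the address is the window at
  \<open>h - E\<close> of \<open>g\<close>.\<close>

definition pilot :: "bool \<Rightarrow> nat \<Rightarrow> nat \<Rightarrow> (nat \<Rightarrow> 'p word) \<Rightarrow> nat \<Rightarrow> nat \<Rightarrow> 'p word" where
  "pilot useP b E y h g = (if useP then y (g div b ^ (h - E) mod b ^ E) else Num 0)"

text \<open>The last three conjuncts say that \<open>C\<close> is a transversal of the classes of
  \<open>K g\<close> on \<open>P\<close>: one representative for each nonempty cell. The promise is
  conditional on some copy passing the test.\<close>

definition selects_best_copy ::
  "nat \<Rightarrow> nat \<Rightarrow> (nat \<Rightarrow> 'p \<Rightarrow> nat) \<Rightarrow> (nat \<Rightarrow> real) \<Rightarrow> 'p set \<Rightarrow> 'p set \<Rightarrow> bool" where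
  "selects_best_copy N m K r P C \<longleftrightarrow>
     (let ok = (\<lambda>g. g < N \<and> card (K g ` P) \<le> m \<and> 0 < r g)
      in (\<exists>g. ok g) \<longrightarrow> (\<exists>g. ok g \<and> (\<forall>g'. ok g' \<longrightarrow> r g \<le> r g') \<and>
           C \<subseteq> P \<and> K g ` C = K g ` P \<and> card C = card (K g ` P)))"

text \<open>In order: compaction, gathering, numbering of the copies, sorting each copy by key,
  fetching predecessors, marking leaders, counting them, the verdict on each copy, selection,
  output.\<close>

definition cluster_rounds :: "nat \<Rightarrow> nat \<Rightarrow> nat" where
  "cluster_rounds E t = sort_rounds (t - 3) + (2 * t + 3) + 1 + sort_rounds (E - 3) + 2 + 1 + 2 * E + 1 + 2 * (t - E) + 1"

text \<open>\<open>key\<close> and \<open>rad\<close> are abstract, so that dyadic and pair guesses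
  share one pipeline. The order of the compacted array \<open>y\<close> is not known beforehand; it
  decides which points serve as pilots, and therefore appears in the conclusion.\<close>

lemma realizable_clustering:
  fixes key :: "'p word \<Rightarrow> 'p word \<Rightarrow> 'p word \<Rightarrow> 'p word \<Rightarrow> nat"
    and rad :: "nat \<Rightarrow> 'p word \<Rightarrow> 'p word \<Rightarrow> real"
  assumes b: "2 \<le> b" and E: "3 \<le> E" "E \<le> t" and Bd: "2 * b ^ t \<le> Bd"
    and h: "h\<^sub>1 + E \<le> t" "h\<^sub>2 + E \<le> t" and hE: "useP \<longrightarrow> E \<le> h\<^sub>1 \<and> E \<le> h\<^sub>2"
    and key: "\<And>p z a a' i. key (Pt p) a a' i \<noteq> key (Num z) a a' i"
  shows "\<exists>G. realizable (\<lambda>w. {w}) (Num ` {..Bd}) (5 * b ^ 3) (5 * b ^ t) (cluster_rounds E t) G \<and>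
    (\<forall>x P. x ` {..<5 * b ^ t} \<inter> range Pt = Pt ` P \<longrightarrow>
       inj_on x {w. w < 5 * b ^ t \<and> is_pt (x w)} \<longrightarrow> finite P \<longrightarrow> card P \<le> b ^ E \<longrightarrow>
       (\<exists>y pts. pts ` {..<card P} = P \<and> (\<forall>v<card P. y v = Pt (pts v)) \<and>
          selects_best_copy (b ^ (t - E)) m
            (\<lambda>g p. key (Pt p) (pilot useP b E y h\<^sub>1 g) (pilot useP b E y h\<^sub>2 g) (Num g))
            (\<lambda>g. rad g (pilot useP b E y h\<^sub>1 g) (pilot useP b E y h\<^sub>2 g)) P {p. \<exists>w<5 * b ^ t. G x w = Pt p}))"
proof -
  define V :: "'p word set" where "V = Num ` {..Bd}"
  have b0: "0 < b" "b dvd b ^ 3" using b by (auto simp: power3_eq_cube)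
  have bt: "1 \<le> b ^ t" "b ^ E \<le> b ^ t" "0 < b ^ E" using b E by (auto intro: power_increasing)
  have [simp]: "0 < b" by (fact b0(1))
  have t3: "3 \<le> t" using E by simp
  obtain G1 where G1: "realizable (\<lambda>w. {w}) V (5 * b ^ 3) (5 * b ^ t) (sort_rounds (t - 3)) G1"
    and G1': "\<forall>(x :: nat \<Rightarrow> 'p word) P. x ` {..<5 * b ^ t} \<inter> range Pt = Pt ` P \<longrightarrow>
       inj_on x {w. w < 5 * b ^ t \<and> is_pt (x w)} \<longrightarrow>
       (\<exists>pts. pts ` {..<card P} = P \<and> (\<forall>v<card P. G1 x v = Pt (pts v)) \<and>
          (\<forall>v. card P \<le> v \<longrightarrow> v < 5 * b ^ t \<longrightarrow> \<not> is_pt (G1 x v)))"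
    using realizable_compaction[OF b t3, where V = V]
    by (elim exE conjE) (rule that)
  define h where "h i = (if i = 0 then 0 else if i = 1 then h\<^sub>1 else h\<^sub>2)" for i :: nat
  have hE': "h i + E \<le> t" for i using h E by (simp add: h_def)
  have "Num 0 \<in> V" by (simp add: V_def)
  obtain G2 where G2: "realizable (\<lambda>w. {w}) V (5 * b ^ 3) (5 * b ^ t) (2 * t + 3) G2"
    and G2': "\<forall>x :: nat \<Rightarrow> 'p word. \<forall>c < b ^ t. \<forall>i < 3. slot (cells_of (G2 x) c) i = x (c div b ^ h i mod b ^ E)"
    using realizable_gather[where h = h and E = E and t = t and V = V, OF b0 hE' \<open>Num 0 \<in> V\<close>]
    by (elim exE conjE) (rule that)
  \<comment> \<open>Without pilots the gathered second and third slots are arbitrary points and get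
    overwritten, so that the state of a copy is a function of its number.\<close>
  define \<phi>3 :: "nat \<Rightarrow> 'p cell \<Rightarrow> 'p cell" where
    "\<phi>3 c z = Cell (c_pt z) (if useP then c_a z else Num 0) (if useP then c_b z else Num 0)
      (Num (min Bd (c div b ^ E))) (Num 0)" for c z
  have l3: "local_op cell_atoms V (b ^ 3) (\<lambda>X c. \<phi>3 c (X c))"
    by (rule local_op_pointwise) (auto simp: \<phi>3_def cell_atoms_def V_def)
  define ckey :: "'p cell \<Rightarrow> nat" where "ckey z = key (c_pt z) (c_a z) (c_b z) (c_idx z)" for z
  have bE: "b ^ 3 * b ^ (E - 3) = b ^ E" using E by (simp add: power_add[symmetric])
  have "2 * (b * b) \<le> b ^ 3" using b by (simp add: power3_eq_cube mult.assoc)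
  moreover have "b ^ 3 * b ^ (E - 3) dvd b ^ t" unfolding bE using E by (intro le_imp_power_dvd)
  ultimately obtain G4 where G4: "realizable cell_atoms V (b ^ 3) (b ^ t) (sort_rounds (E - 3)) G4"
    "sorts_segments ckey (b ^ E) UNIV G4"
    using realizable_sort[of b "b ^ 3" "E - 3" "b ^ t" cell_atoms V ckey UNIV] b0 b unfolding bE by auto
  obtain G5 where G5: "realizable (\<lambda>w. {w}) V (5 * b ^ 3) (5 * b ^ t) 2 G5"
    and G5': "\<forall>x :: nat \<Rightarrow> 'p word. \<forall>c<b ^ t. \<exists>w. cells_of (G5 x) c = set_aux (cells_of x c) w \<and>
       (0 < c \<longrightarrow> w = c_pt (cells_of x (c - 1)))"
    using realizable_shift[of V "b ^ 3" "b ^ t"]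
    by (elim exE conjE) (rule that)
  \<comment> \<open>At the start of a copy the predecessor belongs to another copy, or is
    unspecified for cell 0; the first cell of a copy leads whenever it holds a point.\<close>
  define lead :: "nat \<Rightarrow> 'p cell \<Rightarrow> bool" where
    "lead c z \<longleftrightarrow> is_pt (c_pt z) \<and> (c mod b ^ E = 0 \<or> key (c_aux z) (c_a z) (c_b z) (c_idx z) \<noteq> ckey z)" for c z
  define \<phi>6 :: "nat \<Rightarrow> 'p cell \<Rightarrow> 'p cell" where
    "\<phi>6 c z = Cell (if lead c z then c_pt z else Num 0) (c_a z) (c_b z) (c_idx z) (Num (if lead c z then 1 else 0))" for c z
  have "1 \<le> Bd" using bt(1) Bd by linarith
  then have "0 \<in> {..Bd}" "Suc 0 \<in> {..Bd}" by auto
  then have l6: "local_op cell_atoms V (b ^ 3) (\<lambda>X c. \<phi>6 c (X c))"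
    by (intro local_op_pointwise) (auto simp: \<phi>6_def cell_atoms_def V_def)
  have "b ^ t \<le> Bd" using Bd by simp
  obtain G7 where G7: "realizable cell_atoms V (b ^ 3) (b ^ t) (2 * E) G7"
    and G7': "\<forall>(X :: nat \<Rightarrow> 'p cell) val. (\<forall>c < b ^ t. c_aux (X c) = Num (val c)) \<longrightarrow> (\<forall>c. val c \<le> 1) \<longrightarrow>
       (\<forall>c < b ^ t. G7 X c = set_aux (X c) (Num (\<Sum>l<b ^ E. val (c div b ^ E * b ^ E + l))))"
    using realizable_sum[OF b0 E(2), of Bd, OF \<open>b ^ t \<le> Bd\<close>]
    by (elim exE conjE) (rule that[unfolded V_def])
  \<comment> \<open>The copy number is doubled to make room for the failure bit; hence the
    requirement \<open>2 * b ^ t \<le> Bd\<close>.\<close>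
  define \<phi>8 :: "nat \<Rightarrow> 'p cell \<Rightarrow> 'p cell" where
    "\<phi>8 c z = set_aux z (Num (min Bd (2 * (c div b ^ E) +
       (if num (c_aux z) \<le> m \<and> 0 < rad (c div b ^ E) (c_a z) (c_b z) then 0 else 1))))" for c z
  have l8: "local_op cell_atoms V (b ^ 3) (\<lambda>X c. \<phi>8 c (X c))"
    by (rule local_op_pointwise) (auto simp: \<phi>8_def set_aux_def cell_atoms_def V_def)
  define rk :: "'p word \<times> 'p word \<times> 'p word \<Rightarrow> ereal" where
    "rk T = (if even (num (snd (snd T))) then ereal (rad (num (snd (snd T)) div 2) (fst T) (fst (snd T))) else \<infinity>)" for T
  obtain G9 where G9: "realizable cell_atoms V (b ^ 3) (b ^ t) (2 * (t - E)) G9"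
    and G9': "\<forall>(X :: nat \<Rightarrow> 'p cell) T. (\<forall>c < b ^ t. triple (X c) = T (c div b ^ E)) \<longrightarrow>
       (\<exists>g < b ^ (t - E). (\<forall>g' < b ^ (t - E). rk (T g) \<le> rk (T g')) \<and>
          (\<forall>c < b ^ t. G9 X c = with_triple (X c) (T g)))"
    using realizable_select[OF b0 E(2), of V rk]
    by (elim exE conjE) (rule that)
  \<comment> \<open>After the selection every cell knows the number of the winner. Leaders survive
    in this copy alone, and nothing is output if the winner failed, as its number is then
    odd.\<close>
  define \<phi>10 :: "nat \<Rightarrow> 'p cell \<Rightarrow> 'p cell" where
    "\<phi>10 c z = Cell (if c_aux z = Num (2 * (c div b ^ E)) then c_pt z else Num 0) (Num 0) (Num 0) (Num 0) (Num 0)" for c z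
  have l10: "local_op cell_atoms V (b ^ 3) (\<lambda>X c. \<phi>10 c (X c))"
    by (rule local_op_pointwise) (auto simp: \<phi>10_def cell_atoms_def V_def)
  note rw = realizable_words_of_cells
  note R = realizable_comp[OF realizable_comp[OF realizable_comp[OF realizable_comp[OF realizable_comp[OF
      realizable_comp[OF realizable_comp[OF realizable_comp[OF realizable_comp[OF G1 G2]
        rw[OF realizable_local[OF l3]]] rw[OF G4(1)]] G5] rw[OF realizable_local[OF l6]]] rw[OF G7]]
        rw[OF realizable_local[OF l8]]] rw[OF G9]] rw[OF realizable_local[OF l10]]]
  note R' = R[folded cluster_rounds_def, unfolded cells_of_words_of, unfolded V_def]
  define G where "G = (\<lambda>x. words_of (\<lambda>c. \<phi>10 c (G9 (\<lambda>c. \<phi>8 c (G7 (\<lambda>c. \<phi>6 c (cells_of (G5 (words_of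
    (G4 (\<lambda>c. \<phi>3 c (cells_of (G2 (G1 x)) c))))) c)) c)) c)))"
  have "realizable (\<lambda>w. {w}) (Num ` {..Bd}) (5 * b ^ 3) (5 * b ^ t) (cluster_rounds E t) G"
    unfolding G_def by (rule R')
  then show ?thesis
  proof (intro exI[of _ G] conjI allI impI)
    fix x :: "nat \<Rightarrow> 'p word" and P
    assume xP: "x ` {..<5 * b ^ t} \<inter> range Pt = Pt ` P" "inj_on x {w. w < 5 * b ^ t \<and> is_pt (x w)}"
      and finP: "finite P" and cardP: "card P \<le> b ^ E"
    define y where "y = G1 x"
    obtain pts where pts: "pts ` {..<card P} = P" "\<And>v. v < card P \<Longrightarrow> y v = Pt (pts v)"
      "\<And>v. card P \<le> v \<Longrightarrow> v < 5 * b ^ t \<Longrightarrow> \<not> is_pt (y v)"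
      using G1'[rule_format, OF xP] unfolding y_def by blast
    define pil where "pil = pilot useP b E y"
    define K where "K = (\<lambda>g p. key (Pt p) (pil h\<^sub>1 g) (pil h\<^sub>2 g) (Num g))"
    define r where "r = (\<lambda>g. rad g (pil h\<^sub>1 g) (pil h\<^sub>2 g))"
    define ok where "ok g \<longleftrightarrow> g < b ^ (t - E) \<and> card (K g ` P) \<le> m \<and> 0 < r g" for g
    define X2 where "X2 = cells_of (G2 y)"
    define X3 where "X3 = (\<lambda>c. \<phi>3 c (X2 c))"
    define X4 where "X4 = G4 X3"
    define X5 where "X5 = cells_of (G5 (words_of X4))"
    define X6 where "X6 = (\<lambda>c. \<phi>6 c (X5 c))"
    define X7 where "X7 = G7 X6"
    define X8 where "X8 = (\<lambda>c. \<phi>8 c (X7 c))"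
    define X9 where "X9 = G9 X8"
    define X10 where "X10 = (\<lambda>c. \<phi>10 c (X9 c))"
    define C where "C = {p. \<exists>w<5 * b ^ t. G x w = Pt p}"
    have Gx: "G x = words_of X10"
      by (simp add: G_def X10_def X9_def X8_def X7_def X6_def X5_def X4_def X3_def X2_def y_def)
    have tE: "b ^ t = b ^ (t - E) * b ^ E" using E by (simp add: power_add[symmetric])
    have g_lt: "c div b ^ E < b ^ (t - E)" if "c < b ^ t" for c
      using that bt unfolding tE by (simp add: div_less_iff_less_mult)
    have c_lt: "g * b ^ E + v < b ^ t" if "g < b ^ (t - E)" "v < b ^ E" for g v
    proof -
      have "g * b ^ E + v < Suc g * b ^ E" using that by simp
      also have "\<dots> \<le> b ^ (t - E) * b ^ E" using that by (intro mult_le_mono1) simp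
      finally show ?thesis using tE by simp
    qed
    have g_Bd: "2 * g + 1 \<le> Bd" if "g < b ^ (t - E)" for g
    proof -
      have "b ^ (t - E) \<le> b ^ t" using b by (intro power_increasing) auto
      then show ?thesis using that Bd by linarith
    qed
    have X3: "X3 c = Cell (y (c mod b ^ E)) (pil h\<^sub>1 (c div b ^ E)) (pil h\<^sub>2 (c div b ^ E)) (Num (c div b ^ E)) (Num 0)"
      if c: "c < b ^ t" for c
    proof -
      have s: "slot (X2 c) i = y (c div b ^ h i mod b ^ E)" if "i < 3" for i
        using G2'[rule_format, OF c that] by (simp add: X2_def)
      have dd: "c div b ^ h' = c div b ^ E div b ^ (h' - E)" if "E \<le> h'" for h'
        using that by (simp add: div_mult2_eq[symmetric] power_add[symmetric])
      have "c_pt (X2 c) = y (c mod b ^ E)" using s[of 0] by (simp add: slot_def h_def)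
      moreover have "c_a (X2 c) = pil h\<^sub>1 (c div b ^ E)" if useP
        using s[of 1] that hE dd[of h\<^sub>1] by (simp add: slot_def h_def pil_def pilot_def)
      moreover have "c_b (X2 c) = pil h\<^sub>2 (c div b ^ E)" if useP
        using s[of 2] that hE dd[of h\<^sub>2] by (simp add: slot_def h_def pil_def pilot_def)
      moreover have "min Bd (c div b ^ E) = c div b ^ E" using g_Bd[OF g_lt[OF c]] by simp
      ultimately show ?thesis by (cases useP) (simp_all add: X3_def \<phi>3_def pil_def pilot_def)
    qed
    obtain \<sigma> where \<sigma>: "segment_perm (b ^ E) UNIV \<sigma>" "\<And>c. X4 c = X3 (\<sigma> c)"
      using G4(2) unfolding sorts_segments_def X4_def by metis
    have \<sigma>d: "\<sigma> c div b ^ E = c div b ^ E" for c using \<sigma>(1) by (simp add: segment_perm_def)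
    have \<sigma>lt: "\<sigma> c < b ^ t" if "c < b ^ t" for c
    proof -
      have "\<sigma> c div b ^ E < b ^ (t - E)" using \<sigma>d g_lt[OF that] by simp
      then show ?thesis unfolding tE using bt by (simp add: div_less_iff_less_mult)
    qed
    define yy where "yy c = y (\<sigma> c mod b ^ E)" for c
    have X4: "X4 c = Cell (yy c) (pil h\<^sub>1 (c div b ^ E)) (pil h\<^sub>2 (c div b ^ E)) (Num (c div b ^ E)) (Num 0)"
      if c: "c < b ^ t" for c
      using X3[OF \<sigma>lt[OF c]] by (simp add: \<sigma>(2) \<sigma>d yy_def)
    define kk where "kk g v = key (yy (g * b ^ E + v)) (pil h\<^sub>1 g) (pil h\<^sub>2 g) (Num g)" for g v
    define Ld where "Ld g = {v. v < b ^ E \<and> is_pt (yy (g * b ^ E + v)) \<and> (v = 0 \<or> kk g (v - 1) \<noteq> kk g v)}" for g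
    have kk: "ckey (X4 (g * b ^ E + v)) = kk g v" if "g < b ^ (t - E)" "v < b ^ E" for g v
      using X4[OF c_lt[OF that]] that bt(3) by (simp add: ckey_def kk_def)
    have X6: "X6 (g * b ^ E + v) = Cell (if v \<in> Ld g then yy (g * b ^ E + v) else Num 0) (pil h\<^sub>1 g) (pil h\<^sub>2 g) (Num g)
        (Num (if v \<in> Ld g then 1 else 0))" if gv: "g < b ^ (t - E)" "v < b ^ E" for g v
    proof -
      define c where "c = g * b ^ E + v"
      have c: "c < b ^ t" "c div b ^ E = g" "c mod b ^ E = v" using gv c_lt by (auto simp: c_def)
      obtain w where w: "X5 c = set_aux (X4 c) w" "0 < c \<Longrightarrow> w = c_pt (X4 (c - 1))"
        using G5'[rule_format, OF c(1), of "words_of X4"] by (auto simp: X5_def)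
      have "lead c (X5 c) \<longleftrightarrow> v \<in> Ld g"
      proof (cases "v = 0")
        case True
        then show ?thesis using gv c X4[OF c(1)] w(1) by (simp add: lead_def Ld_def set_aux_def c_def)
      next
        case False
        then have c1: "c - 1 = g * b ^ E + (v - 1)" "0 < c" "v - 1 < b ^ E" using gv by (auto simp: c_def)
        then have "w = yy (g * b ^ E + (v - 1))" using w(2) X4[OF c_lt[OF gv(1) c1(3)]] by simp
        then have "key (c_aux (X5 c)) (c_a (X5 c)) (c_b (X5 c)) (c_idx (X5 c)) = kk g (v - 1)"
          using X4[OF c(1)] w(1) c(2) by (simp add: set_aux_def kk_def)
        moreover have "ckey (X5 c) = kk g v" using kk[OF gv] w(1) by (simp add: ckey_def set_aux_def c_def)
        ultimately show ?thesis using False gv c X4[OF c(1)] w(1)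
          by (simp add: lead_def Ld_def) (simp add: set_aux_def c_def)
      qed
      then have "X6 c = Cell (if v \<in> Ld g then yy c else Num 0) (pil h\<^sub>1 g) (pil h\<^sub>2 g) (Num g)
        (Num (if v \<in> Ld g then 1 else 0))"
        using X4[OF c(1)] w(1) c(2) by (simp add: X6_def \<phi>6_def set_aux_def)
      then show ?thesis by (simp add: c_def)
    qed
    have X6': "X6 c = Cell (if c mod b ^ E \<in> Ld (c div b ^ E) then yy c else Num 0) (pil h\<^sub>1 (c div b ^ E))
        (pil h\<^sub>2 (c div b ^ E)) (Num (c div b ^ E)) (Num (if c mod b ^ E \<in> Ld (c div b ^ E) then 1 else 0))"
      if "c < b ^ t" for c
      using X6[OF g_lt[OF that], of "c mod b ^ E"] unfolding div_mult_mod_eq by simp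
    have mono: "kk g u \<le> kk g v" if "g < b ^ (t - E)" "u \<le> v" "v < b ^ E" for g u v
    proof -
      have "(g * b ^ E + u) div b ^ E = (g * b ^ E + v) div b ^ E" using that by simp
      then have "ckey (X4 (g * b ^ E + u)) \<le> ckey (X4 (g * b ^ E + v))"
        using G4(2) that(2) unfolding sorts_segments_def X4_def by simp
      then show ?thesis using kk that by simp
    qed
    have ptk: "is_pt (yy (g * b ^ E + u)) \<longleftrightarrow> is_pt (yy (g * b ^ E + v))" if "kk g u = kk g v" for g u v
      using that key unfolding kk_def by (metis is_pt_simps word.exhaust)
    have yimg: "yy ` (\<lambda>v. g * b ^ E + v) ` {v. v < b ^ E \<and> is_pt (yy (g * b ^ E + v))} = Pt ` P"
      if g: "g < b ^ (t - E)" for g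
    proof (intro set_eqI iffI)
      fix w assume "w \<in> yy ` (\<lambda>v. g * b ^ E + v) ` {v. v < b ^ E \<and> is_pt (yy (g * b ^ E + v))}"
      then obtain v where v: "v < b ^ E" "is_pt (yy (g * b ^ E + v))" "w = yy (g * b ^ E + v)" by blast
      define u where "u = \<sigma> (g * b ^ E + v) mod b ^ E"
      have "u < b ^ E" using bt by (simp add: u_def)
      then have "u < 5 * b ^ t" using bt(2) by linarith
      then have "u < card P" using pts(3)[of u] v(2) unfolding yy_def u_def[symmetric] by (meson not_le)
      then show "w \<in> Pt ` P" using pts(1,2) v(3) by (auto simp: yy_def u_def[symmetric])
    next
      fix w assume "w \<in> Pt ` P"
      then obtain u where u: "u < card P" "w = Pt (pts u)" using pts(1) by auto
      have ub: "u < b ^ E" using u cardP by simp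
      obtain c where c: "\<sigma> c = g * b ^ E + u" using \<sigma>(1) by (metis segment_perm_def bij_pointE)
      then have cg: "c div b ^ E = g" using \<sigma>d[of c] ub by simp
      define v where "v = c mod b ^ E"
      have v: "v < b ^ E" "c = g * b ^ E + v"
        unfolding v_def cg[symmetric] by (simp, simp only: div_mult_mod_eq)
      have "yy c = w" using c ub u pts(2) by (simp add: yy_def)
      then show "w \<in> yy ` (\<lambda>v. g * b ^ E + v) ` {v. v < b ^ E \<and> is_pt (yy (g * b ^ E + v))}"
        using v u(2) by (intro image_eqI[of _ yy c] image_eqI[of _ _ v]) auto
    qed
    have Ld: "inj_on (kk g) (Ld g)" "kk g ` Ld g = K g ` P" if g: "g < b ^ (t - E)" for g
    proof -
      note sl = sorted_leaders[where kk = "kk g" and L = "b ^ E" and pt = "\<lambda>v. is_pt (yy (g * b ^ E + v))",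
          OF mono[OF g] ptk]
      show "inj_on (kk g) (Ld g)" unfolding Ld_def by (rule sl(1)) auto
      have "kk g ` Ld g = kk g ` {v. v < b ^ E \<and> is_pt (yy (g * b ^ E + v))}"
        unfolding Ld_def by (rule sl(2)) auto
      also have "\<dots> = (\<lambda>w. key w (pil h\<^sub>1 g) (pil h\<^sub>2 g) (Num g)) ` yy ` (\<lambda>v. g * b ^ E + v) ` {v. v < b ^ E \<and> is_pt (yy (g * b ^ E + v))}"
        by (simp add: image_image kk_def)
      also have "\<dots> = K g ` P" unfolding yimg[OF g] by (simp add: image_image K_def)
      finally show "kk g ` Ld g = K g ` P" .
    qed
    have cardLd: "card (Ld g) = card (K g ` P)" if "g < b ^ (t - E)" for g
      using card_image[OF Ld(1)[OF that]] Ld(2)[OF that] by simp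
    have X7: "X7 c = set_aux (X6 c) (Num (card (K (c div b ^ E) ` P)))" if c: "c < b ^ t" for c
    proof -
      define val :: "nat \<Rightarrow> nat" where "val c = (if c mod b ^ E \<in> Ld (c div b ^ E) then 1 else 0)" for c
      have "c_aux (X6 c) = Num (val c)" if "c < b ^ t" for c
        using X6'[OF that] by (simp add: val_def)
      then have "X7 c = set_aux (X6 c) (Num (\<Sum>l<b ^ E. val (c div b ^ E * b ^ E + l)))"
        unfolding X7_def by (intro G7'[rule_format, OF _ _ c]) (auto simp: val_def)
      also have "(\<Sum>l<b ^ E. val (c div b ^ E * b ^ E + l)) = (\<Sum>l<b ^ E. if l \<in> Ld (c div b ^ E) then 1 else 0)"
        by (intro sum.cong refl) (simp add: val_def)
      also have "\<dots> = card ({..<b ^ E} \<inter> Ld (c div b ^ E))" by (simp add: sum.If_cases)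
      also have "{..<b ^ E} \<inter> Ld (c div b ^ E) = Ld (c div b ^ E)" by (auto simp: Ld_def)
      finally show ?thesis using cardLd[OF g_lt[OF c]] by simp
    qed
    define T where "T g = (pil h\<^sub>1 g, pil h\<^sub>2 g, Num (2 * g + (if ok g then 0 else 1)) :: 'p word)" for g
    have X8: "c_pt (X8 c) = c_pt (X6 c)" "triple (X8 c) = T (c div b ^ E)" if c: "c < b ^ t" for c
    proof -
      define g where "g = c div b ^ E"
      have g: "g < b ^ (t - E)" using g_lt[OF c] by (simp add: g_def)
      have x6: "c_a (X6 c) = pil h\<^sub>1 g" "c_b (X6 c) = pil h\<^sub>2 g"
        using X6'[OF c] by (simp_all add: g_def)
      have "c_aux (X8 c) = Num (min Bd (2 * g + (if ok g then 0 else 1)))"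
        using X7[OF c] x6 g by (auto simp: X8_def \<phi>8_def set_aux_def g_def[symmetric] ok_def r_def)
      moreover have "min Bd (2 * g + (if ok g then 0 else 1)) = 2 * g + (if ok g then 0 else 1)"
        using g_Bd[OF g] by auto
      ultimately show "triple (X8 c) = T (c div b ^ E)"
        using X7[OF c] x6 by (simp add: triple_def T_def g_def[symmetric]) (simp add: X8_def \<phi>8_def set_aux_def)
      show "c_pt (X8 c) = c_pt (X6 c)" using X7[OF c] by (simp add: X8_def \<phi>8_def set_aux_def)
    qed
    obtain g where g: "g < b ^ (t - E)" "\<And>g'. g' < b ^ (t - E) \<Longrightarrow> rk (T g) \<le> rk (T g')"
      "\<And>c. c < b ^ t \<Longrightarrow> X9 c = with_triple (X8 c) (T g)"
      using G9'[rule_format, of X8 T] X8(2) unfolding X9_def by blast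
    have rkT: "rk (T g') = (if ok g' then ereal (r g') else \<infinity>)" for g'
      by (simp add: rk_def T_def r_def)
    have main: "ok g \<and> (\<forall>g'. ok g' \<longrightarrow> r g \<le> r g') \<and> C \<subseteq> P \<and> K g ` C = K g ` P \<and> card C = card (K g ` P)"
      if ex: "\<exists>g. ok g"
    proof -
      obtain g0 where g0: "ok g0" using ex by blast
      then have "rk (T g) \<le> ereal (r g0)" using g(2)[of g0] by (simp add: rkT ok_def)
      then have okg: "ok g" by (auto simp: rkT split: if_splits)
      have min: "r g \<le> r g'" if "ok g'" for g'
        using g(2)[of g'] that okg by (simp add: rkT) (simp add: ok_def)
      have X10: "X10 c = Cell (if c div b ^ E = g then c_pt (X6 c) else Num 0) (Num 0) (Num 0) (Num 0) (Num 0)"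
        if c: "c < b ^ t" for c
        using g(3)[OF c] X8(1)[OF c] okg by (auto simp: X10_def \<phi>10_def with_triple_def T_def)
      define q where "q v = (THE p. yy (g * b ^ E + v) = Pt p)" for v
      have q: "yy (g * b ^ E + v) = Pt (q v)" if "v \<in> Ld g" for v
        using that by (auto simp: Ld_def q_def elim!: is_ptE)
      have C: "C = q ` Ld g"
      proof (intro set_eqI iffI)
        fix p assume "p \<in> C"
        then obtain w where w: "w < 5 * b ^ t" "words_of X10 w = Pt p" by (auto simp: C_def Gx)
        define c where "c = w div 5"
        have c: "c < b ^ t" using w(1) by (simp add: c_def div_less_iff_less_mult mult.commute)
        have "c div b ^ E = g" "c_pt (X6 c) = Pt p"
          using w(2) X10[OF c] by (auto simp: words_of_def c_def[symmetric] slot_def split: if_splits)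
        moreover then have "c_pt (X6 c) = (if c mod b ^ E \<in> Ld g then yy c else Num 0)"
          using X6'[OF c] by simp
        moreover have "c = c div b ^ E * b ^ E + c mod b ^ E" by (simp only: div_mult_mod_eq)
        ultimately have "c mod b ^ E \<in> Ld g" "yy (g * b ^ E + c mod b ^ E) = Pt p" by (auto split: if_splits)
        then show "p \<in> q ` Ld g" using q by (intro image_eqI[of _ _ "c mod b ^ E"]) auto
      next
        fix p assume "p \<in> q ` Ld g"
        then obtain v where v: "v \<in> Ld g" "p = q v" by blast
        then have vE: "v < b ^ E" by (simp add: Ld_def)
        define c where "c = g * b ^ E + v"
        have c: "c < b ^ t" "c div b ^ E = g" using c_lt[OF g(1) vE] vE by (auto simp: c_def)
        have "words_of X10 (5 * c) = Pt p"
          using X10[OF c(1)] c(2) X6[OF g(1) vE, folded c_def] v q[OF v(1), folded c_def]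
          by (simp add: words_of_def slot_def)
        then show "p \<in> C" using c(1) unfolding C_def Gx by (intro CollectI exI[of _ "5 * c"]) auto
      qed
      have Kq: "K g (q v) = kk g v" if "v \<in> Ld g" for v using q[OF that] by (simp add: K_def kk_def)
      have "inj_on q (Ld g)" by (rule inj_onI) (metis Kq Ld(1)[OF g(1)] inj_onD)
      then have "card C = card (K g ` P)" unfolding C using cardLd[OF g(1)] by (simp add: card_image)
      moreover have "K g ` C = K g ` P" unfolding C Ld(2)[OF g(1), symmetric] image_image using Kq by simp
      moreover have "C \<subseteq> P"
      proof
        fix p assume "p \<in> C"
        then obtain v where v: "v \<in> Ld g" "p = q v" unfolding C by blast
        then have "Pt p \<in> Pt ` P" unfolding yimg[OF g(1), symmetric] using q[OF v(1)]
          by (intro image_eqI[of _ yy "g * b ^ E + v"] image_eqI[of _ _ v]) (auto simp: Ld_def)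
        then show "p \<in> P" by auto
      qed
      ultimately show ?thesis using okg min by blast
    qed
    have "selects_best_copy (b ^ (t - E)) m K r P C"
      unfolding selects_best_copy_def Let_def ok_def[symmetric] using main by blast
    then show "\<exists>y pts. pts ` {..<card P} = P \<and> (\<forall>v<card P. y v = Pt (pts v)) \<and>
          selects_best_copy (b ^ (t - E)) m
            (\<lambda>g p. key (Pt p) (pilot useP b E y h\<^sub>1 g) (pilot useP b E y h\<^sub>2 g) (Num g))
            (\<lambda>g. rad g (pilot useP b E y h\<^sub>1 g) (pilot useP b E y h\<^sub>2 g)) P {p. \<exists>w<5 * b ^ t. G x w = Pt p}"
      using pts(1,2) unfolding K_def r_def C_def pil_def by blast
  qed
qed

subsection \<open>The k-center program\<close>

lemma space_eq_of_points: "set ws \<subseteq> range Pt \<Longrightarrow> space s ws = s * length ws"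
  by (induction ws) (auto simp: space_def)

text \<open>A point is charged \<open>s\<close> words, so at most \<open>\<beta>\<close> points lie
  on a machine and \<open>initial_array\<close> cuts none off. Injectivity is a count: at most
  \<open>card P\<close> wires carry points, and they show \<open>card P\<close> values.\<close>

lemma input_config_array:
  fixes P :: "'p set"
  assumes inp: "input_config P s m (s * \<beta>) c\<^sub>0" and s: "0 < s" and \<beta>: "0 < \<beta>" and P: "finite P"
  shows "initial_array \<beta> c\<^sub>0 ` {..<m * \<beta>} \<inter> range Pt = Pt ` P"
    and "inj_on (initial_array \<beta> c\<^sub>0) {w. w < m * \<beta> \<and> is_pt (initial_array \<beta> c\<^sub>0 w)}"
proof -
  define x where "x = initial_array \<beta> c\<^sub>0"
  define mem where "mem = (\<lambda>i. fst (c\<^sub>0 i))"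
  define L where "L = concat (map mem [0..<m])"
  have L: "mset L = image_mset Pt (mset_set P)" using inp by (simp add: input_config_def L_def mem_def)
  have setL: "set L = Pt ` P" using arg_cong[OF L, of set_mset] P by simp
  have lenL: "length L = card P" using arg_cong[OF L, of size] by simp
  have sumL: "(\<Sum>i<m. length (mem i)) = card P"
    unfolding lenL[symmetric] L_def by (simp add: length_concat comp_def interv_sum_list_conv_sum_set_nat lessThan_atLeast0)
  have memP: "set (mem i) \<subseteq> Pt ` P" if "i < m" for i using that setL by (auto simp: L_def)
  have len: "length (mem i) \<le> \<beta>" if "i < m" for i
  proof -
    have "space s (mem i) \<le> s * \<beta>" using inp that by (simp add: input_config_def mem_def)
    moreover have "space s (mem i) = s * length (mem i)" using memP[OF that] by (intro space_eq_of_points) auto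
    ultimately show ?thesis using s by simp
  qed
  have x: "x (i * \<beta> + j) = (if j < length (mem i) then mem i ! j else Num 0)" if "j < \<beta>" for i j
    using that by (simp add: x_def initial_array_def mem_def)
  show img: "initial_array \<beta> c\<^sub>0 ` {..<m * \<beta>} \<inter> range Pt = Pt ` P"
    unfolding x_def[symmetric]
  proof (intro set_eqI iffI)
    fix w assume "w \<in> x ` {..<m * \<beta>} \<inter> range Pt"
    then obtain u p where u: "u < m * \<beta>" "w = x u" "w = Pt p" by auto
    define i j where "i = u div \<beta>" and "j = u mod \<beta>"
    have ij: "i < m" "j < \<beta>" "u = i * \<beta> + j" using u(1) \<beta> by (auto simp: i_def j_def div_less_iff_less_mult)
    then have "w \<in> set (mem i)" using x[OF ij(2), of i] u by (auto split: if_splits)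
    then show "w \<in> Pt ` P" using memP[OF ij(1)] by blast
  next
    fix w assume w: "w \<in> Pt ` P"
    then have "w \<in> set L" using setL by simp
    then obtain i where i: "i < m" "w \<in> set (mem i)" by (auto simp: L_def)
    then obtain j where j: "j < length (mem i)" "w = mem i ! j" by (metis in_set_conv_nth)
    have "j < \<beta>" using j len[OF i(1)] by simp
    have "i * \<beta> + j < Suc i * \<beta>" using \<open>j < \<beta>\<close> by simp
    also have "\<dots> \<le> m * \<beta>" using i by (intro mult_le_mono1) simp
    finally show "w \<in> x ` {..<m * \<beta>} \<inter> range Pt"
      using x[OF \<open>j < \<beta>\<close>, of i] j w by (auto intro!: image_eqI[of _ x "i * \<beta> + j"])
  qed
  define W where "W = {w. w < m * \<beta> \<and> is_pt (x w)}"
  have fW: "finite W" by (simp add: W_def)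
  have "x ` W = x ` {..<m * \<beta>} \<inter> range Pt" by (auto simp: W_def image_iff elim!: is_ptE)
  then have "card (x ` W) = card (Pt ` P)" using img by (simp add: x_def)
  also have "\<dots> = card P" by (intro card_image) (simp add: inj_on_def)
  finally have 1: "card (x ` W) = card P" .
  have "card W = (\<Sum>i<m. card {j. j < \<beta> \<and> is_pt (x (i * \<beta> + j))})" unfolding W_def by (rule card_blocks)
  also have "\<dots> \<le> (\<Sum>i<m. length (mem i))"
  proof (intro sum_mono)
    fix i
    have "{j. j < \<beta> \<and> is_pt (x (i * \<beta> + j))} \<subseteq> {..<length (mem i)}" using x by (auto split: if_splits)
    then show "card {j. j < \<beta> \<and> is_pt (x (i * \<beta> + j))} \<le> length (mem i)"
      using card_mono[of "{..<length (mem i)}"] by fastforce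
  qed
  finally have "card W \<le> card P" using sumL by simp
  then have "card (x ` W) = card W" using 1 card_image_le[OF fW, of x] by simp
  then show "inj_on (initial_array \<beta> c\<^sub>0) {w. w < m * \<beta> \<and> is_pt (initial_array \<beta> c\<^sub>0 w)}"
    using eq_card_imp_inj_on[OF fW] by (simp add: W_def x_def)
qed

text \<open>With at least as many machines as points, each machine receives at most one.\<close>

lemma input_config_exists:
  assumes "finite P" "card P \<le> m" "0 < \<beta>"
  shows "\<exists>c\<^sub>0. input_config P s m (s * \<beta>) c\<^sub>0"
proof -
  obtain ps where ps: "set ps = P" "distinct ps" using finite_distinct_list[OF assms(1)] by blast
  have len: "length ps = card P" using ps distinct_card by fastforce
  define c where "c i = (if i < card P then [Pt (ps ! i)] else [], [] :: (nat \<times> 'a word) list)" for i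
  have "[0..<m] = [0..<card P] @ [card P..<m]"
    using upt_add_eq_append[of 0 "card P" "m - card P"] assms(2) by simp
  then have "concat (map (\<lambda>i. fst (c i)) [0..<m]) = concat (map (\<lambda>i. fst (c i)) [0..<card P]) @ concat (map (\<lambda>i. fst (c i)) [card P..<m])"
    by (simp only: map_append concat_append)
  also have "concat (map (\<lambda>i. fst (c i)) [card P..<m]) = []" by (simp add: c_def)
  also have "map (\<lambda>i. fst (c i)) [0..<card P] = map (\<lambda>i. [Pt (ps ! i)]) [0..<card P]" by (simp add: c_def)
  also have "concat (map (\<lambda>i. [Pt (ps ! i)]) [0..<card P]) = map Pt ps"
    unfolding len[symmetric] concat_map_singleton by (rule nth_equalityI) simp_all
  finally have "mset (concat (map (\<lambda>i. fst (c i)) [0..<m])) = image_mset Pt (mset_set P)"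
    using ps by (simp add: mset_set_set[symmetric])
  moreover have "c i = ([], [])" if "m \<le> i" for i using that assms(2) by (simp add: c_def)
  moreover have "space s (fst (c i)) \<le> s * \<beta>" for i using assms(3) by (simp add: c_def space_def)
  ultimately show ?thesis unfolding input_config_def by (intro exI[of _ c]) (simp add: c_def)
qed

text \<open>Copy \<open>g\<close> uses the shift \<open>g mod b\<close> and the guess \<open>g div b\<close>. The dyadic guesses need about
  \<open>log \<Delta>\<close> copies. If this exceeds \<open>n\<close>, then the global space allows \<open>n\<^sup>2\<close> copies, and the guesses are the
  distances of pairs of input points, one of which is the optimum itself.\<close>

definition guess_radius :: "bool \<Rightarrow> nat \<Rightarrow> nat \<Rightarrow> 'p::metric_space word \<Rightarrow> 'p word \<Rightarrow> real" where
  "guess_radius dyadic b g w w' =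
     (if dyadic then 2 ^ (g div b)
      else case w of Num _ \<Rightarrow> 0 | Pt p \<Rightarrow> (case w' of Num _ \<Rightarrow> 0 | Pt p' \<Rightarrow> dist p p'))"

text \<open>Only equality of keys matters, so any injection into the naturals may define their
  order; \<open>to_nat\<close> exists because cells are functions from a finite type to the
  integers. \<open>None\<close> separates the fillers from the points.\<close>

definition grid_key ::
  "bool \<Rightarrow> nat \<Rightarrow> nat \<Rightarrow> (real ^ 'd) word \<Rightarrow> (real ^ 'd) word \<Rightarrow> (real ^ 'd) word \<Rightarrow> (real ^ 'd) word \<Rightarrow> nat" where
  "grid_key dyadic b X w a a' i = to_nat (case w of Num _ \<Rightarrow> None
     | Pt p \<Rightarrow> Some (grid_cell (guess_radius dyadic b (num i) a a') X (num i mod b) p))"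

text \<open>A common bound for all \<open>t\<close> up to \<open>3 * E + 1\<close>, as the number
  \<open>t = E + 1 + q\<close> of address digits varies with the diameter.\<close>

definition kcenter_rounds :: "nat \<Rightarrow> nat" where
  "kcenter_rounds E = (\<Sum>t\<le>3 * E + 1. cluster_rounds E t)"

text \<open>Digits of a cell address, from the lowest: \<open>E\<close> for the position in the
  copy, one for the shift, \<open>q\<close> for the guess. If \<open>q = 2 * E\<close>, a guess is a
  pair of positions in the compacted input, read through the windows at
  \<open>h\<^sub>2 = E + 1\<close> and \<open>h\<^sub>1 = 2 * E + 1\<close>. With
  \<open>b ^ 3\<close> cells each, the \<open>b ^ (E + q - 2)\<close> machines hold exactly the
  \<open>b ^ (E + 1 + q)\<close> cells.\<close>

lemma kcenter_program:
  fixes b E q X k mm :: nat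
  assumes b: "2 \<le> b" and E: "3 \<le> E" and q: "q \<le> E \<or> q = 2 * E" "2 \<le> q" and X: "2 \<le> X" "X \<le> b"
    and mm: "real k + real k * (real CARD('d) * 2 ^ Suc CARD('d)) / real X < real mm + 1"
  shows "\<exists>A :: (real ^ 'd) program. \<forall>P c\<^sub>0 Bd.
     finite P \<longrightarrow> 0 < k \<longrightarrow> k < card P \<longrightarrow> card P \<le> b ^ E \<longrightarrow> min_separation P = 1 \<longrightarrow>
     (q \<le> E \<longrightarrow> log 2 (diameter P) \<le> real (b ^ q - 1)) \<longrightarrow> 2 * b ^ (E + 1 + q) \<le> Bd \<longrightarrow>
     input_config P CARD('d) (b ^ (E + q - 2)) (CARD('d) * (5 * b ^ 3)) c\<^sub>0 \<longrightarrow>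
     mpc_respects A P CARD('d) Bd (b ^ (E + q - 2)) (CARD('d) * (5 * b ^ 3)) (Suc (kcenter_rounds E)) c\<^sub>0 \<and>
     (\<exists>c. mpc_run A (b ^ (E + q - 2)) (Suc (kcenter_rounds E)) c\<^sub>0 = return_pmf c \<and>
        (let C = mpc_output (b ^ (E + q - 2)) c in C \<noteq> {} \<and> C \<subseteq> P \<and> card C \<le> mm \<and>
          kcenter_cost P C \<le> 2 * real CARD('d) * real X * kcenter_opt P k))"
proof -
  define t where "t = E + 1 + q"
  define dyadic where "dyadic = (q \<le> E)"
  define h\<^sub>1 h\<^sub>2 where "h\<^sub>1 = (if dyadic then 0 else 2 * E + 1)" and "h\<^sub>2 = (if dyadic then 0 else E + 1)"
  define m where "m = b ^ (E + q - 2)"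
  have t: "E \<le> t" "h\<^sub>1 + E \<le> t" "h\<^sub>2 + E \<le> t" "t \<le> 3 * E + 1"
    using q by (auto simp: t_def h\<^sub>1_def h\<^sub>2_def dyadic_def)
  have "E + q - 2 + 3 = t" using q E by (simp add: t_def)
  then have mt: "m * (5 * b ^ 3) = 5 * b ^ t" unfolding m_def by (metis mult.left_commute power_add)
  have hE: "\<not> dyadic \<longrightarrow> E \<le> h\<^sub>1 \<and> E \<le> h\<^sub>2" by (simp add: h\<^sub>1_def h\<^sub>2_def)
  have key: "grid_key dyadic b X (Pt p) a a' i \<noteq> grid_key dyadic b X (Num z) a a' i" for p z a a' and i :: "(real ^ 'd) word"
    by (simp add: grid_key_def)
  obtain G where G: "realizable (\<lambda>w. {w}) (Num ` {..2 * b ^ t}) (5 * b ^ 3) (5 * b ^ t) (cluster_rounds E t) G"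
    and G': "\<forall>(x :: nat \<Rightarrow> (real ^ 'd) word) P. x ` {..<5 * b ^ t} \<inter> range Pt = Pt ` P \<longrightarrow>
       inj_on x {w. w < 5 * b ^ t \<and> is_pt (x w)} \<longrightarrow> finite P \<longrightarrow> card P \<le> b ^ E \<longrightarrow>
       (\<exists>y pts. pts ` {..<card P} = P \<and> (\<forall>v<card P. y v = Pt (pts v)) \<and>
          selects_best_copy (b ^ (t - E)) mm
            (\<lambda>g p. grid_key dyadic b X (Pt p) (pilot (\<not> dyadic) b E y h\<^sub>1 g) (pilot (\<not> dyadic) b E y h\<^sub>2 g) (Num g))
            (\<lambda>g. guess_radius dyadic b g (pilot (\<not> dyadic) b E y h\<^sub>1 g) (pilot (\<not> dyadic) b E y h\<^sub>2 g))
            P {p. \<exists>w<5 * b ^ t. G x w = Pt p})"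
    using realizable_clustering[where key = "grid_key dyadic b X" and rad = "guess_radius dyadic b" and useP = "\<not> dyadic" and m = mm,
        OF b E t(1) order_refl t(2,3) hE key]
    by (elim exE conjE) (rule that)
  have "cluster_rounds E t \<le> kcenter_rounds E"
    unfolding kcenter_rounds_def using t(4) by (intro member_le_sum) auto
  note R = realizable_pad[OF G this, folded mt]
  have \<beta>: "0 < 5 * b ^ 3" using b by simp
  obtain A :: "(real ^ 'd) program" where A: "\<forall>P s Bd' c\<^sub>0. 1 \<le> s \<longrightarrow> 2 * b ^ t \<le> Bd' \<longrightarrow> finite P \<longrightarrow>
     input_config P s m (s * (5 * b ^ 3)) c\<^sub>0 \<longrightarrow>
     mpc_respects A P s Bd' m (s * (5 * b ^ 3)) (Suc (kcenter_rounds E)) c\<^sub>0 \<and>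
     (\<exists>c. mpc_run A m (Suc (kcenter_rounds E)) c\<^sub>0 = return_pmf c \<and>
        mpc_output m c = {p. \<exists>w<m * (5 * b ^ 3). G (initial_array (5 * b ^ 3) c\<^sub>0) w = Pt p})"
    using realizable_imp_program[OF R \<beta>] by (rule exE) (rule that)
  have "mpc_respects A P CARD('d) Bd m (CARD('d) * (5 * b ^ 3)) (Suc (kcenter_rounds E)) c\<^sub>0 \<and>
     (\<exists>c. mpc_run A m (Suc (kcenter_rounds E)) c\<^sub>0 = return_pmf c \<and>
        (let C = mpc_output m c in C \<noteq> {} \<and> C \<subseteq> P \<and> card C \<le> mm \<and>
          kcenter_cost P C \<le> 2 * real CARD('d) * real X * kcenter_opt P k))"
    if P: "finite P" and k: "0 < k" "k < card P" and n: "card P \<le> b ^ E" and sep: "min_separation P = 1"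
      and diam: "q \<le> E \<longrightarrow> log 2 (diameter P) \<le> real (b ^ q - 1)" and Bd: "2 * b ^ t \<le> Bd"
      and inp: "input_config P CARD('d) m (CARD('d) * (5 * b ^ 3)) c\<^sub>0" for P :: "(real ^ 'd) set" and c\<^sub>0 Bd
  proof -
    define x where "x = initial_array (5 * b ^ 3) c\<^sub>0"
    have run: "mpc_respects A P CARD('d) Bd m (CARD('d) * (5 * b ^ 3)) (Suc (kcenter_rounds E)) c\<^sub>0 \<and>
     (\<exists>c. mpc_run A m (Suc (kcenter_rounds E)) c\<^sub>0 = return_pmf c \<and>
        mpc_output m c = {p. \<exists>w<5 * b ^ t. G x w = Pt p})"
      using A[rule_format, OF _ Bd P inp] by (simp add: mt x_def Suc_le_eq)
    have d0: "0 < CARD('d)" by simp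
    note arr = input_config_array[OF inp d0 \<beta> P, unfolded mt, folded x_def]
    define C where "C = {p. \<exists>w<5 * b ^ t. G x w = Pt p}"
    obtain y pts where pts: "pts ` {..<card P} = P" "\<forall>v<card P. y v = Pt (pts v)"
      and main: "selects_best_copy (b ^ (t - E)) mm
            (\<lambda>g p. grid_key dyadic b X (Pt p) (pilot (\<not> dyadic) b E y h\<^sub>1 g) (pilot (\<not> dyadic) b E y h\<^sub>2 g) (Num g))
            (\<lambda>g. guess_radius dyadic b g (pilot (\<not> dyadic) b E y h\<^sub>1 g) (pilot (\<not> dyadic) b E y h\<^sub>2 g)) P C"
      using G'[rule_format, OF arr P n, folded C_def] by (elim exE conjE) (rule that)
    define pil where "pil = pilot (\<not> dyadic) b E y"
    define K where "K = (\<lambda>g p. grid_key dyadic b X (Pt p) (pil h\<^sub>1 g) (pil h\<^sub>2 g) (Num g))"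
    define r where "r = (\<lambda>g. guess_radius dyadic b g (pil h\<^sub>1 g) (pil h\<^sub>2 g))"
    define ok where "ok g \<longleftrightarrow> g < b ^ (t - E) \<and> card (K g ` P) \<le> mm \<and> 0 < r g" for g
    have "selects_best_copy (b ^ (t - E)) mm K r P C" using main by (simp only: K_def r_def pil_def)
    then have main': "(\<exists>g. ok g) \<longrightarrow> (\<exists>g. ok g \<and> (\<forall>g'. ok g' \<longrightarrow> r g \<le> r g') \<and>
        C \<subseteq> P \<and> K g ` C = K g ` P \<and> card C = card (K g ` P))"
      unfolding selects_best_copy_def Let_def ok_def[symmetric] .
    have K: "K g p = to_nat (Some (grid_cell (r g) X (g mod b) p))" for g p
      by (simp add: K_def grid_key_def r_def)
    have tE: "b ^ (t - E) = b ^ q * b" by (simp add: t_def)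
    obtain Z p\<^sub>1 p\<^sub>2 where Z: "Z \<subseteq> P" "card Z = k" "p\<^sub>1 \<in> P" "p\<^sub>2 \<in> P" "kcenter_opt P k = dist p\<^sub>1 p\<^sub>2"
      and cover: "\<And>p. p \<in> P \<Longrightarrow> \<exists>z\<in>Z. dist z p \<le> kcenter_opt P k" and opt1: "1 \<le> kcenter_opt P k"
      using kcenter_opt_witness[OF P k] sep by metis
    have fZ: "finite Z" using Z(1) P finite_subset by blast
    \<comment> \<open>A guess whose copies, one for each shift, all use the same radius between the
      optimum and its double.\<close>
    obtain \<gamma> where \<gamma>: "\<gamma> < b ^ q" and rad: "\<And>s. s < b \<Longrightarrow> r (\<gamma> * b + s) = r (\<gamma> * b)"
      "kcenter_opt P k \<le> r (\<gamma> * b)" "r (\<gamma> * b) \<le> 2 * kcenter_opt P k"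
    proof (cases dyadic)
      case True
      define \<gamma> where "\<gamma> = nat \<lceil>log 2 (kcenter_opt P k)\<rceil>"
      have "0 \<le> log 2 (kcenter_opt P k)" using opt1 by simp
      then have G1: "log 2 (kcenter_opt P k) \<le> real \<gamma>" "real \<gamma> \<le> log 2 (kcenter_opt P k) + 1"
        unfolding \<gamma>_def by linarith+
      have "kcenter_opt P k \<le> diameter P"
        unfolding Z(5) using diameter_bounded_bound[OF finite_imp_bounded[OF P] Z(3,4)] .
      then have "log 2 (kcenter_opt P k) \<le> log 2 (diameter P)" using opt1 by simp
      then have "log 2 (kcenter_opt P k) \<le> real (b ^ q - 1)" using diam True by (simp add: dyadic_def)
      then have "\<gamma> \<le> b ^ q - 1" unfolding \<gamma>_def by (simp add: ceiling_le_iff nat_le_iff)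
      then have Gq: "\<gamma> < b ^ q" using b by (metis Suc_pred' less_Suc_eq_le less_le_trans pos2 zero_less_power)
      have "kcenter_opt P k = 2 powr log 2 (kcenter_opt P k)" using opt1 by simp
      also have "\<dots> \<le> 2 powr real \<gamma>" using G1 by (intro powr_mono) auto
      finally have 1: "kcenter_opt P k \<le> 2 ^ \<gamma>" by (simp add: powr_realpow)
      have "2 ^ \<gamma> = 2 powr real \<gamma>" by (simp add: powr_realpow)
      also have "\<dots> \<le> 2 powr (log 2 (kcenter_opt P k) + 1)" using G1 by (intro powr_mono) auto
      also have "\<dots> = 2 * kcenter_opt P k" using opt1 by (simp add: powr_add)
      finally have 2: "2 ^ \<gamma> \<le> 2 * kcenter_opt P k" .
      have "r (\<gamma> * b + s') = 2 ^ \<gamma>" if "s' < b" for s' using that True by (simp add: r_def guess_radius_def)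
      from this this[of 0] show thesis using 1 2 Gq b by (intro that[of \<gamma>]) auto
    next
      case False
      then have q2: "q = 2 * E" using q by (simp add: dyadic_def)
      obtain a a' where a: "a < card P" "p\<^sub>1 = pts a" and a': "a' < card P" "p\<^sub>2 = pts a'"
        using Z(3,4) pts(1) by (metis imageE lessThan_iff)
      \<comment> \<open>The positions of two points whose distance is the optimum, written as one
        number of \<open>2 * E\<close> digits.\<close>
      define \<gamma> where "\<gamma> = a * b ^ E + a'"
      have aE: "a < b ^ E" "a' < b ^ E" using a(1) a'(1) n by auto
      have "\<gamma> < Suc a * b ^ E" using aE by (simp add: \<gamma>_def)
      also have "\<dots> \<le> b ^ E * b ^ E" using aE by (intro mult_le_mono1) simp
      finally have Gq: "\<gamma> < b ^ q" by (simp add: q2 power_add[symmetric] mult_2)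
      have "r (\<gamma> * b + s') = kcenter_opt P k" if "s' < b" for s'
      proof -
        have "(\<gamma> * b + s') div b = \<gamma>" using that by simp
        moreover have "2 * E + 1 - E = 1 + E" "E + 1 - E = 1" by simp_all
        moreover have "(\<gamma> * b + s') div b ^ (1 + E) = \<gamma> div b ^ E"
          using \<open>(\<gamma> * b + s') div b = \<gamma>\<close> by (simp add: div_mult2_eq)
        moreover have "\<gamma> div b ^ E = a" "\<gamma> mod b ^ E = a'" using aE b by (simp_all add: \<gamma>_def)
        ultimately have "pil h\<^sub>1 (\<gamma> * b + s') = Pt p\<^sub>1" "pil h\<^sub>2 (\<gamma> * b + s') = Pt p\<^sub>2"
          using False aE a a' pts(2) by (simp_all add: pil_def pilot_def h\<^sub>1_def h\<^sub>2_def)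
        then show ?thesis using False by (simp add: r_def guess_radius_def Z(5))
      qed
      from this this[of 0] show thesis using Gq b opt1 by (intro that[of \<gamma>]) auto
    qed
    have "\<exists>g. ok g \<and> r g \<le> 2 * kcenter_opt P k"
    proof -
      have rG0: "0 < r (\<gamma> * b)" using opt1 rad(2) by simp
      obtain s where s: "s < X" "real (card (grid_cell (r (\<gamma> * b)) X s ` P))
           \<le> real (card Z) + real (card Z) * (real CARD('d) * 2 ^ Suc CARD('d)) / real X"
        using exists_good_shift[OF rG0 X(1) fZ] cover rad(2) by (meson order_trans)
      have sb: "s < b" using s X by simp
      have "card (K (\<gamma> * b + s) ` P) = card (grid_cell (r (\<gamma> * b)) X s ` P)"
      proof -
        have "K (\<gamma> * b + s) ` P = (\<lambda>f. to_nat (Some f)) ` grid_cell (r (\<gamma> * b)) X s ` P"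
          using sb by (simp add: K image_image rad(1)[OF sb])
        then show ?thesis by (simp add: card_image inj_on_def)
      qed
      then have "real (card (K (\<gamma> * b + s) ` P)) < real mm + 1"
        using le_less_trans[OF s(2)[unfolded Z(2)] mm] by simp
      then have "card (K (\<gamma> * b + s) ` P) \<le> mm" by linarith
      moreover have "\<gamma> * b + s < b ^ (t - E)"
      proof -
        have "\<gamma> * b + s < Suc \<gamma> * b" using sb by simp
        also have "\<dots> \<le> b ^ q * b" using \<gamma> by (intro mult_le_mono1) simp
        finally show ?thesis by (simp add: tE)
      qed
      ultimately have "ok (\<gamma> * b + s)" using rad(1)[OF sb] rG0 by (simp add: ok_def)
      then show ?thesis using rad(1)[OF sb] rad(3) by auto
    qed
    \<comment> \<open>By minimality, the radius of the winner is at most that of the passing copy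
      just found.\<close>
    then obtain g where g: "ok g" "r g \<le> 2 * kcenter_opt P k" "C \<subseteq> P" "K g ` C = K g ` P" "card C = card (K g ` P)"
      using main' by (meson order_trans)
    have rg: "0 < r g" using g(1) by (simp add: ok_def)
    have "P \<noteq> {}" using k by auto
    then have "C \<noteq> {}" using g(4) by auto
    moreover have "kcenter_cost P C \<le> 2 * real CARD('d) * real X * kcenter_opt P k"
    proof (rule kcenter_cost_le[OF P \<open>P \<noteq> {}\<close>])
      show "finite C" using g(3) P finite_subset by blast
      fix p assume "p \<in> P"
      then obtain p' where p': "p' \<in> C" "K g p = K g p'" using g(4) by (metis imageE imageI)
      then have "grid_cell (r g) X (g mod b) p = grid_cell (r g) X (g mod b) p'" by (simp add: K)
      then have "dist p p' \<le> real CARD('d) * (real X * r g)" using rg X by (intro grid_cell_eq_imp_dist_le) auto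
      also have "\<dots> \<le> real CARD('d) * (real X * (2 * kcenter_opt P k))" using g(2) by (intro mult_left_mono) auto
      finally show "\<exists>q\<in>C. dist p q \<le> 2 * real CARD('d) * real X * kcenter_opt P k"
        using p' by (intro bexI[of _ p']) (simp_all add: mult_ac)
    qed
    ultimately have "C \<noteq> {} \<and> C \<subseteq> P \<and> card C \<le> mm \<and>
          kcenter_cost P C \<le> 2 * real CARD('d) * real X * kcenter_opt P k"
      using g(1,3,5) by (simp add: ok_def)
    moreover obtain c where "mpc_run A m (Suc (kcenter_rounds E)) c\<^sub>0 = return_pmf c" "mpc_output m c = C"
      using run unfolding C_def by blast
    ultimately show ?thesis using run unfolding Let_def by blast
  qed
  then show ?thesis unfolding m_def t_def by blast
qed

subsection \<open>Parameters\<close>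

text \<open>One logarithm takes \<open>2 ^ (j + 1)\<close> to \<open>j + 1 \<le> 2 ^ j\<close>. This
  crude descent shows that the least number in \<open>log_star\<close> exists and is at most about
  \<open>log 2 n\<close>.\<close>

lemma iterated_log_le_one:
  "x < 2 ^ j \<Longrightarrow> \<exists>i\<le>j. (log 2 ^^ i) x \<le> 1" for x :: real
proof (induction j arbitrary: x)
  case (Suc j)
  show ?case
  proof (cases "x \<le> 1")
    case False
    have "log 2 x < log 2 (2 ^ Suc j)" using False Suc.prems by (intro log_less) auto
    also have "\<dots> = real (Suc j)" by (subst log_nat_power) auto
    also have "\<dots> \<le> real (2 ^ j)" using Suc_leI[OF less_exp[of j]] by (rule of_nat_mono)
    finally have "log 2 x < 2 ^ j" by simp
    then obtain i where "i \<le> j" "(log 2 ^^ i) (log 2 x) \<le> 1" using Suc.IH by blast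
    then show ?thesis by (intro exI[of _ "Suc i"]) (simp add: funpow_swap1)
  qed (auto intro!: exI[of _ 0])
qed (auto intro!: exI[of _ 0])

lemma iterated_log_log_star: "(log 2 ^^ log_star n) (real n) \<le> 1"
proof -
  have "real n < 2 ^ n" using less_exp[of n] by (metis of_nat_less_iff of_nat_numeral of_nat_power)
  then have "\<exists>i. (log 2 ^^ i) (real n) \<le> 1" using iterated_log_le_one by blast
  then show ?thesis unfolding log_star_def by (rule LeastI_ex)
qed

lemma log_star_le_log:
  assumes "1 \<le> n"
  shows "real (log_star n) \<le> log 2 (real n) + 1"
proof -
  define j where "j = Suc (nat \<lfloor>log 2 (real n)\<rfloor>)"
  have "0 \<le> log 2 (real n)" using assms by simp
  then have j: "log 2 (real n) < real j" "real j \<le> log 2 (real n) + 1" unfolding j_def by linarith+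
  have "real n = 2 powr log 2 (real n)" using assms by simp
  also have "\<dots> < 2 powr real j" using j(1) by simp
  finally have "real n < 2 ^ j" by (simp add: powr_realpow)
  then obtain i where i: "i \<le> j" "(log 2 ^^ i) (real n) \<le> 1" using iterated_log_le_one by blast
  then have "log_star n \<le> i" unfolding log_star_def by (intro Least_le)
  then show ?thesis using i(1) j(2) by linarith
qed

text \<open>Each fixed iterate of the logarithm tends to infinity, so for large \<open>n\<close>
  none of the first \<open>j\<close> iterates is at most 1.\<close>

lemma filterlim_log_star: "filterlim log_star at_top sequentially"
  unfolding filterlim_at_top
proof
  fix j
  have lim: "filterlim (\<lambda>n. (log 2 ^^ i) (real n)) at_top sequentially" for i
  proof (induction i)
    case 0
    then show ?case by (simp add: filterlim_real_sequentially)
  next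
    case (Suc i)
    have "filterlim (log 2) at_top at_top" by real_asymp
    from filterlim_compose[OF this Suc] show ?case by simp
  qed
  have "\<forall>\<^sub>F n in sequentially. \<forall>i\<in>{..j}. 1 < (log 2 ^^ i) (real n)"
    using lim unfolding filterlim_at_top_dense by (intro eventually_ball_finite) auto
  then show "\<forall>\<^sub>F n in sequentially. j \<le> log_star n"
  proof eventually_elim
    case (elim n)
    then show ?case using iterated_log_log_star[of n] by (metis atMost_iff linorder_not_le nle_le)
  qed
qed

text \<open>The infimum of \<open>X\<close> over all \<open>n \<ge> k\<close>. The excess over
  \<open>k\<close> is governed by \<open>X n\<close> but must be a function of \<open>k\<close>
  alone; since \<open>k < n\<close>, this infimum can replace \<open>X n\<close>, and it still tends
  to infinity.\<close>

definition tail_min :: "(nat \<Rightarrow> nat) \<Rightarrow> nat \<Rightarrow> nat" where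
  "tail_min X k = (LEAST v. \<exists>n\<ge>k. X n = v)"

lemma tail_min_le: "k \<le> n \<Longrightarrow> tail_min X k \<le> X n"
  unfolding tail_min_def by (rule Least_le) auto

lemma le_tail_min:
  assumes "\<And>n. k \<le> n \<Longrightarrow> j \<le> X n"
  shows "j \<le> tail_min X k"
proof -
  have "\<exists>n\<ge>k. X n = tail_min X k" unfolding tail_min_def by (rule LeastI_ex) auto
  then show ?thesis using assms by metis
qed

lemma filterlim_tail_min:
  assumes "filterlim X at_top sequentially"
  shows "filterlim (tail_min X) at_top sequentially"
  unfolding filterlim_at_top
proof
  fix j
  have "\<forall>\<^sub>F n in sequentially. j \<le> X n" using assms by (simp add: filterlim_at_top)
  then obtain N where "\<And>n. N \<le> n \<Longrightarrow> j \<le> X n" unfolding eventually_sequentially by blast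
  then show "\<forall>\<^sub>F k in sequentially. j \<le> tail_min X k"
    unfolding eventually_sequentially by (meson le_tail_min order_trans)
qed

section \<open>The base, the number of digits and the global space\<close>

definition root_ceiling :: "nat \<Rightarrow> nat \<Rightarrow> nat" where
  "root_ceiling E n = nat \<lceil>real n powr (1 / real E)\<rceil>"

lemma root_ceiling_bounds:
  assumes n: "2 \<le> n" and E: "0 < E"
  shows "n \<le> root_ceiling E n ^ E" "2 \<le> root_ceiling E n"
    and "real (root_ceiling E n) \<le> 2 * real n powr (1 / real E)"
proof -
  define x where "x = real n powr (1 / real E)"
  have "1 powr (1 / real E) < x" unfolding x_def using n E by (intro powr_less_mono2) auto
  then have x: "1 < x" by simp
  have b: "x \<le> real (root_ceiling E n)" "real (root_ceiling E n) \<le> x + 1"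
    unfolding root_ceiling_def x_def[symmetric] using x by linarith+
  show "2 \<le> root_ceiling E n" using x b(1) by linarith
  show "real (root_ceiling E n) \<le> 2 * real n powr (1 / real E)"
    using x b(2) unfolding x_def[symmetric] by linarith
  have "x ^ E = real n" using n E by (simp add: x_def powr_power)
  moreover have "x ^ E \<le> real (root_ceiling E n) ^ E" using x b(1) by (intro power_mono) auto
  ultimately show "n \<le> root_ceiling E n ^ E" by (metis of_nat_le_iff of_nat_power)
qed

text \<open>The program learns \<open>q\<close> only through the number \<open>b ^ (E + q - 2)\<close> of machines; \<open>q = 2 E\<close> marks the regime
  where the guesses are pairs of points.\<close>

definition guess_digits :: "nat \<Rightarrow> nat \<Rightarrow> nat \<Rightarrow> nat \<Rightarrow> nat" where
  "guess_digits E b n L = (if Suc L \<le> n then LEAST q. 2 \<le> q \<and> L < b ^ q else 2 * E)"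

text \<open>\<open>2 \<le> q\<close> will give at least \<open>b ^ E \<ge> n\<close> machines. In
  the dyadic regime minimality yields \<open>b ^ (q - 1) \<le> L\<close> unless
  \<open>q = 2\<close>; the factor \<open>b ^ 2\<close> covers both cases.\<close>

lemma guess_digits_props:
  fixes L :: nat
  assumes b: "2 \<le> b" and E: "2 \<le> E" and n: "n \<le> b ^ E"
  defines "q \<equiv> guess_digits E b n L"
  shows "q \<le> E \<or> q = 2 * E" "2 \<le> q" "q \<le> E \<Longrightarrow> L < b ^ q"
    and "Suc L \<le> n \<Longrightarrow> b ^ q \<le> b ^ 2 * Suc L"
proof -
  have ex: "2 \<le> E \<and> L < b ^ E" if "Suc L \<le> n" using that n E by simp
  have q: "2 \<le> q \<and> L < b ^ q" "q \<le> E" if L: "Suc L \<le> n"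
  proof -
    have q': "q = (LEAST q. 2 \<le> q \<and> L < b ^ q)" using L by (simp add: q_def guess_digits_def)
    show "2 \<le> q \<and> L < b ^ q" unfolding q' by (rule LeastI[of _ E]) (rule ex[OF L])
    show "q \<le> E" unfolding q' by (rule Least_le) (rule ex[OF L])
  qed
  have q2: "q = 2 * E" if "\<not> Suc L \<le> n" using that by (simp add: q_def guess_digits_def)
  show "q \<le> E \<or> q = 2 * E" "2 \<le> q" "q \<le> E \<Longrightarrow> L < b ^ q"
    using q q2 E by (cases "Suc L \<le> n"; auto)+
  show "b ^ q \<le> b ^ 2 * Suc L" if L: "Suc L \<le> n"
  proof (cases "q = 2")
    case False
    then have q3: "2 \<le> q - 1" "q = Suc (q - 1)" using q(1)[OF L] by auto
    have "\<not> (2 \<le> q - 1 \<and> L < b ^ (q - 1))"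
      using not_less_Least[of "q - 1" "\<lambda>q. 2 \<le> q \<and> L < b ^ q"] L q3(2)
      by (simp add: q_def guess_digits_def)
    then have "b ^ (q - 1) \<le> L" using q3(1) by simp
    then have "b * b ^ (q - 1) \<le> b * Suc L" by (intro mult_le_mono2) simp
    also have "b * b ^ (q - 1) = b ^ q" by (metis power_Suc q3(2))
    also have "b * Suc L \<le> b ^ 2 * Suc L" using b by (intro mult_le_mono1) (simp add: power2_eq_square)
    finally show ?thesis .
  qed simp
qed

text \<open>Dyadic regime: \<open>b ^ 3 \<le> 8 * n powr \<rho>\<close> and
  \<open>L + 1 \<le> 3 * lg ^ 2\<close> give the factor 24, and five words per cell make it 120.
  Otherwise \<open>n \<le> L\<close>, hence \<open>n \<le> 2 * lg\<close>, and \<open>lg ^ 2\<close>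
  pays for two of the three factors \<open>n\<close> in \<open>b ^ (3 * E)\<close>; the
  \<open>8 ^ E\<close> is the cube of the \<open>2 ^ E\<close> lost to rounding in
  \<open>b ^ E\<close>.\<close>

lemma global_space_bound:
  fixes lg :: real
  assumes n: "2 \<le> n" and E: "3 \<le> E" "3 / real E \<le> \<rho>" and lg: "1 \<le> lg"
  defines "b \<equiv> root_ceiling E n"
  shows "real (s * (5 * b ^ (E + 1 + guess_digits E b n (nat \<lceil>lg\<rceil>))))
     \<le> real s * 120 * 8 ^ E * (real n powr (1 + \<rho>) * lg\<^sup>2)"
proof -
  define L where "L = nat \<lceil>lg\<rceil>"
  define q where "q = guess_digits E b n L"
  define x where "x = real n powr (1 / real E)"
  have E0: "0 < E" using E by simp
  note rc = root_ceiling_bounds[OF n E0, folded b_def x_def]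
  have x1: "1 \<le> x" using n by (simp add: x_def ge_one_powr_ge_zero)
  have xE: "x ^ E = real n" using n E0 by (simp add: x_def powr_power)
  have x3: "x ^ 3 \<le> real n powr \<rho>"
  proof -
    have "x ^ 3 = real n powr (3 / real E)" using n by (simp add: x_def powr_power)
    also have "\<dots> \<le> real n powr \<rho>" using n E(2) by (intro powr_mono) auto
    finally show ?thesis .
  qed
  have L: "real L \<le> lg + 1" "lg \<le> real L" unfolding L_def using lg by linarith+
  have bE: "real b ^ E \<le> 2 ^ E * real n"
    using power_mono[OF rc(3), of E] by (simp add: power_mult_distrib xE)
  have b3: "real b ^ 3 \<le> 8 * real n powr \<rho>"
    using power_mono[OF rc(3), of 3] x3 by (simp add: power_mult_distrib)
  have n1: "real n * real n powr \<rho> = real n powr (1 + \<rho>)" using n by (simp add: powr_add)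
  have pos: "0 \<le> real n powr (1 + \<rho>) * lg\<^sup>2" by simp
  have "real (b ^ (E + 1 + q)) \<le> 24 * 8 ^ E * (real n powr (1 + \<rho>) * lg\<^sup>2)"
  proof (cases "Suc L \<le> n")
    case True
    have "b ^ q \<le> b ^ 2 * Suc L"
      unfolding q_def using E by (intro guess_digits_props(4)[OF rc(2) _ rc(1) True]) simp
    then have bq: "real b ^ q \<le> real b ^ 2 * real (Suc L)" by (metis of_nat_le_iff of_nat_mult of_nat_power)
    have "lg * 1 \<le> lg * lg" using lg by (intro mult_left_mono) auto
    then have "lg \<le> lg\<^sup>2" by (simp only: power2_eq_square mult_1_right)
    then have L3: "real (Suc L) \<le> 3 * lg\<^sup>2" using L(1) lg by simp
    have "real (b ^ (E + 1 + q)) = real b ^ E * real b * real b ^ q" by (simp add: power_add)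
    also have "\<dots> \<le> real b ^ E * real b * (real b ^ 2 * real (Suc L))" using bq by (intro mult_left_mono) auto
    also have "\<dots> = real b ^ E * (real b ^ 3 * real (Suc L))" by (simp add: power2_eq_square power3_eq_cube)
    also have "\<dots> \<le> (2 ^ E * real n) * ((8 * real n powr \<rho>) * (3 * lg\<^sup>2))"
      using bE b3 L3 by (intro mult_mono) auto
    also have "\<dots> = 24 * 2 ^ E * (real n powr (1 + \<rho>) * lg\<^sup>2)" unfolding n1[symmetric] by simp
    also have "\<dots> \<le> 24 * 8 ^ E * (real n powr (1 + \<rho>) * lg\<^sup>2)"
      using pos by (intro mult_right_mono mult_left_mono power_mono) auto
    finally show ?thesis .
  next
    case False
    then have q: "q = 2 * E" by (simp add: q_def guess_digits_def)
    have "real n \<le> 2 * lg" using False L n by linarith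
    then have n2: "real n ^ 2 \<le> 4 * lg\<^sup>2" using power_mono[of "real n" "2 * lg" 2] by (simp add: power_mult_distrib)
    have "x ^ 1 \<le> x ^ 3" using x1 by (intro power_increasing) auto
    then have b1: "real b \<le> 2 * real n powr \<rho>" using rc(3) x3 by simp
    have e: "E + 1 + q = E * 3 + 1" using q by simp
    have "real (b ^ (E + 1 + q)) = (real b ^ E) ^ 3 * real b"
      unfolding e power_add power_mult by simp
    also have "\<dots> \<le> (2 ^ E * real n) ^ 3 * (2 * real n powr \<rho>)"
      using bE b1 by (intro mult_mono power_mono) auto
    also have "\<dots> = 8 ^ E * (real n * real n powr \<rho>) * (2 * real n ^ 2)"
    proof -
      have "((2::real) ^ E) ^ 3 = (2 ^ 3) ^ E" by (simp only: power_mult[symmetric] mult.commute)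
      then show ?thesis by (simp add: power_mult_distrib power2_eq_square power3_eq_cube)
    qed
    also have "\<dots> \<le> 8 ^ E * (real n * real n powr \<rho>) * (2 * (4 * lg\<^sup>2))"
      using n2 by (intro mult_left_mono) auto
    also have "\<dots> = 8 * 8 ^ E * (real n powr (1 + \<rho>) * lg\<^sup>2)" unfolding n1 by simp
    also have "\<dots> \<le> 24 * 8 ^ E * (real n powr (1 + \<rho>) * lg\<^sup>2)"
      using pos by (intro mult_right_mono) auto
    finally show ?thesis .
  qed
  then have "real s * 5 * real (b ^ (E + 1 + q)) \<le> real s * 5 * (24 * 8 ^ E * (real n powr (1 + \<rho>) * lg\<^sup>2))"
    by (intro mult_left_mono) auto
  then show ?thesis by (simp add: q_def L_def mult.assoc)
qed

theorem mainTheorem1: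
  fixes \<delta> \<rho> :: real
  assumes "0 < \<delta>" "\<delta> < 1" "0 < \<rho>"
  shows "\<exists>c>0. \<forall>\<kappa>>0.
    \<exists>(A :: nat \<Rightarrow> nat \<Rightarrow> nat \<Rightarrow> (real ^ 'd) program)
      (S :: nat \<Rightarrow> nat) (M :: nat \<Rightarrow> real \<Rightarrow> nat) (R :: nat \<Rightarrow> nat)
      (\<alpha> :: nat \<Rightarrow> real) (g :: nat \<Rightarrow> real) (K :: real) (e :: nat) (b :: nat) (a :: real).
      (\<lambda>n. real (S n)) \<in> O(\<lambda>n. real n powr \<delta>) \<and>
      (\<lambda>n. real (R n)) \<in> O(\<lambda>n. log 2 (log 2 (real n))) \<and>
      \<alpha> \<in> O(\<lambda>n. real (log_star n)) \<and>
      g \<in> o(\<lambda>k. real k) \<and>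
      a > 0 \<and>
      (\<forall>\<^sub>F n in sequentially. \<forall>k (P :: (real ^ 'd) set).
         k < n \<and> real k \<ge> \<kappa> * log 2 (real n) powr c \<and>
         finite P \<and> card P = n \<and> min_separation P = 1 \<longrightarrow>
         (let s = CARD('d); \<Delta> = diameter P; m = M n \<Delta>; T = m * S n;
              f = real n powr (1 + \<rho>) * (log 2 \<Delta>)\<^sup>2
          in real T \<le> K * f * log 2 f ^ e \<and>
             (\<exists>c\<^sub>0. input_config P s m (S n) c\<^sub>0) \<and>
             (\<forall>c\<^sub>0. input_config P s m (S n) c\<^sub>0 \<longrightarrow>
                mpc_respects (A n k m) P s (T ^ b) m (S n) (R n) c\<^sub>0 \<and>
                measure_pmf.prob (mpc_run (A n k m) m (R n) c\<^sub>0)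
                  {c'. let C = mpc_output m c' in
                     C \<noteq> {} \<and> C \<subseteq> P \<and> real (card C) \<le> real k + g k \<and>
                     kcenter_cost P C \<le> \<alpha> n * kcenter_opt P k}
                  \<ge> 1 - 1 / real n powr a)))"
proof -
  let ?d = "CARD('d)"
  \<comment> \<open>\<open>3 / \<delta>\<close> fits the \<open>b ^ 3\<close> cells of a machine
    into \<open>O(n powr \<delta>)\<close>, \<open>3 / \<rho>\<close> fits the slack
    \<open>b ^ 3\<close> of the global space into \<open>n powr \<rho>\<close>, and the summand 3
    makes a copy fill at least one machine.\<close>
  define E where "E = nat \<lceil>3 / \<delta>\<rceil> + nat \<lceil>3 / \<rho>\<rceil> + 3"
  have E: "3 \<le> E" "3 / real E \<le> \<delta>" "3 / real E \<le> \<rho>"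
  proof -
    have "3 / \<delta> \<le> real E" "3 / \<rho> \<le> real E" unfolding E_def by linarith+
    moreover have "0 < real E" by (simp add: E_def)
    ultimately show "3 / real E \<le> \<delta>" "3 / real E \<le> \<rho>" using assms by (simp_all add: divide_le_eq mult.commute)
  qed (simp add: E_def)
  \<comment> \<open>The summand 2 ensures \<open>X n \<ge> 2\<close> for all \<open>n\<close>, so
    that a ball meets at most two layers of cells per coordinate.\<close>
  define X where "X n = log_star n + 2" for n
  define b where "b n = root_ceiling E n" for n
  define S where "S n = ?d * (5 * b n ^ 3)" for n
  define Q where "Q n \<Delta> = guess_digits E (b n) n (nat \<lceil>log 2 \<Delta>\<rceil>)" for n and \<Delta> :: real
  define M where "M n \<Delta> = b n ^ (E + Q n \<Delta> - 2)" for n \<Delta>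
  define R where "R n = Suc (kcenter_rounds E)" for n :: nat
  define c\<^sub>d where "c\<^sub>d = real ?d * 2 ^ Suc ?d"
  define g where "g k = real k * (c\<^sub>d / real (tail_min X k))" for k
  define \<alpha> where "\<alpha> n = 2 * real ?d * real (X n)" for n
  define mm where "mm n k = nat \<lfloor>real k + real k * c\<^sub>d / real (X n)\<rfloor>" for n k
  define good where "good n k m A \<longleftrightarrow> (\<forall>P c\<^sub>0. finite P \<longrightarrow> card P = n \<longrightarrow> min_separation P = 1 \<longrightarrow>
      M n (diameter P) = m \<longrightarrow> input_config P ?d m (S n) c\<^sub>0 \<longrightarrow>
      mpc_respects A P ?d (m * S n) m (S n) (R n) c\<^sub>0 \<and>
      (\<exists>c. mpc_run A m (R n) c\<^sub>0 = return_pmf c \<and>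
        (let C = mpc_output m c in C \<noteq> {} \<and> C \<subseteq> P \<and> card C \<le> mm n k \<and>
          kcenter_cost P C \<le> \<alpha> n * kcenter_opt P k)))" for n k m and A :: "(real ^ 'd) program"
  \<comment> \<open>A program may depend on \<open>n\<close>, \<open>k\<close> and \<open>m\<close>,
    but not on the input. \<open>good\<close> asks it to serve all inputs whose diameter leads to
    \<open>m\<close> machines, and one such program is chosen.\<close>
  define A where "A n k m = (SOME A. good n k m A)" for n k m
  have Xlim: "filterlim X at_top sequentially"
    unfolding filterlim_at_top
  proof
    fix j
    have "\<forall>\<^sub>F n in sequentially. j \<le> log_star n" using filterlim_log_star by (simp add: filterlim_at_top)
    then show "\<forall>\<^sub>F n in sequentially. j \<le> X n" by eventually_elim (simp add: X_def)
  qed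
  have c\<^sub>d: "0 < c\<^sub>d" by (simp add: c\<^sub>d_def)
  have S: "(\<lambda>n. real (S n)) \<in> O(\<lambda>n. real n powr \<delta>)"
  proof (rule bigoI[of _ "40 * real ?d"], rule eventually_sequentiallyI[of 2])
    fix n :: nat assume n: "2 \<le> n"
    have "real (b n) ^ 3 \<le> (2 * real n powr (1 / real E)) ^ 3"
      using root_ceiling_bounds(3)[OF n, of E] E by (intro power_mono) (auto simp: b_def)
    also have "\<dots> = 8 * real n powr (3 / real E)" using n by (simp add: power_mult_distrib powr_power)
    also have "\<dots> \<le> 8 * real n powr \<delta>" using n E by (intro mult_left_mono powr_mono) auto
    finally show "norm (real (S n)) \<le> 40 * real ?d * norm (real n powr \<delta>)" by (simp add: S_def mult_left_mono)
  qed
  have R: "(\<lambda>n. real (R n)) \<in> O(\<lambda>n. log 2 (log 2 (real n)))"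
  proof (rule bigoI[of _ "real (Suc (kcenter_rounds E))"])
    have "\<forall>\<^sub>F n in sequentially. 1 \<le> log 2 (log 2 (real n))" by real_asymp
    then show "\<forall>\<^sub>F n in sequentially. norm (real (R n)) \<le> real (Suc (kcenter_rounds E)) * norm (log 2 (log 2 (real n)))"
    proof eventually_elim
      case (elim n)
      have "real (Suc (kcenter_rounds E)) * 1 \<le> real (Suc (kcenter_rounds E)) * log 2 (log 2 (real n))"
        using elim by (intro mult_left_mono) auto
      then show ?case using elim by (simp add: R_def)
    qed
  qed
  have \<alpha>: "\<alpha> \<in> O(\<lambda>n. real (log_star n))"
  proof (rule bigoI[of _ "6 * real ?d"])
    have "\<forall>\<^sub>F n in sequentially. 1 \<le> log_star n" using filterlim_log_star by (simp add: filterlim_at_top)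
    then show "\<forall>\<^sub>F n in sequentially. norm (\<alpha> n) \<le> 6 * real ?d * norm (real (log_star n))"
    proof eventually_elim
      case (elim n)
      then have "real (X n) \<le> 3 * real (log_star n)" by (simp add: X_def)
      then have "2 * real ?d * real (X n) \<le> 2 * real ?d * (3 * real (log_star n))" by (intro mult_left_mono) auto
      then show ?case by (simp add: \<alpha>_def)
    qed
  qed
  have g: "g \<in> o(\<lambda>k. real k)"
  proof (rule smalloI_tendsto)
    have "filterlim (\<lambda>k. real (tail_min X k)) at_top sequentially"
      using filterlim_compose[OF filterlim_real_sequentially filterlim_tail_min[OF Xlim]] .
    then have "((\<lambda>k. c\<^sub>d / real (tail_min X k)) \<longlongrightarrow> 0) sequentially"
      by (intro tendsto_divide_0[OF tendsto_const] filterlim_at_top_imp_at_infinity)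
    moreover have "\<forall>\<^sub>F k in sequentially. g k / real k = c\<^sub>d / real (tail_min X k)"
      using eventually_gt_at_top[of 0] by eventually_elim (simp add: g_def)
    ultimately show "((\<lambda>k. g k / real k) \<longlongrightarrow> 0) sequentially" by (simp add: tendsto_cong)
    show "\<forall>\<^sub>F k in sequentially. real k \<noteq> 0" using eventually_gt_at_top[of 0] by eventually_elim simp
  qed
  \<comment> \<open>This lets a single digit number the shifts.\<close>
  have Xb: "\<forall>\<^sub>F n in sequentially. X n \<le> b n"
  proof -
    have "0 < 1 / real E" using E by simp
    then have "\<forall>\<^sub>F n in sequentially. log 2 (real n) + 3 \<le> real n powr (1 / real E)" by real_asymp
    moreover have "\<forall>\<^sub>F n in sequentially. 1 \<le> (n::nat)" by (rule eventually_ge_at_top)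
    ultimately show ?thesis
    proof eventually_elim
      case (elim n)
      then have "real (X n) \<le> real n powr (1 / real E)" using log_star_le_log[of n] by (simp add: X_def)
      also have "\<dots> \<le> real (b n)" unfolding b_def root_ceiling_def by linarith
      finally show ?case by simp
    qed
  qed
  have good: "good n k m (A n k m)" if n: "2 \<le> n" "X n \<le> b n" and k: "0 < k" "k < n" for n k m
  proof (cases "\<exists>P :: (real ^ 'd) set. M n (diameter P) = m")
    case True
    then obtain P\<^sub>0 :: "(real ^ 'd) set" where P\<^sub>0: "M n (diameter P\<^sub>0) = m" by blast
    define q where "q = Q n (diameter P\<^sub>0)"
    have E0: "0 < E" "2 \<le> E" using E by auto
    note rc = root_ceiling_bounds[OF n(1) E0(1), folded b_def]
    note gd = guess_digits_props[OF rc(2) E0(2) rc(1)]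
    have q: "q \<le> E \<or> q = 2 * E" "2 \<le> q" unfolding q_def Q_def using gd by auto
    \<comment> \<open>The number of machines determines \<open>q\<close>, so all inputs with the
      same \<open>m\<close> share one program.\<close>
    have qP: "Q n (diameter P) = q" if "M n (diameter P) = m" for P :: "(real ^ 'd) set"
    proof -
      have "b n ^ (E + Q n (diameter P) - 2) = b n ^ (E + q - 2)" using that P\<^sub>0 by (simp add: M_def q_def)
      then have "E + Q n (diameter P) - 2 = E + q - 2" using rc(2) by (simp add: power_inject_exp)
      moreover have "2 \<le> Q n (diameter P)" unfolding Q_def using gd by auto
      ultimately show ?thesis using q(2) by simp
    qed
    have m: "m = b n ^ (E + q - 2)" using P\<^sub>0 by (simp add: M_def q_def)
    have X2: "2 \<le> X n" by (simp add: X_def)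
    have "real k + real k * (real ?d * 2 ^ Suc ?d) / real (X n) < real (mm n k) + 1"
      unfolding mm_def c\<^sub>d_def by linarith
    from kcenter_program[OF rc(2) E(1) q X2 n(2) this]
    obtain A' :: "(real ^ 'd) program" where A': "\<forall>P c\<^sub>0 Bd.
       finite P \<longrightarrow> 0 < k \<longrightarrow> k < card P \<longrightarrow> card P \<le> b n ^ E \<longrightarrow> min_separation P = 1 \<longrightarrow>
       (q \<le> E \<longrightarrow> log 2 (diameter P) \<le> real (b n ^ q - 1)) \<longrightarrow> 2 * b n ^ (E + 1 + q) \<le> Bd \<longrightarrow>
       input_config P ?d m (S n) c\<^sub>0 \<longrightarrow>
       mpc_respects A' P ?d Bd m (S n) (R n) c\<^sub>0 \<and>
       (\<exists>c. mpc_run A' m (R n) c\<^sub>0 = return_pmf c \<and>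
          (let C = mpc_output m c in C \<noteq> {} \<and> C \<subseteq> P \<and> card C \<le> mm n k \<and>
            kcenter_cost P C \<le> 2 * real ?d * real (X n) * kcenter_opt P k))"
      unfolding m[symmetric] S_def[of n, symmetric] R_def[of n, symmetric] by (rule exE) (rule that)
    have "good n k m A'"
      unfolding good_def \<alpha>_def
    proof (intro allI impI, rule A'[rule_format])
      fix P :: "(real ^ 'd) set" and c\<^sub>0
      assume P: "finite P" "card P = n" "min_separation P = 1" "M n (diameter P) = m"
        and inp: "input_config P ?d m (S n) c\<^sub>0"
      show "finite P" "min_separation P = 1" "input_config P ?d m (S n) c\<^sub>0" "0 < k" by fact+
      show "k < card P" "card P \<le> b n ^ E" using P k rc(1) by auto
      have "E + q - 2 + 3 = E + 1 + q" using q(2) by simp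
      then have "m * S n = ?d * (5 * b n ^ (E + 1 + q))"
        unfolding m S_def by (metis (no_types, lifting) mult.assoc mult.left_commute power_add)
      \<comment> \<open>All numbers that occur are at most \<open>2 * b ^ (E + 1 + q)\<close>, which
        is within the global space itself; so the exponent of the word bound can be 1.\<close>
      moreover have "1 * (2 * b n ^ (E + 1 + q)) \<le> ?d * (5 * b n ^ (E + 1 + q))"
        by (intro mult_mono) (auto simp: Suc_le_eq)
      ultimately show "2 * b n ^ (E + 1 + q) \<le> m * S n" by simp
      assume qE: "q \<le> E"
      have "nat \<lceil>log 2 (diameter P)\<rceil> < b n ^ q"
        using gd(3)[of "nat \<lceil>log 2 (diameter P)\<rceil>"] qE qP[OF P(4)] by (simp add: Q_def)
      then have "nat \<lceil>log 2 (diameter P)\<rceil> \<le> b n ^ q - 1" by (metis Suc_leI diff_Suc_1 diff_le_mono)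
      then have "real (nat \<lceil>log 2 (diameter P)\<rceil>) \<le> real (b n ^ q - 1)" by (rule of_nat_mono)
      then show "log 2 (diameter P) \<le> real (b n ^ q - 1)" by (rule order_trans[OF real_nat_ceiling_ge])
    qed
    then show ?thesis unfolding A_def by (rule someI[of "good n k m"])
  next
    case False
    then have "good n k m A'" for A' by (simp add: good_def)
    then show ?thesis .
  qed
  have key: "(let s = ?d; \<Delta> = diameter P; m = M n \<Delta>; T = m * S n;
              f = real n powr (1 + \<rho>) * (log 2 \<Delta>)\<^sup>2
          in real T \<le> (real ?d * 120 * 8 ^ E) * f * log 2 f ^ 0 \<and>
             (\<exists>c\<^sub>0. input_config P s m (S n) c\<^sub>0) \<and>
             (\<forall>c\<^sub>0. input_config P s m (S n) c\<^sub>0 \<longrightarrow>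
                mpc_respects (A n k m) P s (T ^ 1) m (S n) (R n) c\<^sub>0 \<and>
                measure_pmf.prob (mpc_run (A n k m) m (R n) c\<^sub>0)
                  {c'. let C = mpc_output m c' in
                     C \<noteq> {} \<and> C \<subseteq> P \<and> real (card C) \<le> real k + g k \<and>
                     kcenter_cost P C \<le> \<alpha> n * kcenter_opt P k}
                  \<ge> 1 - 1 / real n powr 1))"
    if n: "2 \<le> n" "X n \<le> b n" "(4 * ?d + 1) ^ ?d < n" and k: "k < n" "real k \<ge> \<kappa> * log 2 (real n) powr 1"
      and \<kappa>: "0 < \<kappa>" and P: "finite P" "card P = n" "min_separation P = 1" for n k \<kappa> and P :: "(real ^ 'd) set"
  proof -
    define \<Delta> where "\<Delta> = diameter P"
    define m where "m = M n \<Delta>"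
    define q where "q = Q n \<Delta>"
    have E0: "0 < E" "2 \<le> E" using E by auto
    note rc = root_ceiling_bounds[OF n(1) E0(1), folded b_def]
    note gd = guess_digits_props[OF rc(2) E0(2) rc(1)]
    have q2: "2 \<le> q" unfolding q_def Q_def using gd by auto
    have "0 < log 2 (real n)" using n(1) by simp
    then have "0 < \<kappa> * log 2 (real n) powr 1" using \<kappa> by simp
    then have k0: "0 < k" using k(2) by linarith
    have "2 \<le> \<Delta>"
    proof (rule ccontr)
      assume "\<not> 2 \<le> \<Delta>"
      then show False using card_le_of_diameter_less_two[of P] P n(3) by (simp add: \<Delta>_def)
    qed
    then have lg: "1 \<le> log 2 \<Delta>" by (subst le_log_iff) auto
    have "E + q - 2 + 3 = E + 1 + q" using q2 by simp
    then have T: "m * S n = ?d * (5 * b n ^ (E + 1 + q))"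
      unfolding m_def M_def q_def[symmetric] S_def by (metis (no_types, lifting) mult.assoc mult.left_commute power_add)
    have space: "real (m * S n) \<le> real ?d * 120 * 8 ^ E * (real n powr (1 + \<rho>) * (log 2 \<Delta>)\<^sup>2)"
      unfolding T q_def Q_def b_def by (rule global_space_bound[OF n(1) E(1,3) lg])
    have "n \<le> m"
    proof -
      have "b n ^ E \<le> m" unfolding m_def M_def q_def[symmetric] using q2 rc(2) by (intro power_increasing) auto
      then show ?thesis using rc(1) by simp
    qed
    then have inp: "\<exists>c\<^sub>0. input_config P ?d m (S n) c\<^sub>0"
      unfolding S_def using P rc(2) by (intro input_config_exists) auto
    have run: "mpc_respects (A n k m) P ?d ((m * S n) ^ 1) m (S n) (R n) c\<^sub>0 \<and>
        1 - 1 / real n powr 1 \<le> measure_pmf.prob (mpc_run (A n k m) m (R n) c\<^sub>0)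
                  {c'. let C = mpc_output m c' in
                     C \<noteq> {} \<and> C \<subseteq> P \<and> real (card C) \<le> real k + g k \<and>
                     kcenter_cost P C \<le> \<alpha> n * kcenter_opt P k}"
      if c\<^sub>0: "input_config P ?d m (S n) c\<^sub>0" for c\<^sub>0
    proof -
      have "M n (diameter P) = m" by (simp add: m_def \<Delta>_def)
      from good[OF n(1,2) k0 k(1), of m, unfolded good_def, rule_format, OF P this c\<^sub>0]
      obtain c where resp: "mpc_respects (A n k m) P ?d (m * S n) m (S n) (R n) c\<^sub>0"
        and c: "mpc_run (A n k m) m (R n) c\<^sub>0 = return_pmf c"
        and C: "mpc_output m c \<noteq> {}" "mpc_output m c \<subseteq> P" "card (mpc_output m c) \<le> mm n k"
          "kcenter_cost P (mpc_output m c) \<le> \<alpha> n * kcenter_opt P k"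
        unfolding Let_def by blast
      have "2 \<le> tail_min X k" by (intro le_tail_min) (simp add: X_def)
      then have "c\<^sub>d / real (X n) \<le> c\<^sub>d / real (tail_min X k)"
        using tail_min_le[of k n X] k(1) c\<^sub>d by (intro divide_left_mono) auto
      then have "real k * (c\<^sub>d / real (X n)) \<le> g k" unfolding g_def by (intro mult_left_mono) auto
      moreover have "0 \<le> real k + real k * c\<^sub>d / real (X n)" using c\<^sub>d by simp
      then have "real (mm n k) \<le> real k + real k * c\<^sub>d / real (X n)" unfolding mm_def by linarith
      ultimately have "real (card (mpc_output m c)) \<le> real k + g k" using C(3) by simp
      then have "measure_pmf.prob (return_pmf c) {c'. let C = mpc_output m c' in
                     C \<noteq> {} \<and> C \<subseteq> P \<and> real (card C) \<le> real k + g k \<and>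
                     kcenter_cost P C \<le> \<alpha> n * kcenter_opt P k} = 1"
        using C by (simp add: measure_return_pmf Let_def)
      then show ?thesis using resp c by simp
    qed
    show ?thesis
      unfolding Let_def \<Delta>_def[symmetric] m_def[symmetric] using space inp run[unfolded Let_def] by simp
  qed
  show ?thesis
  \<comment> \<open>The witness for \<open>c\<close> is 1. The space bound has no logarithmic
    factor, so \<open>e\<close> is 0, and the run is deterministic, so the success probability is 1
    and \<open>a = 1\<close> will do.\<close>
  proof (rule exI[of _ 1], intro conjI allI impI, goal_cases)
    case (2 \<kappa>)
    have ev: "\<forall>\<^sub>F n in sequentially. 2 \<le> n \<and> X n \<le> b n \<and> (4 * ?d + 1) ^ ?d < n"
      using Xb eventually_ge_at_top[of 2] eventually_gt_at_top[of "(4 * ?d + 1) ^ ?d"] by eventually_elim simp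
    show ?case
      by (rule exI[of _ A], rule exI[of _ S], rule exI[of _ M], rule exI[of _ R], rule exI[of _ \<alpha>],
          rule exI[of _ g], rule exI[of _ "real ?d * 120 * 8 ^ E"], rule exI[of _ 0], rule exI[of _ 1],
          rule exI[of _ 1], intro conjI S R \<alpha> g zero_less_one, rule eventually_mono[OF ev], intro allI impI,
          elim conjE, rule key[OF _ _ _ _ _ 2])
  qed simp
qed

end
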